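(* Let $m\ge2$, $L>0$, $\mathbb T^m=\mathbb R^m/(2\pi\mathbb Z)^m$, and $M=[0,L]\times\mathbb T^m$. For $j=1,2$ let $$g_j=dt^2+h_{j,\alpha\beta}(t)\,dy^\alpha dy^\beta,\qquad h_j\in C^\infty([0,L];\mathrm{Sym}_m^+),$$ in the fixed product coordinates $(t,y)$. If the full Dirichlet-to-Neumann maps of $g_1$ and $g_2$, expressed in the common boundary Fourier basis, agree on $\{0,L\}\times\mathbb T^m$, then $h_1(t)=h_2(t)$ for every $0\le t\le L$.
   Context: $\mathrm{Sym}_m^+$ denotes the real symmetric positive definite $m\times m$ matrices. For a smooth metric $g$ on $M$ and $f\in C^\infty(\partial M)$, the full Dirichlet-to-Neumann map is $\Lambda_gf=\partial_{\nu_g}u|_{\partial M}$, where $\Delta_gu=0$ in $M$, $u|_{\partial M}=f$, and $\nu_g$ is the outward $g$-unit normal. The boundary is $\partial M=\{0,L\}\times\mathbb T^m$, and the boundary Fourier basis is given by the functions $e^{ik\cdot y}$, $k\in\mathbb Z^m$, on each of the two components; both boundary components are identified by the identity for the two metrics. *)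

theory Defs
  imports "HOL-Analysis.Analysis"
begin

section \<open>Smooth functions up to the boundary\<close>

text \<open>
  Derivatives are taken within \<open>S\<close>. They are unique when \<open>S\<close> is convex with nonempty interior, in
  particular for \<open>{0..L}\<close> and for the slab below, where one gets functions all of whose derivatives
  exist and are continuous up to the boundary.
\<close>

primrec Ck_on :: "nat \<Rightarrow> 'a::real_normed_vector set \<Rightarrow> ('a \<Rightarrow> 'b::real_normed_vector) \<Rightarrow> bool" where
  "Ck_on 0 S f \<longleftrightarrow> continuous_on S f"
| "Ck_on (Suc k) S f \<longleftrightarrow>
     (\<exists>f'. (\<forall>x\<in>S. (f has_derivative f' x) (at x within S)) \<and> (\<forall>v. Ck_on k S (\<lambda>x. f' x v)))"

definition smooth_on :: "'a::real_normed_vector set \<Rightarrow> ('a \<Rightarrow> 'b::real_normed_vector) \<Rightarrow> bool" where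
  "smooth_on S f \<longleftrightarrow> (\<forall>k. Ck_on k S f)"

definition partial_within ::
    "'d::finite \<Rightarrow> (real^'d) set \<Rightarrow> (real^'d \<Rightarrow> 'b::real_normed_vector) \<Rightarrow> real^'d \<Rightarrow> 'b" where
  "partial_within i S u x = frechet_derivative u (at x within S) (axis i 1)"


section \<open>Riemannian metrics in coordinates\<close>

text \<open>
  A metric is given by its coefficient matrix at each point. The Laplacian is
  \<open>|g|\<^sup>-\<^sup>1\<^sup>/\<^sup>2 \<partial>\<^sub>i (|g|\<^sup>1\<^sup>/\<^sup>2 g\<^sup>i\<^sup>j \<partial>\<^sub>j u)\<close>.
\<close>

type_synonym 'd metric = "real^'d \<Rightarrow> real^'d^'d"

definition metric_inner :: "'d::finite metric \<Rightarrow> real^'d \<Rightarrow> real^'d \<Rightarrow> real^'d \<Rightarrow> real" where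
  "metric_inner g x v w = v \<bullet> (g x *v w)"

definition laplace_beltrami ::
    "(real^'d) set \<Rightarrow> 'd::finite metric \<Rightarrow> (real^'d \<Rightarrow> complex) \<Rightarrow> real^'d \<Rightarrow> complex" where
  "laplace_beltrami S g u x =
     (1 / sqrt (det (g x))) *\<^sub>R
     (\<Sum>i\<in>UNIV. partial_within i S
        (\<lambda>z. \<Sum>j\<in>UNIV. (sqrt (det (g z)) * matrix_inv (g z) $ i $ j) *\<^sub>R partial_within j S u z) x)"


section \<open>The cylinder\<close>

text \<open>
  Points \<open>(t, y)\<close> are vectors indexed by \<open>'n option\<close>: the coordinate \<open>None\<close> is \<open>t\<close> and \<open>Some \<alpha>\<close> is
  \<open>y\<^sup>\<alpha>\<close>. Functions on \<open>[0,L] \<times> \<real>\<^sup>m/(2\<pi>\<int>)\<^sup>m\<close> are functions on the slab \<open>[0,L] \<times> \<real>\<^sup>m\<close> that are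
  \<open>2\<pi>\<close>-periodic in each \<open>y\<^sup>\<alpha>\<close>.
\<close>

definition point :: "real \<Rightarrow> real^'n \<Rightarrow> real^('n::finite option)" where
  "point t y = (\<chi> i. case i of None \<Rightarrow> t | Some \<alpha> \<Rightarrow> y $ \<alpha>)"

definition torus_part :: "real^('n::finite option) \<Rightarrow> real^'n" where
  "torus_part x = (\<chi> \<alpha>. x $ Some \<alpha>)"

definition slab :: "real \<Rightarrow> (real^('n::finite option)) set" where
  "slab L = {x. 0 \<le> x $ None \<and> x $ None \<le> L}"

definition slab_boundary :: "real \<Rightarrow> (real^('n::finite option)) set" where
  "slab_boundary L = {x. x $ None \<in> {0, L}}"

definition torus_periodic :: "real \<Rightarrow> (real^('n::finite option) \<Rightarrow> 'b) \<Rightarrow> bool" where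
  "torus_periodic L u \<longleftrightarrow> (\<forall>x\<in>slab L. \<forall>\<alpha>. u (x + axis (Some \<alpha>) (2 * pi)) = u x)"

definition Sym_pos :: "(real^'n^'n) set" where
  "Sym_pos = {A. transpose A = A \<and> (\<forall>v. v \<noteq> 0 \<longrightarrow> v \<bullet> (A *v v) > 0)}"

definition product_metric :: "(real \<Rightarrow> real^'n^'n) \<Rightarrow> ('n::finite option) metric" where
  "product_metric h x = (\<chi> i j. case (i, j) of
       (None, None) \<Rightarrow> 1
     | (Some \<alpha>, Some \<beta>) \<Rightarrow> h (x $ None) $ \<alpha> $ \<beta>
     | _ \<Rightarrow> 0)"


section \<open>The Dirichlet-to-Neumann map\<close>

definition outward_unit_normal ::
    "real \<Rightarrow> ('n::finite option) metric \<Rightarrow> real^('n option) \<Rightarrow> real^('n option)" where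
  "outward_unit_normal L g x = (THE v.
     metric_inner g x v v = 1 \<and>
     (\<forall>w. w $ None = 0 \<longrightarrow> metric_inner g x v w = 0) \<and>
     (if x $ None = L then v $ None > 0 else v $ None < 0))"

definition dirichlet_solution ::
    "real \<Rightarrow> ('n::finite option) metric \<Rightarrow> (real^('n option) \<Rightarrow> complex)
      \<Rightarrow> (real^('n option) \<Rightarrow> complex) \<Rightarrow> bool" where
  "dirichlet_solution L g f u \<longleftrightarrow>
     smooth_on (slab L) u \<and> torus_periodic L u \<and>
     (\<forall>x\<in>slab L. laplace_beltrami (slab L) g u x = 0) \<and>
     (\<forall>x\<in>slab_boundary L. u x = f x)"

text \<open>
  For smooth periodic boundary data \<open>f\<close> the Dirichlet problem has a solution, unique on the slab.
  The choice below is only between extensions of it outside the slab, which do not affect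
  the derivative within the slab. Only the values of \<open>dn_map L g f\<close> on \<open>slab_boundary L\<close> matter.
\<close>

definition dn_map ::
    "real \<Rightarrow> ('n::finite option) metric \<Rightarrow> (real^('n option) \<Rightarrow> complex)
      \<Rightarrow> (real^('n option) \<Rightarrow> complex)" where
  "dn_map L g f x =
     frechet_derivative (SOME u. dirichlet_solution L g f u) (at x within slab L)
       (outward_unit_normal L g x)"


section \<open>The boundary Fourier basis\<close>

definition fourier_mode :: "int^'n \<Rightarrow> real^'n::finite \<Rightarrow> complex" where
  "fourier_mode k y = exp (\<i> * of_real (\<Sum>\<alpha>\<in>UNIV. of_int (k $ \<alpha>) * y $ \<alpha>))"

definition boundary_mode :: "real \<Rightarrow> int^'n \<Rightarrow> real^('n::finite option) \<Rightarrow> complex" where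
  "boundary_mode s k x = (if x $ None = s then fourier_mode k (torus_part x) else 0)"

text \<open>Fourier coefficient at frequency \<open>l\<close> on the boundary component \<open>{r} \<times> \<real>\<^sup>m/(2\<pi>\<int>)\<^sup>m\<close>.\<close>

definition boundary_coeff ::
    "real \<Rightarrow> int^'n \<Rightarrow> (real^('n::finite option) \<Rightarrow> complex) \<Rightarrow> complex" where
  "boundary_coeff r l q =
     integral (cbox 0 (\<chi> \<alpha>. 2 * pi)) (\<lambda>y. q (point r y) * cnj (fourier_mode l y))
       / of_real ((2 * pi) ^ CARD('n))"

definition dn_matrix ::
    "real \<Rightarrow> ('n::finite option) metric \<Rightarrow> real \<times> (int^'n) \<Rightarrow> real \<times> (int^'n) \<Rightarrow> complex" where
  "dn_matrix L g = (\<lambda>(r, l) (s, k). boundary_coeff r l (dn_map L g (boundary_mode s k)))"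

end

(*
  Separating variables, the mode with frequency k solves (W a')' = W q a, where W = sqrt (det h) and
  q = h^-1(k, k), and the Dirichlet-to-Neumann data determine the endpoint derivatives of a. In the
  variable x in [0, 1] with dt/dx = T W this is the string equation phi'' = P phi with
  P = T^2 W^2 q, and the zero mode provides the normalisation T W at both ends. Passing from k to n k
  multiplies P by n^2, so an inverse theorem for the string yields T^2 W^2 h^-1 as a function of x.
  For m >= 2 taking determinants separates W from h: two metrics with the same data satisfy
  h_2 = c h_1 with c^(m-1) constant, hence c = 1, and then dt/dx is the same for both.

  Inverse theorem for the string: if P_1 and P_2 have the same data for all n, then (P_1 - P_2) u_1 u_2
  integrates to zero for all solutions u_j of u'' = n^2 P_j u. For the solutions that decay in the
  optical variable s (s' = sqrt P), write u_j = exp(- n s_j) (a_j + b_j) / (2 P_j^(1/4)). The four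
  products of a_1, b_1 with a_2, b_2 solve a linear transport system whose phases do not depend on n.
  Taking linear combinations over n turns exp(- n z) into an arbitrary function f (Weierstrass), and
  an a priori estimate for the transport system, uniform in f, shows that u_1 u_2 acts on f like the
  evaluation f(s_1 + s_2) up to a Volterra term. Testing with narrow tents forces P_1 = P_2.
*)
theory Submission
  imports Defs
begin

text \<open>The frequency is the only spectral parameter, and the torus restricts it to integer
  multiples \<open>n\<close> of a lattice vector, so information at integers must be converted into
  information at a point. Sums of \<open>l n * exp (- n z)\<close> approximate a narrow tent, but
  there is no control over the coefficients \<open>l n\<close>, and an error bound taken term by
  term in \<open>n\<close> is worthless. The way out is that \<open>n\<close> enters the transport
  system linearly and through the phases only: after summation over \<open>n\<close> the factor
  \<open>exp (- n p)\<close> is a shift of \<open>z\<close> by \<open>p\<close>, and the source of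
  the summed system is the profile \<open>exp_sum l N\<close> itself. The profile feeds only
  components whose phase has slope at least \<delta>, so it enters the estimate through an
  antiderivative. A tent of mass \<open>h^2\<close> therefore meets an error that is again of order
  \<open>h^2\<close>, but spread essentially over the points to the left of the test point; an
  exponential weight makes that part small. The determinant argument has no content for
  \<open>m = 1\<close>: the cylinder is then a surface, and its harmonic functions see the metric
  only up to a conformal factor.\<close>

section \<open>Linear systems of ordinary differential equations\<close>

text \<open>Terms of the Picard series for the system \<open>y c' = f c * y (\<not> c)\<close> with
  initial values \<open>A c\<close>. The system is off-diagonal, so every term is a single iterated
  integral with alternating factors, and a Boolean can serve as the index.\<close>

primrec picard :: "(bool \<Rightarrow> real \<Rightarrow> real) \<Rightarrow> (bool \<Rightarrow> real) \<Rightarrow> real \<Rightarrow> nat \<Rightarrow> bool \<Rightarrow> real \<Rightarrow> real" where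
  "picard f A a 0 c x = A c"
| "picard f A a (Suc j) c x = integral {a..x} (\<lambda>t. f c t * picard f A a j (\<not> c) t)"

lemma continuous_on_picard:
  assumes "\<And>c. continuous_on {a..b} (f c)"
  shows "continuous_on {a..b} (picard f A a j c)"
proof (induction j arbitrary: c)
  case (Suc j)
  have "continuous_on {a..b} (\<lambda>t. f c t * picard f A a j (\<not> c) t)"
    by (intro continuous_intros assms Suc)
  then show ?case
    using indefinite_integral_continuous_1 integrable_continuous_real by fastforce
qed auto

lemma picard_derivative:
  assumes "\<And>c. continuous_on {a..b} (f c)" and "x \<in> {a..b}"
  shows "(picard f A a (Suc j) c has_real_derivative f c x * picard f A a j (\<not> c) x) (at x within {a..b})"
proof -
  have "continuous_on {a..b} (\<lambda>t. f c t * picard f A a j (\<not> c) t)"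
    by (intro continuous_intros assms continuous_on_picard)
  from integral_has_real_derivative[OF this assms(2)] show ?thesis
    by (rule has_field_derivative_transform_within[OF _ zero_less_one]) (use assms in auto)
qed

text \<open>Each integration turns \<open>(t - a) ^ j / fact j\<close> into the next power over the
  next factorial, which makes the series converge on the whole interval for any size of
  \<open>M\<close>.\<close>

lemma picard_bound:
  assumes cont: "\<And>c. continuous_on {a..b} (f c)"
    and M: "\<And>c t. t \<in> {a..b} \<Longrightarrow> \<bar>f c t\<bar> \<le> M" and A: "\<And>c. \<bar>A c\<bar> \<le> K" and "x \<in> {a..b}"
  shows "\<bar>picard f A a j c x\<bar> \<le> K * ((M * (x - a)) ^ j / fact j)"
  using \<open>x \<in> {a..b}\<close>
proof (induction j arbitrary: c x)
  case (Suc j)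
  have M0: "0 \<le> M" using M[of a True] Suc.prems by force
  have K0: "0 \<le> K" using A[of True] by linarith
  have sub: "{a..x} \<subseteq> {a..b}" using Suc.prems by auto
  have ci: "continuous_on {a..x} (\<lambda>t. f c t * picard f A a j (\<not> c) t)"
    by (rule continuous_on_subset[OF _ sub]) (intro continuous_intros assms continuous_on_picard)
  define H where "H t = K * M ^ Suc j * ((t - a) ^ Suc j / fact (Suc j))" for t
  have "((\<lambda>t. K * M ^ Suc j * ((t - a) ^ j / fact j)) has_integral (H x - H a)) {a..x}"
  proof (rule fundamental_theorem_of_calculus)
    show "a \<le> x" using Suc.prems by auto
    fix t assume "t \<in> {a..x}"
    have "(H has_real_derivative K * M ^ Suc j * (real (Suc j) * (t - a) ^ j / fact (Suc j))) (at t within {a..x})"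
      unfolding H_def by (rule derivative_eq_intros refl | simp)+
    also have "real (Suc j) * (t - a) ^ j / fact (Suc j) = (t - a) ^ j / fact j"
      by (simp add: field_simps del: of_nat_Suc)
    finally show "(H has_vector_derivative K * M ^ Suc j * ((t - a) ^ j / fact j)) (at t within {a..x})"
      by (simp add: has_real_derivative_iff_has_vector_derivative)
  qed
  then have hi: "((\<lambda>t. K * M ^ Suc j * ((t - a) ^ j / fact j)) has_integral H x) {a..x}"
    by (simp add: H_def)
  have "norm (integral {a..x} (\<lambda>t. f c t * picard f A a j (\<not> c) t))
      \<le> integral {a..x} (\<lambda>t. K * M ^ Suc j * ((t - a) ^ j / fact j))"
  proof (rule integral_norm_bound_integral)
    show "(\<lambda>t. f c t * picard f A a j (\<not> c) t) integrable_on {a..x}"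
      using ci by (rule integrable_continuous_real)
    show "(\<lambda>t. K * M ^ Suc j * ((t - a) ^ j / fact j)) integrable_on {a..x}" using hi by blast
    fix t assume t: "t \<in> {a..x}"
    then have t': "t \<in> {a..b}" using sub by auto
    have "\<bar>f c t\<bar> * \<bar>picard f A a j (\<not> c) t\<bar> \<le> M * (K * ((M * (t - a)) ^ j / fact j))"
      by (intro mult_mono M[OF t'] Suc.IH[OF t'] M0) auto
    then show "norm (f c t * picard f A a j (\<not> c) t) \<le> K * M ^ Suc j * ((t - a) ^ j / fact j)"
      by (simp add: abs_mult power_mult_distrib mult_ac)
  qed
  also have "\<dots> = H x" using hi by blast
  finally show ?case by (simp add: H_def power_mult_distrib mult_ac)
qed (use A in auto)

lemma linear_system_exists:
  fixes f g :: "real \<Rightarrow> real"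
  assumes "a \<le> b" and f: "continuous_on {a..b} f" and g: "continuous_on {a..b} g"
  obtains u v where "u a = A" "v a = B"
    "\<And>x. x \<in> {a..b} \<Longrightarrow> (u has_real_derivative f x * v x) (at x within {a..b})"
    "\<And>x. x \<in> {a..b} \<Longrightarrow> (v has_real_derivative g x * u x) (at x within {a..b})"
proof -
  define F where "F c = (if c then f else g)" for c
  define A' where "A' c = (if c then A else B)" for c
  define U where "U = picard F A' a"
  have cF: "continuous_on {a..b} (F c)" for c using f g by (auto simp: F_def)
  have "bounded (f ` {a..b})" "bounded (g ` {a..b})"
    using f g by (auto intro!: compact_imp_bounded compact_continuous_image)
  then obtain M1 M2 where M1: "\<forall>y\<in>f ` {a..b}. norm y \<le> M1" and M2: "\<forall>y\<in>g ` {a..b}. norm y \<le> M2"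
    unfolding bounded_iff by blast
  define M where "M = max M1 M2"
  have M: "\<bar>F c t\<bar> \<le> M" if "t \<in> {a..b}" for c t
  proof -
    have "\<bar>f t\<bar> \<le> M1" "\<bar>g t\<bar> \<le> M2" using M1 M2 that by auto
    then show ?thesis by (auto simp: F_def M_def)
  qed
  have M0: "0 \<le> M" using M[of a True] assms by force
  define K where "K = max \<bar>A\<bar> \<bar>B\<bar>"
  have K: "\<bar>A' c\<bar> \<le> K" for c by (auto simp: A'_def K_def)
  have K0: "0 \<le> K" using K[of True] by linarith
  define R where "R j = K * ((M * (b - a)) ^ j / fact j)" for j
  have bd: "\<bar>U j c x\<bar> \<le> R j" if "x \<in> {a..b}" for j c x
  proof -
    have "\<bar>U j c x\<bar> \<le> K * ((M * (x - a)) ^ j / fact j)"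
      unfolding U_def by (rule picard_bound[OF cF M K that])
    also have "\<dots> \<le> R j" unfolding R_def
      using that K0 M0 by (intro mult_left_mono divide_right_mono power_mono) auto
    finally show ?thesis .
  qed
  have sR: "summable R"
    unfolding R_def using summable_exp[of "M * (b - a)"] by (intro summable_mult) (simp add: field_simps)
  \<comment> \<open>The derivatives of the terms: the initial term is constant, and differentiation
    shifts the others by one. The M-test is applied to these derivatives.\<close>
  define U' where "U' j c x = (case j of 0 \<Rightarrow> 0 | Suc i \<Rightarrow> F c x * U i (\<not> c) x)" for j c x
  define Y where "Y c x = (\<Sum>j. U j c x)" for c x
  have sU: "summable (\<lambda>j. U j c x)" if "x \<in> {a..b}" for c x
    by (rule summable_comparison_test'[OF sR, of 0]) (use bd[OF that] in auto)
  have U'sum: "(\<Sum>j. U' j c x) = F c x * Y (\<not> c) x" if "x \<in> {a..b}" for c x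
  proof -
    have "(\<lambda>j. U' (Suc j) c x) sums (F c x * Y (\<not> c) x)"
      unfolding U'_def Y_def using sU[OF that] by (auto intro!: sums_mult summable_sums)
    then have "(\<lambda>j. U' j c x) sums (F c x * Y (\<not> c) x)"
      by (subst (asm) sums_Suc_iff) (simp add: U'_def)
    then show ?thesis by (rule sums_unique[symmetric])
  qed
  have D: "(Y c has_real_derivative F c x * Y (\<not> c) x) (at x within {a..b})" if x: "x \<in> {a..b}" for c x
  proof -
    have ul: "uniform_limit {a..b} (\<lambda>n x. \<Sum>j<n. U' j c x) (\<lambda>x. \<Sum>j. U' j c x) sequentially"
    proof (rule Weierstrass_m_test)
      fix j t assume t: "t \<in> {a..b}"
      show "norm (U' j c t) \<le> (case j of 0 \<Rightarrow> 0 | Suc i \<Rightarrow> M * R i)"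
        using bd[OF t] M[OF t] M0
        by (auto simp: U'_def abs_mult split: nat.split intro!: mult_mono)
    next
      show "summable (\<lambda>j. case j of 0 \<Rightarrow> 0 | Suc i \<Rightarrow> M * R i)"
        by (subst summable_Suc_iff[symmetric]) (simp add: sR summable_mult)
    qed
    have dU: "(U j c has_real_derivative U' j c x) (at x within {a..b})" if "x \<in> {a..b}" for j x
    proof (cases j)
      case 0 then have "U j c = (\<lambda>x. A' c)" by (auto simp: U_def)
      then show ?thesis using 0 by (simp add: U'_def)
    next
      case (Suc i) then show ?thesis using picard_derivative[where A=A' and j=i and c=c, OF cF that] by (simp add: U_def U'_def)
    qed
    have aab: "a \<in> {a..b}" using assms(1) by simp
    have "\<exists>G. \<forall>x\<in>{a..b}. (\<lambda>n. U n c x) sums G x \<and>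
        (G has_real_derivative (\<Sum>j. U' j c x)) (at x within {a..b})"
      by (rule has_field_derivative_series[OF convex_real_interval(5) dU ul aab sU[OF aab]])
    then obtain G where G: "\<And>x. x \<in> {a..b} \<Longrightarrow> (\<lambda>n. U n c x) sums G x"
      "\<And>x. x \<in> {a..b} \<Longrightarrow> (G has_real_derivative (\<Sum>j. U' j c x)) (at x within {a..b})"
      by blast
    have "G t = Y c t" if "t \<in> {a..b}" for t using G(1)[OF that] by (simp add: Y_def sums_iff)
    then have "(Y c has_real_derivative (\<Sum>j. U' j c x)) (at x within {a..b})"
      by (rule has_field_derivative_transform_within[OF G(2)[OF x] zero_less_one x]) simp
    then show ?thesis by (simp add: U'sum[OF x])
  qed
  have Ya: "Y c a = A' c" for c
  proof -
    have "U j c a = (if j = 0 then A' c else 0)" for j by (cases j) (auto simp: U_def)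
    then show ?thesis unfolding Y_def by (subst suminf_finite[of "{0}"]) auto
  qed
  show ?thesis
  proof (rule that[of "Y True" "Y False"])
    fix x assume x: "x \<in> {a..b}"
    show "(Y True has_real_derivative f x * Y False x) (at x within {a..b})"
      using D[OF x, of True] by (simp add: F_def)
    show "(Y False has_real_derivative g x * Y True x) (at x within {a..b})"
      using D[OF x, of False] by (simp add: F_def)
  qed (simp_all add: Ya A'_def)
qed

section \<open>Transport systems and exponential sums\<close>

definition exp_sum :: "(nat \<Rightarrow> real) \<Rightarrow> nat \<Rightarrow> real \<Rightarrow> real" where
  "exp_sum l N z = (\<Sum>n\<in>{1..N}. l n * exp (- (real n * z)))"

text \<open>In the variable \<open>y = exp (- z)\<close> this is the Weierstrass theorem for \<open>f z / y\<close>, which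
  extends continuously to \<open>y = 0\<close> because \<open>f\<close> vanishes near infinity.\<close>

lemma exp_polynomial_dense:
  fixes f :: "real \<Rightarrow> real"
  assumes cont: "continuous_on UNIV f" and R: "\<And>z. R \<le> z \<Longrightarrow> f z = 0" and "0 < e"
  obtains l :: "nat \<Rightarrow> real" and N where
    "\<And>z. 0 \<le> z \<Longrightarrow> \<bar>exp_sum l N z - f z\<bar> \<le> e * exp (- z)"
proof -
  define w where "w y = (if y \<le> exp (- R) then 0 else f (- ln y) / y)" for y :: real
  have "continuous_on ({..exp (- R)} \<union> {exp (- R)..}) w"
    unfolding w_def
  proof (rule continuous_on_If)
    show "continuous_on {exp (- R)..} (\<lambda>y. f (- ln y) / y)"
      by (intro continuous_intros continuous_on_compose2[OF cont] ballI)
        (use exp_gt_zero[of "- R"] in \<open>auto simp del: exp_gt_zero\<close>)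
  qed (use R in auto)
  then have cw: "continuous_on {0..1} w" by (rule continuous_on_subset) auto
  obtain g where g: "real_polynomial_function g" "\<And>y. y \<in> {0..1} \<Longrightarrow> \<bar>w y - g y\<bar> < e"
    using Stone_Weierstrass_real_polynomial_function[OF _ cw \<open>0 < e\<close>] by (metis compact_Icc)
  obtain a N where gN: "g = (\<lambda>x. \<Sum>i\<le>N. a i * x ^ i)"
    using g(1) unfolding real_polynomial_function_iff_sum by blast
  show ?thesis
  proof (rule that[of N' l for N' l])
    fix z :: real assume z: "0 \<le> z"
    have wz: "w (exp (- z)) = f z * exp z"
      using R[of z] by (auto simp: w_def) (simp add: exp_minus field_simps)
    \<comment> \<open>Multiplying the polynomial back by \<open>y = exp (- z)\<close> raises every
      exponent by one. Hence the sum starts at \<open>n = 1\<close>, and the error keeps a factor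
      \<open>exp (- z)\<close>.\<close>
    have "(\<Sum>n\<in>{1..Suc N}. a (n - 1) * exp (- (real n * z))) = (\<Sum>i\<le>N. a i * exp (- (real (Suc i) * z)))"
      by (rule sum.reindex_bij_witness[of _ Suc "\<lambda>n. n - 1"]) auto
    also have "\<dots> = (\<Sum>i\<le>N. a i * exp (- z) ^ i * exp (- z))"
      by (intro sum.cong refl) (simp add: exp_of_nat_mult[symmetric] exp_add[symmetric] algebra_simps)
    also have "\<dots> = g (exp (- z)) * exp (- z)"
      by (simp add: gN sum_distrib_right)
    finally have eq: "(\<Sum>n\<in>{1..Suc N}. a (n - 1) * exp (- (real n * z))) - f z
        = (g (exp (- z)) - w (exp (- z))) * exp (- z)"
      by (simp add: wz left_diff_distrib mult.assoc flip: exp_add)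
    have "\<bar>g (exp (- z)) - w (exp (- z))\<bar> \<le> e"
      using g(2)[of "exp (- z)"] z by (simp add: abs_minus_commute)
    then show "\<bar>exp_sum (\<lambda>n. a (n - 1)) (Suc N) z - f z\<bar> \<le> e * exp (- z)"
      unfolding eq exp_sum_def by (simp add: abs_mult)
  qed
qed

lemma mvt_within:
  fixes f :: "real \<Rightarrow> real"
  assumes "a < b" "\<And>x. x \<in> {a..b} \<Longrightarrow> (f has_real_derivative f' x) (at x within {a..b})"
  obtains x where "x \<in> {a<..<b}" "f b - f a = f' x * (b - a)"
  using mvt_simple[of a b f "\<lambda>x. (*) (f' x)"] assms unfolding has_field_derivative_def by auto

lemma within_deriv_nonneg:
  fixes f :: "real \<Rightarrow> real"
  assumes "a \<le> b" "\<And>x. x \<in> {a..b} \<Longrightarrow> (f has_real_derivative f' x) (at x within {a..b})"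
    and "\<And>x. x \<in> {a..b} \<Longrightarrow> 0 \<le> f' x"
  shows "f a \<le> f b"
proof (cases "a = b")
  case False
  then obtain x where "x \<in> {a<..<b}" "f b - f a = f' x * (b - a)"
    using mvt_within[of a b f f'] assms by auto
  moreover then have "0 \<le> f' x * (b - a)" using assms by (intro mult_nonneg_nonneg) auto
  ultimately show ?thesis by linarith
qed auto

text \<open>\<open>n\<close> is the frequency and \<open>i\<close> the component. Component \<open>0\<close> has phase \<open>0\<close>; in the application the
  \<open>c n i\<close> are the four products of amplitudes of two Jost solutions.\<close>

locale transport =
  fixes m :: nat and M :: "nat \<Rightarrow> nat \<Rightarrow> real \<Rightarrow> real" and p dp :: "nat \<Rightarrow> real \<Rightarrow> real"
    and c :: "nat \<Rightarrow> nat \<Rightarrow> real \<Rightarrow> real" and B \<delta> :: real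
  assumes m0: "0 < m" and B0: "0 < B" and \<delta>0: "0 < \<delta>"
    and M_cont: "\<And>i j. i < m \<Longrightarrow> j < m \<Longrightarrow> continuous_on {0..1} (M i j)"
    and M_bound: "\<And>i j x. i < m \<Longrightarrow> j < m \<Longrightarrow> x \<in> {0..1} \<Longrightarrow> \<bar>M i j x\<bar> \<le> B"
    and M00: "\<And>x. x \<in> {0..1} \<Longrightarrow> M 0 0 x = 0"
    and p_deriv: "\<And>i x. i < m \<Longrightarrow> x \<in> {0..1} \<Longrightarrow> (p i has_real_derivative dp i x) (at x within {0..1})"
    and dp_pos: "\<And>i x. 0 < i \<Longrightarrow> i < m \<Longrightarrow> x \<in> {0..1} \<Longrightarrow> \<delta> \<le> dp i x"
    and p0: "\<And>x. p 0 x = 0" "\<And>x. dp 0 x = 0"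
    and c_deriv: "\<And>n i x. 1 \<le> n \<Longrightarrow> i < m \<Longrightarrow> x \<in> {0..1} \<Longrightarrow>
      (c n i has_real_derivative real n * dp i x * c n i x + (\<Sum>j<m. M i j x * c n j x)) (at x within {0..1})"
    and c_end: "\<And>n i. 1 \<le> n \<Longrightarrow> i < m \<Longrightarrow> c n i 1 = (if i = 0 then 1 else 0)"
begin

section \<open>Duhamel's formula and the estimate for superposed frequencies\<close>

lemma p_cont: "i < m \<Longrightarrow> continuous_on {0..1} (p i)"
  using p_deriv by (meson DERIV_continuous_on)

lemma c_cont: "1 \<le> n \<Longrightarrow> i < m \<Longrightarrow> continuous_on {0..1} (c n i)"
  using c_deriv by (meson DERIV_continuous_on)

lemma p_mono: "i < m \<Longrightarrow> 0 \<le> x \<Longrightarrow> x \<le> y \<Longrightarrow> y \<le> 1 \<Longrightarrow> p i x \<le> p i y"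
proof -
  assume i: "i < m" and xy: "0 \<le> x" "x \<le> y" "y \<le> 1"
  show "p i x \<le> p i y"
  proof (rule within_deriv_nonneg[OF xy(2)])
    fix t assume t: "t \<in> {x..y}"
    show "(p i has_real_derivative dp i t) (at t within {x..y})"
      by (rule DERIV_subset[OF p_deriv[OF i]]) (use t xy in auto)
    show "0 \<le> dp i t" using dp_pos[of i t] p0 \<delta>0 i t xy by (cases "i = 0") force+
  qed
qed

text \<open>Duhamel's formula, integrated from the right end, where the values of
  \<open>c n i\<close> are prescribed. Since \<open>p i\<close> is increasing, the exponential is at
  most 1 for \<open>r \<ge> x\<close>, uniformly in \<open>n\<close>.\<close>

lemma mild_form:
  assumes "1 \<le> n" "i < m" "x \<in> {0..1}"
  shows "((\<lambda>r. exp (- (real n * (p i r - p i x))) * (\<Sum>j<m. M i j r * c n j r)) has_integral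
     (if i = 0 then 1 else 0) - c n i x) {x..1}"
proof -
  have "((\<lambda>r. exp (- (real n * (p i r - p i x))) * (\<Sum>j<m. M i j r * c n j r)) has_integral
     (exp (- (real n * (p i 1 - p i x))) * c n i 1 - exp (- (real n * (p i x - p i x))) * c n i x)) {x..1}"
  proof (rule fundamental_theorem_of_calculus)
    fix r assume r: "r \<in> {x..1}"
    then have r': "r \<in> {0..1}" and sub: "{x..1} \<subseteq> {0..1}" using assms by auto
    note d = DERIV_subset[OF p_deriv[OF \<open>i < m\<close> r'] sub] DERIV_subset[OF c_deriv[OF \<open>1 \<le> n\<close> \<open>i < m\<close> r'] sub]
    have "((\<lambda>r. exp (- (real n * (p i r - p i x))) * c n i r) has_real_derivative
       exp (- (real n * (p i r - p i x))) * (\<Sum>j<m. M i j r * c n j r)) (at r within {x..1})"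
      by (rule derivative_eq_intros d refl)+ (simp add: algebra_simps)
    then show "((\<lambda>r. exp (- (real n * (p i r - p i x))) * c n i r) has_vector_derivative
       exp (- (real n * (p i r - p i x))) * (\<Sum>j<m. M i j r * c n j r)) (at r within {x..1})"
      by (simp add: has_real_derivative_iff_has_vector_derivative)
  qed (use assms in auto)
  then show ?thesis using c_end[OF assms(1,2)] p0(1) by (auto split: if_splits)
qed

text \<open>The rate is such that the integral of \<open>m * B * exp (- (Lam * r))\<close> over
  \<open>r \<ge> x\<close> is at most half of \<open>exp (- (Lam * x))\<close>; this is the gain in
  each Picard step.\<close>

definition Lam :: real where "Lam = 2 * real m * B"

definition Cst :: real where "Cst = 2 * (B / \<delta>) * exp Lam"

lemma Lam_pos: "0 < Lam" using m0 B0 by (simp add: Lam_def)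

lemma Cst_pos: "0 < Cst" using B0 \<delta>0 by (simp add: Cst_def)

text \<open>The additional variable \<open>z\<close> serves to remove \<open>n\<close>: multiplying
  the term of frequency \<open>n\<close> by \<open>exp (- n s)\<close> is the same as replacing
  \<open>z\<close> by \<open>z + s\<close>.\<close>

definition wave :: "(nat \<Rightarrow> real) \<Rightarrow> nat \<Rightarrow> nat \<Rightarrow> real \<Rightarrow> real \<Rightarrow> real" where
  "wave l N i x z = (\<Sum>n\<in>{1..N}. l n * c n i x * exp (- (real n * z)))"

text \<open>The subtracted term is the value that \<open>wave\<close> would have for
  \<open>M = 0\<close>, when \<open>c n 0\<close> is constantly 1 and the other components
  vanish.\<close>

definition wave_error :: "(nat \<Rightarrow> real) \<Rightarrow> nat \<Rightarrow> nat \<Rightarrow> real \<Rightarrow> real \<Rightarrow> real" where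
  "wave_error l N i x z = wave l N i x z - (if i = 0 then exp_sum l N z else 0)"

text \<open>All that the final estimate may know of the coefficients \<open>l\<close> is this pair:
  a majorant \<open>g\<close> of the profile, and an antiderivative \<open>G\<close> of
  \<open>- g\<close> that is nonnegative for \<open>z \<ge> 0\<close>.\<close>

context
  fixes l :: "nat \<Rightarrow> real" and N :: nat and g G :: "real \<Rightarrow> real"
  assumes g: "\<And>z. 0 \<le> z \<Longrightarrow> \<bar>exp_sum l N z\<bar> \<le> g z"
    and G: "\<And>z. (G has_real_derivative - g z) (at z)" and G_pos: "\<And>z. 0 \<le> z \<Longrightarrow> 0 \<le> G z"
begin

abbreviation "f \<equiv> exp_sum l N"

abbreviation "F \<equiv> wave l N"

abbreviation "E \<equiv> wave_error l N"

lemma G_antimono: "0 \<le> z \<Longrightarrow> z \<le> z' \<Longrightarrow> G z' \<le> G z"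
proof (rule DERIV_nonpos_imp_nonincreasing[of z z' G])
  fix t assume "0 \<le> z" "z \<le> t"
  then have "0 \<le> g t" using order_trans[OF abs_ge_zero g[of t]] by simp
  then show "\<exists>d. (G has_real_derivative d) (at t) \<and> d \<le> 0" using G[of t] by (intro exI[of _ "- g t"]) simp
qed

text \<open>The sum of \<open>mild_form\<close> over \<open>n\<close> with weights
  \<open>l n * exp (- n z)\<close>. The exponentials combine into a translation of \<open>z\<close>,
  and the resulting equation no longer contains \<open>n\<close>.\<close>

lemma E_integral:
  assumes "i < m" "x \<in> {0..1}"
  shows "((\<lambda>r. \<Sum>j<m. M i j r * F j r (z + (p i r - p i x))) has_integral - E i x z) {x..1}"
proof -
  have "((\<lambda>r. \<Sum>n\<in>{1..N}. l n * exp (- (real n * z)) *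
      (exp (- (real n * (p i r - p i x))) * (\<Sum>j<m. M i j r * c n j r))) has_integral
      (\<Sum>n\<in>{1..N}. l n * exp (- (real n * z)) * ((if i = 0 then 1 else 0) - c n i x))) {x..1}"
    by (intro has_integral_sum has_integral_mult_right mild_form assms) auto
  moreover have "(\<Sum>n\<in>{1..N}. l n * exp (- (real n * z)) * ((if i = 0 then 1 else 0) - c n i x)) = - E i x z"
    by (auto simp: wave_error_def wave_def exp_sum_def algebra_simps sum_subtractf sum_negf)
  moreover have "(\<Sum>n\<in>{1..N}. l n * exp (- (real n * z)) *
      (exp (- (real n * (p i r - p i x))) * (\<Sum>j<m. M i j r * c n j r)))
      = (\<Sum>j<m. M i j r * F j r (z + (p i r - p i x)))" for r
    unfolding wave_def sum_distrib_left
    by (subst sum.swap) (intro sum.cong refl, simp add: algebra_simps flip: exp_add)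
  ultimately show ?thesis by simp
qed

text \<open>One Picard step halves the coefficient of \<open>exp (- z)\<close>, a bound that depends on the coefficients \<open>l\<close>,
  and keeps that of \<open>G z\<close> below the fixed point \<^const>\<open>Cst\<close>; iterating leaves a bound by \<open>G\<close> alone.\<close>

lemma E_step:
  assumes H: "\<And>i x z. i < m \<Longrightarrow> x \<in> {0..1} \<Longrightarrow> 0 \<le> z \<Longrightarrow> \<bar>E i x z\<bar> \<le> (a * G z + X * exp (- z)) * exp (- (Lam * x))"
    and a: "0 \<le> a" "0 \<le> X" and i: "i < m" and x: "x \<in> {0..1}" and z: "0 \<le> z"
  shows "\<bar>E i x z\<bar> \<le> (((B / \<delta>) * exp Lam + a / 2) * G z + X / 2 * exp (- z)) * exp (- (Lam * x))"
proof -
  define y where "y r = z + (p i r - p i x)" for r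
  have y_cont: "continuous_on {x..1} y"
    unfolding y_def by (intro continuous_intros continuous_on_subset[OF p_cont[OF i]]) (use x in auto)
  have y: "z \<le> y r" "0 \<le> y r" if "r \<in> {x..1}" for r
    using p_mono[OF i, of x r] that x z by (auto simp: y_def)
  define h where "h r = (\<Sum>j<m. M i j r * F j r (y r))" for r
  define V where "V = a * G z + X * exp (- z)"
  \<comment> \<open>The profile enters component \<open>i\<close> with the factor
    \<open>M i 0\<close>. For \<open>i \<noteq> 0\<close> the slope
    \<open>dp i \<ge> \<delta>\<close> turns \<open>g (y r)\<close> into at most
    \<open>g (y r) * dp i r / \<delta>\<close>, the derivative of
    \<open>- G (y r) / \<delta>\<close>. For \<open>i = 0\<close> the phase is constant and this
    would fail, but \<open>M 0 0 = 0\<close>. The other summand collects the errors of all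
    components.\<close>
  define b where "b r = (if i = 0 then 0 else (B / \<delta>) * (g (y r) * dp i r)) + real m * B * V * exp (- (Lam * r))" for r
  have V0: "0 \<le> V" using a G_pos[OF z] by (simp add: V_def)
  have hb: "\<bar>h r\<bar> \<le> b r" if r: "r \<in> {x..1}" for r
  proof -
    have r': "r \<in> {0..1}" using r x by auto
    have Er: "\<bar>E j r (y r)\<bar> \<le> V * exp (- (Lam * r))" if "j < m" for j
    proof -
      have "\<bar>E j r (y r)\<bar> \<le> (a * G (y r) + X * exp (- y r)) * exp (- (Lam * r))"
        by (rule H[OF that r' y(2)[OF r]])
      also have "\<dots> \<le> V * exp (- (Lam * r))"
        unfolding V_def using y[OF r] a G_antimono[OF z y(1)[OF r]]
        by (intro mult_right_mono add_mono mult_left_mono) auto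
      finally show ?thesis .
    qed
    have "h r = M i 0 r * f (y r) + (\<Sum>j<m. M i j r * E j r (y r))"
    proof -
      have "(\<Sum>j<m. M i j r * E j r (y r)) = h r - (\<Sum>j<m. if j = 0 then M i 0 r * f (y r) else 0)"
        unfolding h_def sum_subtractf[symmetric] by (intro sum.cong refl) (auto simp: wave_error_def algebra_simps)
      then show ?thesis using m0 by simp
    qed
    then have "\<bar>h r\<bar> \<le> \<bar>M i 0 r * f (y r)\<bar> + \<bar>\<Sum>j<m. M i j r * E j r (y r)\<bar>" by linarith
    also have "\<bar>\<Sum>j<m. M i j r * E j r (y r)\<bar> \<le> (\<Sum>j<m. B * (V * exp (- (Lam * r))))"
      by (rule order_trans[OF sum_abs], intro sum_mono)
        (use M_bound[OF i _ r'] Er B0 V0 in \<open>auto simp: abs_mult intro!: mult_mono\<close>)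
    also have "\<dots> = real m * B * V * exp (- (Lam * r))" by simp
    also have "\<bar>M i 0 r * f (y r)\<bar> \<le> (if i = 0 then 0 else (B / \<delta>) * (g (y r) * dp i r))"
    proof (cases "i = 0")
      case False
      have fg: "\<bar>f (y r)\<bar> \<le> g (y r)" using g[OF y(2)[OF r]] .
      have "\<bar>M i 0 r\<bar> * \<bar>f (y r)\<bar> \<le> B * g (y r)"
        using M_bound[OF i m0 r'] fg B0 by (intro mult_mono) auto
      also have "\<dots> \<le> B * g (y r) * (dp i r / \<delta>)"
      proof -
        have "1 \<le> dp i r / \<delta>" using dp_pos[of i r] False i r' \<delta>0 by (simp add: field_simps)
        moreover have "0 \<le> B * g (y r)" using fg B0 by (intro mult_nonneg_nonneg) linarith+
        ultimately show ?thesis using mult_left_mono by fastforce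
      qed
      finally show ?thesis using False by (simp add: abs_mult field_simps)
    qed (use M00 r' in auto)
    finally show ?thesis by (simp add: b_def)
  qed
  have x1: "x \<le> 1" using x by simp
  have I1: "((\<lambda>r. real m * B * V * exp (- (Lam * r))) has_integral
     (- (V / 2) * exp (- (Lam * 1)) - (- (V / 2) * exp (- (Lam * x))))) {x..1}"
  proof (rule fundamental_theorem_of_calculus[OF x1])
    fix r :: real
    have "((\<lambda>r. - (V / 2) * exp (- (Lam * r))) has_real_derivative real m * B * V * exp (- (Lam * r))) (at r within {x..1})"
      by (rule derivative_eq_intros refl)+ (simp add: Lam_def)
    then show "((\<lambda>r. - (V / 2) * exp (- (Lam * r))) has_vector_derivative real m * B * V * exp (- (Lam * r))) (at r within {x..1})"
      by (simp add: has_real_derivative_iff_has_vector_derivative)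
  qed
  have I2: "((\<lambda>r. g (y r) * dp i r) has_integral (- G (y 1) - (- G (y x)))) {x..1}"
  proof (rule fundamental_theorem_of_calculus[OF x1])
    fix r assume r: "r \<in> {x..1}"
    then have r': "r \<in> {0..1}" using x by auto
    have "(y has_real_derivative dp i r) (at r within {x..1})"
      unfolding y_def
      by (rule derivative_eq_intros DERIV_subset[OF p_deriv[OF i r']] refl)+ (use x in auto)
    from DERIV_chain2[OF G this] have "((\<lambda>r. - G (y r)) has_real_derivative g (y r) * dp i r) (at r within {x..1})"
      by (auto intro!: derivative_eq_intros)
    then show "((\<lambda>r. - G (y r)) has_vector_derivative g (y r) * dp i r) (at r within {x..1})"
      by (simp add: has_real_derivative_iff_has_vector_derivative)
  qed
  have bi: "(b has_integral ((if i = 0 then 0 else (B / \<delta>) * (- G (y 1) - (- G (y x)))) +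
     (- (V / 2) * exp (- (Lam * 1)) - (- (V / 2) * exp (- (Lam * x)))))) {x..1}"
    using I1 has_integral_add[OF has_integral_mult_right[OF I2, of "B / \<delta>"] I1]
    by (cases "i = 0") (simp_all add: b_def[abs_def])
  have "\<bar>E i x z\<bar> \<le> (if i = 0 then 0 else (B / \<delta>) * (- G (y 1) - (- G (y x)))) +
     (- (V / 2) * exp (- (Lam * 1)) - (- (V / 2) * exp (- (Lam * x))))"
  proof -
    have hi: "(h has_integral - E i x z) {x..1}" using E_integral[OF i x] by (simp add: h_def[abs_def] y_def)
    have "norm (integral {x..1} h) \<le> integral {x..1} b"
      by (rule integral_norm_bound_integral) (use hi bi hb in auto)
    then show ?thesis using hi bi by (simp add: integral_unique)
  qed
  also have "\<dots> \<le> (B / \<delta>) * G z + (V / 2) * exp (- (Lam * x))"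
  proof (rule add_mono)
    have "G (y 1) \<ge> 0" using y(2)[of 1] x G_pos by auto
    moreover have "y x = z" by (simp add: y_def)
    ultimately show "(if i = 0 then 0 else (B / \<delta>) * (- G (y 1) - (- G (y x)))) \<le> (B / \<delta>) * G z"
      using B0 \<delta>0 G_pos[OF z] by (auto intro!: mult_left_mono divide_right_mono)
  qed (use V0 in auto)
  also have "(B / \<delta>) * G z \<le> (B / \<delta>) * exp Lam * G z * exp (- (Lam * x))"
  proof -
    have "1 \<le> exp Lam * exp (- (Lam * x))"
      using Lam_pos x by (simp flip: exp_add)
    then have "(B / \<delta>) * G z * 1 \<le> (B / \<delta>) * G z * (exp Lam * exp (- (Lam * x)))"
      using B0 \<delta>0 G_pos[OF z] by (intro mult_left_mono) auto
    then show ?thesis by (simp add: mult_ac)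
  qed
  finally show ?thesis by (simp add: V_def algebra_simps add_divide_distrib)
qed

lemma E_bound:
  assumes "i < m" "x \<in> {0..1}" "0 \<le> z"
  shows "\<bar>E i x z\<bar> \<le> Cst * G z"
proof -
  \<comment> \<open>A crude bound whose constant depends on \<open>l\<close> and \<open>N\<close>.
    It only starts the iteration, in which its contribution is halved at each step.\<close>
  have "\<exists>X0\<ge>0. \<forall>i<m. \<forall>x\<in>{0..1}. \<forall>z\<ge>0. \<bar>E i x z\<bar> \<le> X0 * exp (- z)"
  proof -
    have "\<exists>K. \<forall>x\<in>{0..1}. \<bar>c n i x\<bar> \<le> K" if "1 \<le> n" "i < m" for n i
    proof -
      have "bounded (c n i ` {0..1})"
        by (intro compact_imp_bounded compact_continuous_image c_cont that) auto
      then show ?thesis by (auto simp: bounded_iff)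
    qed
    then obtain K where K: "\<And>n i x. 1 \<le> n \<Longrightarrow> i < m \<Longrightarrow> x \<in> {0..1} \<Longrightarrow> \<bar>c n i x\<bar> \<le> K n i" by metis
    define X0 where "X0 = (\<Sum>n\<in>{1..N}. \<bar>l n\<bar> * ((\<Sum>i<m. \<bar>K n i\<bar>) + 1))"
    have "\<bar>E i x z\<bar> \<le> X0 * exp (- z)" if "i < m" "x \<in> {0..1}" "0 \<le> z" for i x z
    proof -
      have "E i x z = (\<Sum>n\<in>{1..N}. l n * (c n i x - (if i = 0 then 1 else 0)) * exp (- (real n * z)))"
        by (auto simp: wave_error_def wave_def exp_sum_def algebra_simps sum_subtractf)
      also have "\<bar>\<dots>\<bar> \<le> (\<Sum>n\<in>{1..N}. \<bar>l n\<bar> * ((\<Sum>i<m. \<bar>K n i\<bar>) + 1) * exp (- z))"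
      proof (rule order_trans[OF sum_abs], rule sum_mono)
        fix n assume n: "n \<in> {1..N}"
        have "\<bar>c n i x\<bar> \<le> \<bar>K n i\<bar>" using K[of n i x] n that by auto
        also have "\<dots> \<le> (\<Sum>i<m. \<bar>K n i\<bar>)" using that by (intro member_le_sum) auto
        finally have "\<bar>c n i x - (if i = 0 then 1 else 0)\<bar> \<le> (\<Sum>i<m. \<bar>K n i\<bar>) + 1" by auto
        moreover have "exp (- (real n * z)) \<le> exp (- z)" using n that mult_right_mono[of 1 "real n" z] by auto
        ultimately show "\<bar>l n * (c n i x - (if i = 0 then 1 else 0)) * exp (- (real n * z))\<bar>
            \<le> \<bar>l n\<bar> * ((\<Sum>i<m. \<bar>K n i\<bar>) + 1) * exp (- z)"
          unfolding abs_mult by (intro mult_mono) (auto intro!: add_nonneg_nonneg sum_nonneg)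
      qed
      finally show ?thesis by (simp add: X0_def sum_distrib_right)
    qed
    moreover have "0 \<le> X0" unfolding X0_def by (auto intro!: sum_nonneg mult_nonneg_nonneg add_nonneg_nonneg)
    ultimately show ?thesis by blast
  qed
  then obtain X0 where X0: "0 \<le> X0" and EX: "\<And>i x z. i < m \<Longrightarrow> x \<in> {0..1} \<Longrightarrow> 0 \<le> z \<Longrightarrow> \<bar>E i x z\<bar> \<le> X0 * exp (- z)"
    by blast
  define a where "a = 2 * (B / \<delta>) * exp Lam"
  have a0: "0 \<le> a" using B0 \<delta>0 by (simp add: a_def)
  define X where "X = X0 * exp Lam"
  have it: "\<bar>E i x z\<bar> \<le> (a * G z + X / 2 ^ k * exp (- z)) * exp (- (Lam * x))"
    if "i < m" "x \<in> {0..1}" "0 \<le> z" for k i x z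
    using that
  proof (induction k arbitrary: i x z)
    case 0
    have "1 \<le> exp Lam * exp (- (Lam * x))"
      using Lam_pos 0 by (simp flip: exp_add)
    then have "X0 * exp (- z) * 1 \<le> X0 * exp (- z) * (exp Lam * exp (- (Lam * x)))"
      using X0 by (intro mult_left_mono) auto
    also have "\<dots> \<le> (a * G z + X / 2 ^ 0 * exp (- z)) * exp (- (Lam * x))"
      using a0 G_pos[OF 0(3)] by (simp add: X_def algebra_simps)
    finally show ?case using EX[OF 0] by linarith
  next
    case (Suc k)
    show ?case
      using E_step[OF Suc.IH a0 _ Suc.prems] X0 by (simp add: X_def a_def mult_ac)
  qed
  have "(\<lambda>k. (a * G z + X / 2 ^ k * exp (- z)) * exp (- (Lam * x))) \<longlonglongrightarrow> (a * G z + 0 * exp (- z)) * exp (- (Lam * x))"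
    by (intro tendsto_intros LIMSEQ_divide_realpow_zero) auto
  then have "\<bar>E i x z\<bar> \<le> (a * G z + 0 * exp (- z)) * exp (- (Lam * x))"
    by (rule LIMSEQ_le_const) (use it[OF assms] in blast)
  also have "\<dots> \<le> a * G z" using a0 G_pos assms Lam_pos by (simp add: mult_left_le)
  finally show ?thesis by (simp add: Cst_def a_def)
qed

end

end

section \<open>Tents as test profiles, and their tail integrals\<close>

definition tent :: "real \<Rightarrow> real \<Rightarrow> real \<Rightarrow> real" where
  "tent z0 h z = max 0 (h - \<bar>z - z0\<bar>)"

text \<open>The integral of the tent over all points beyond \<open>z\<close>: the total mass
  \<open>h\<^sup>2\<close> minus half the second difference of the squared positive part. In this
  form differentiability at the kinks reduces to that of \<open>(max 0 y)\<^sup>2\<close>.\<close>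

definition tent_tail :: "real \<Rightarrow> real \<Rightarrow> real \<Rightarrow> real" where
  "tent_tail z0 h z = h\<^sup>2 - ((max 0 (z - z0 + h))\<^sup>2 - 2 * (max 0 (z - z0))\<^sup>2 + (max 0 (z - z0 - h))\<^sup>2) / 2"

lemma max0_square_deriv: "((\<lambda>y. (max 0 y)\<^sup>2) has_real_derivative 2 * max 0 y) (at y)" for y :: real
proof (cases y "0::real" rule: linorder_cases)
  case less
  have "((\<lambda>y. 0) has_real_derivative 2 * max 0 y) (at y)" using less by simp
  then show ?thesis
    by (rule has_field_derivative_transform_within_open[of _ _ _ "{..<0}"]) (use less in auto)
next
  case greater
  have "((\<lambda>y. y\<^sup>2) has_real_derivative 2 * max 0 y) (at y)"
    using greater by (auto intro!: derivative_eq_intros)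
  then show ?thesis
    by (rule has_field_derivative_transform_within_open[of _ _ _ "{0<..}"]) (use greater in auto)
next
  case equal
  have "(\<lambda>h::real. (max 0 (0 + h))\<^sup>2 / h) \<midarrow>0\<rightarrow> 0"
  proof (rule Lim_null_comparison)
    show "\<forall>\<^sub>F h::real in at 0. norm ((max 0 (0 + h))\<^sup>2 / h) \<le> \<bar>h\<bar>"
      by (intro always_eventually allI) (auto simp: max_def power2_eq_square)
    show "(\<lambda>h::real. \<bar>h\<bar>) \<midarrow>0\<rightarrow> 0" by (auto intro!: tendsto_eq_intros)
  qed
  then show ?thesis by (simp add: DERIV_def equal)
qed

lemma tent_tail_deriv:
  assumes "0 < h"
  shows "(tent_tail z0 h has_real_derivative - tent z0 h z) (at z)"
proof -
  have *: "((\<lambda>z. (max 0 (z - a))\<^sup>2) has_real_derivative 2 * max 0 (z - a)) (at z)" for a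
  proof -
    have "((\<lambda>z. z - a) has_real_derivative 1) (at z)" by (auto intro!: derivative_eq_intros)
    from DERIV_chain2[OF max0_square_deriv this] show ?thesis by simp
  qed
  have "((\<lambda>z. h\<^sup>2 - ((max 0 (z - (z0 - h)))\<^sup>2 - 2 * (max 0 (z - z0))\<^sup>2 + (max 0 (z - (z0 + h)))\<^sup>2) / 2)
      has_real_derivative 0 - (2 * max 0 (z - (z0 - h)) - 2 * (2 * max 0 (z - z0)) + 2 * max 0 (z - (z0 + h))) / 2) (at z)"
    by (intro DERIV_diff DERIV_add DERIV_const DERIV_cdivide DERIV_cmult *)
  also have "0 - (2 * max 0 (z - (z0 - h)) - 2 * (2 * max 0 (z - z0)) + 2 * max 0 (z - (z0 + h))) / 2 = - tent z0 h z"
    using assms by (auto simp: tent_def max_def abs_if)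
  also have "(\<lambda>z. h\<^sup>2 - ((max 0 (z - (z0 - h)))\<^sup>2 - 2 * (max 0 (z - z0))\<^sup>2 + (max 0 (z - (z0 + h)))\<^sup>2) / 2) = tent_tail z0 h"
    by (auto simp: tent_tail_def algebra_simps)
  finally show ?thesis .
qed

lemma tent_cont: "continuous_on UNIV (tent z0 h)"
  unfolding tent_def by (intro continuous_intros)

lemma tent_nonneg: "0 \<le> tent z0 h z" by (simp add: tent_def)

lemma tent_tail_cont: "0 < h \<Longrightarrow> continuous_on UNIV (tent_tail z0 h)"
  by (rule DERIV_continuous_on[OF tent_tail_deriv])

lemma tent_tail_antimono: "0 < h \<Longrightarrow> z \<le> z' \<Longrightarrow> tent_tail z0 h z' \<le> tent_tail z0 h z"
  by (rule DERIV_nonpos_imp_nonincreasing[of z z'])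
    (auto intro!: exI[of _ "- tent z0 h _"] tent_tail_deriv simp: tent_nonneg)

lemma tent_tail_zero: "0 < h \<Longrightarrow> z0 + h \<le> z \<Longrightarrow> tent_tail z0 h z = 0"
  by (auto simp: tent_tail_def max_def power2_eq_square algebra_simps)

lemma tent_tail_nonneg: "0 < h \<Longrightarrow> 0 \<le> tent_tail z0 h z"
  using tent_tail_antimono[of h z "max z (z0 + h)" z0] tent_tail_zero[of h z0 "max z (z0 + h)"] by simp

lemma tent_tail_le: "0 < h \<Longrightarrow> tent_tail z0 h z \<le> h\<^sup>2"
  using tent_tail_antimono[of h "min z (z0 - h)" z z0] by (auto simp: tent_tail_def)

section \<open>From orthogonality to vanishing, by concentrating tents\<close>

context transport
begin

text \<open>Weighting \<open>ortho\<close> by \<open>l n\<close> and summing shows that \<Delta> is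
  orthogonal to the sum of the waves at \<open>z = \<sigma> x\<close>. By \<open>E_bound\<close>
  that sum differs from the profile by at most \<open>m * Cst\<close> times the tail, and the
  profile can be taken arbitrarily close to the tent.\<close>

lemma product_estimate:
  fixes \<Delta> \<sigma> :: "real \<Rightarrow> real"
  assumes \<Delta>: "continuous_on {0..1} \<Delta>" and \<sigma>: "continuous_on {0..1} \<sigma>" "\<And>x. x \<in> {0..1} \<Longrightarrow> 0 \<le> \<sigma> x"
    and ortho: "\<And>n. 1 \<le> n \<Longrightarrow> integral {0..1} (\<lambda>x. \<Delta> x * exp (- (real n * \<sigma> x)) * (\<Sum>i<m. c n i x)) = 0"
    and h: "0 < h"
  shows "\<bar>integral {0..1} (\<lambda>x. \<Delta> x * tent z0 h (\<sigma> x))\<bar>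
      \<le> real m * Cst * integral {0..1} (\<lambda>x. \<bar>\<Delta> x\<bar> * tent_tail z0 h (\<sigma> x))"
proof -
  define T where "T = tent z0 h"
  have T_cont: "continuous_on UNIV T" using tent_cont by (simp add: T_def)
  define GT where "GT = tent_tail z0 h"
  have GT_cont: "continuous_on UNIV GT"
    using tent_tail_cont[OF h] by (simp add: GT_def)
  note ci = continuous_intros \<Delta> \<sigma>(1) continuous_on_compose2[OF T_cont _ subset_UNIV]
    continuous_on_compose2[OF GT_cont _ subset_UNIV]
  define J where "J = integral {0..1} (\<lambda>x. \<bar>\<Delta> x\<bar> * exp (- \<sigma> x))"
  have "\<bar>integral {0..1} (\<lambda>x. \<Delta> x * T (\<sigma> x))\<bar>
      \<le> real m * Cst * integral {0..1} (\<lambda>x. \<bar>\<Delta> x\<bar> * GT (\<sigma> x)) + e * ((real m * Cst + 1) * J)" if e: "0 < e" for e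
  proof -
    obtain l N where lN: "\<And>z. 0 \<le> z \<Longrightarrow> \<bar>exp_sum l N z - T z\<bar> \<le> e * exp (- z)"
    proof -
      have "tent z0 h z = 0" if "z0 + h \<le> z" for z using that h by (auto simp: tent_def)
      from exp_polynomial_dense[OF tent_cont this e] show ?thesis using that unfolding T_def by blast
    qed
    \<comment> \<open>The approximation error \<open>e * exp (- z)\<close> is its own tail integral,
      so adding it to both the tent and its tail keeps \<open>G' = - g\<close>.\<close>
    define g where "g z = T z + e * exp (- z)" for z
    define G where "G z = GT z + e * exp (- z)" for z
    have fg: "\<bar>exp_sum l N z\<bar> \<le> g z" if "0 \<le> z" for z
      using lN[OF that] tent_nonneg[of z0 h z] by (auto simp: g_def T_def)
    have Eb: "\<bar>wave l N i x z - (if i = 0 then exp_sum l N z else 0)\<bar> \<le> Cst * G z" if "i < m" "x \<in> {0..1}" "0 \<le> z" for i x z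
    proof -
      have "(G has_real_derivative - g z) (at z)" for z
        unfolding G_def g_def GT_def T_def
        by (rule derivative_eq_intros tent_tail_deriv[OF h] refl)+ simp
      moreover have "0 \<le> G z" for z using tent_tail_nonneg[OF h] e by (simp add: G_def GT_def)
      ultimately show ?thesis
        using E_bound[where l = l and N = N and g = g and G = G and i = i and x = x and z = z] fg that
        by (simp add: wave_error_def)
    qed
    have F_cont: "continuous_on {0..1} (\<lambda>x. wave l N i x (\<sigma> x))" if "i < m" for i
      unfolding wave_def using that by (intro ci c_cont) auto
    have f_cont: "continuous_on {0..1} (\<lambda>x. exp_sum l N (\<sigma> x))"
      unfolding exp_sum_def by (intro ci)
    have zero: "integral {0..1} (\<lambda>x. \<Delta> x * (\<Sum>i<m. wave l N i x (\<sigma> x))) = 0"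
    proof -
      have "\<Delta> x * (\<Sum>i<m. wave l N i x (\<sigma> x)) = (\<Sum>n\<in>{1..N}. l n * (\<Delta> x * exp (- (real n * \<sigma> x)) * (\<Sum>i<m. c n i x)))" for x
        unfolding wave_def sum_distrib_left
        by (subst sum.swap) (simp add: algebra_simps)
      moreover have "((\<lambda>x. \<Sum>n\<in>{1..N}. l n * (\<Delta> x * exp (- (real n * \<sigma> x)) * (\<Sum>i<m. c n i x))) has_integral
          (\<Sum>n\<in>{1..N}. l n * 0)) {0..1}"
      proof (intro has_integral_sum has_integral_mult_right)
        fix n assume n: "n \<in> {1..N}"
        have "continuous_on {0..1} (\<lambda>x. \<Delta> x * exp (- (real n * \<sigma> x)) * (\<Sum>i<m. c n i x))"
          using n by (intro ci c_cont) auto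
        then have "(\<lambda>x. \<Delta> x * exp (- (real n * \<sigma> x)) * (\<Sum>i<m. c n i x)) integrable_on {0..1}"
          by (rule integrable_continuous_real)
        then show "((\<lambda>x. \<Delta> x * exp (- (real n * \<sigma> x)) * (\<Sum>i<m. c n i x)) has_integral 0) {0..1}"
          using ortho[of n] n by (auto simp: has_integral_iff)
      qed simp
      ultimately show ?thesis by (simp add: integral_unique)
    qed
    have pt: "\<bar>\<Delta> x * T (\<sigma> x) - \<Delta> x * (\<Sum>i<m. wave l N i x (\<sigma> x))\<bar> \<le> \<bar>\<Delta> x\<bar> * (real m * (Cst * G (\<sigma> x)) + e * exp (- \<sigma> x))"
      if x: "x \<in> {0..1}" for x
    proof -
      have "(\<Sum>i<m. wave l N i x (\<sigma> x) - (if i = 0 then exp_sum l N (\<sigma> x) else 0)) = (\<Sum>i<m. wave l N i x (\<sigma> x)) - exp_sum l N (\<sigma> x)"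
        using m0 by (simp add: sum_subtractf)
      moreover have "\<bar>\<Sum>i<m. wave l N i x (\<sigma> x) - (if i = 0 then exp_sum l N (\<sigma> x) else 0)\<bar> \<le> (\<Sum>i<m. Cst * G (\<sigma> x))"
        by (rule order_trans[OF sum_abs], intro sum_mono Eb) (use x \<sigma> in auto)
      moreover have "\<bar>exp_sum l N (\<sigma> x) - T (\<sigma> x)\<bar> \<le> e * exp (- \<sigma> x)"
        using lN[OF \<sigma>(2)[OF x]] .
      ultimately have "\<bar>T (\<sigma> x) - (\<Sum>i<m. wave l N i x (\<sigma> x))\<bar> \<le> real m * (Cst * G (\<sigma> x)) + e * exp (- \<sigma> x)"
        by simp
      then show ?thesis by (simp add: abs_mult mult_left_mono flip: right_diff_distrib)
    qed
    have i1: "(\<lambda>x. \<Delta> x * T (\<sigma> x)) integrable_on {0..1}"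
      and i2: "(\<lambda>x. \<Delta> x * (\<Sum>i<m. wave l N i x (\<sigma> x))) integrable_on {0..1}"
      and i3: "(\<lambda>x. \<bar>\<Delta> x\<bar> * GT (\<sigma> x)) integrable_on {0..1}"
      and i4: "(\<lambda>x. \<bar>\<Delta> x\<bar> * exp (- \<sigma> x)) integrable_on {0..1}"
      by (auto intro!: integrable_continuous_real ci F_cont)
    have "\<bar>integral {0..1} (\<lambda>x. \<Delta> x * T (\<sigma> x))\<bar>
        = norm (integral {0..1} (\<lambda>x. \<Delta> x * T (\<sigma> x) - \<Delta> x * (\<Sum>i<m. wave l N i x (\<sigma> x))))"
      using zero by (simp add: integral_diff[OF i1 i2])
    also have "\<dots> \<le> integral {0..1} (\<lambda>x. real m * Cst * (\<bar>\<Delta> x\<bar> * GT (\<sigma> x)) + e * (real m * Cst + 1) * (\<bar>\<Delta> x\<bar> * exp (- \<sigma> x)))"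
    proof (rule integral_norm_bound_integral)
      fix x :: real assume "x \<in> {0..1}"
      from pt[OF this] show "norm (\<Delta> x * T (\<sigma> x) - \<Delta> x * (\<Sum>i<m. wave l N i x (\<sigma> x)))
          \<le> real m * Cst * (\<bar>\<Delta> x\<bar> * GT (\<sigma> x)) + e * (real m * Cst + 1) * (\<bar>\<Delta> x\<bar> * exp (- \<sigma> x))"
        by (simp add: G_def algebra_simps)
    qed (intro integrable_diff integrable_add integrable_on_mult_right i1 i2 i3 i4)+
    also have "\<dots> = real m * Cst * integral {0..1} (\<lambda>x. \<bar>\<Delta> x\<bar> * GT (\<sigma> x)) + e * ((real m * Cst + 1) * J)"
      by (simp add: integral_add integrable_on_mult_right i3 i4 J_def)
    finally show ?thesis .
  qed
  then have "\<bar>integral {0..1} (\<lambda>x. \<Delta> x * T (\<sigma> x))\<bar> \<le> real m * Cst * integral {0..1} (\<lambda>x. \<bar>\<Delta> x\<bar> * GT (\<sigma> x))"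
  proof -
    assume H: "\<And>e. 0 < e \<Longrightarrow> \<bar>integral {0..1} (\<lambda>x. \<Delta> x * T (\<sigma> x))\<bar>
      \<le> real m * Cst * integral {0..1} (\<lambda>x. \<bar>\<Delta> x\<bar> * GT (\<sigma> x)) + e * ((real m * Cst + 1) * J)"
    have "((\<lambda>e. real m * Cst * integral {0..1} (\<lambda>x. \<bar>\<Delta> x\<bar> * GT (\<sigma> x)) + e * ((real m * Cst + 1) * J))
       \<longlongrightarrow> real m * Cst * integral {0..1} (\<lambda>x. \<bar>\<Delta> x\<bar> * GT (\<sigma> x)) + 0 * ((real m * Cst + 1) * J)) (at_right 0)"
      by (intro tendsto_intros)
    moreover have "\<forall>\<^sub>F e in at_right 0. \<bar>integral {0..1} (\<lambda>x. \<Delta> x * T (\<sigma> x))\<bar>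
      \<le> real m * Cst * integral {0..1} (\<lambda>x. \<bar>\<Delta> x\<bar> * GT (\<sigma> x)) + e * ((real m * Cst + 1) * J)"
      using H by (auto simp: eventually_at_right_less intro: eventually_mono[OF eventually_at_right_less])
    ultimately show ?thesis
      using tendsto_lowerbound trivial_limit_at_right_real by fastforce
  qed
  then show ?thesis by (simp add: T_def GT_def)
qed

text \<open>\<open>x0\<close> maximises \<open>\<bar>\<Delta> x\<bar> exp (- \<Lambda> x)\<close>. A tent of width \<open>h\<close> at \<open>\<sigma> x0\<close> then gives at least
  \<open>\<Delta> x0 h\<^sup>2 / (8 K)\<close> on the left of \<open>product_estimate\<close> and at most \<open>3 m Cst \<Delta> x0 h\<^sup>2 / \<Lambda>\<close> on the right.\<close>

lemma ortho_imp_nonpos: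
  fixes \<Delta> \<sigma> d\<sigma> :: "real \<Rightarrow> real"
  assumes \<Delta>: "continuous_on {0..1} \<Delta>"
    and \<sigma>_pos: "\<And>x. x \<in> {0..1} \<Longrightarrow> 0 \<le> \<sigma> x"
    and \<sigma>_deriv: "\<And>x. x \<in> {0..1} \<Longrightarrow> (\<sigma> has_real_derivative d\<sigma> x) (at x within {0..1})"
    and d\<sigma>: "\<And>x. x \<in> {0..1} \<Longrightarrow> \<delta> \<le> d\<sigma> x" "\<And>x. x \<in> {0..1} \<Longrightarrow> d\<sigma> x \<le> K"
    and ortho: "\<And>n. 1 \<le> n \<Longrightarrow> integral {0..1} (\<lambda>x. \<Delta> x * exp (- (real n * \<sigma> x)) * (\<Sum>i<m. c n i x)) = 0"
  defines "\<Lambda> \<equiv> 24 * K * (real m * Cst) + 1"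
  assumes x0: "x0 \<in> {0..1}" and mx: "\<And>x. x \<in> {0..1} \<Longrightarrow> \<bar>\<Delta> x\<bar> * exp (- (\<Lambda> * x)) \<le> \<bar>\<Delta> x0\<bar> * exp (- (\<Lambda> * x0))"
  shows "\<Delta> x0 \<le> 0"
proof (rule ccontr)
  assume "\<not> \<Delta> x0 \<le> 0"
  then have pos: "0 < \<Delta> x0" by simp
  have \<sigma>_cont: "continuous_on {0..1} \<sigma>" using \<sigma>_deriv by (meson DERIV_continuous_on)
  have K0: "0 < K" using d\<sigma>[of 0] \<delta>0 by simp
  have C0: "0 < real m * Cst" using m0 Cst_pos by simp
  have L0: "0 < \<Lambda>" using K0 C0 by (simp add: \<Lambda>_def add_pos_pos)
  have lip: "\<delta> * (y - x) \<le> \<sigma> y - \<sigma> x" "\<sigma> y - \<sigma> x \<le> K * (y - x)" if "0 \<le> x" "x \<le> y" "y \<le> 1" for x y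
  proof -
    have sub: "{x..y} \<subseteq> {0..1}" using that by auto
    have "\<sigma> x - \<delta> * x \<le> \<sigma> y - \<delta> * y"
    proof (rule within_deriv_nonneg[OF that(2), of "\<lambda>x. \<sigma> x - \<delta> * x"])
      fix t assume t: "t \<in> {x..y}"
      show "((\<lambda>x. \<sigma> x - \<delta> * x) has_real_derivative d\<sigma> t - \<delta>) (at t within {x..y})"
        using t sub by (auto intro!: derivative_eq_intros DERIV_subset[OF \<sigma>_deriv sub])
      show "0 \<le> d\<sigma> t - \<delta>" using d\<sigma>(1)[of t] t sub by auto
    qed
    then show "\<delta> * (y - x) \<le> \<sigma> y - \<sigma> x" by (simp add: algebra_simps)
    have "K * x - \<sigma> x \<le> K * y - \<sigma> y"
    proof (rule within_deriv_nonneg[OF that(2), of "\<lambda>x. K * x - \<sigma> x"])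
      fix t assume t: "t \<in> {x..y}"
      show "((\<lambda>x. K * x - \<sigma> x) has_real_derivative K - d\<sigma> t) (at t within {x..y})"
        using t sub by (auto intro!: derivative_eq_intros DERIV_subset[OF \<sigma>_deriv sub])
      show "0 \<le> K - d\<sigma> t" using d\<sigma>(2)[of t] t sub by auto
    qed
    then show "\<sigma> y - \<sigma> x \<le> K * (y - x)" by (simp add: algebra_simps)
  qed
  have lip': "\<delta> * \<bar>x - x0\<bar> \<le> \<bar>\<sigma> x - \<sigma> x0\<bar>" "\<bar>\<sigma> x - \<sigma> x0\<bar> \<le> K * \<bar>x - x0\<bar>" if "x \<in> {0..1}" for x
  proof -
    have "\<delta> * \<bar>x - x0\<bar> \<le> \<bar>\<sigma> x - \<sigma> x0\<bar> \<and> \<bar>\<sigma> x - \<sigma> x0\<bar> \<le> K * \<bar>x - x0\<bar>"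
    proof (cases "x \<le> x0")
      case True
      moreover have "0 \<le> \<delta> * (x0 - x)" using True \<delta>0 by simp
      ultimately show ?thesis using lip[of x x0] that x0 by (simp add: abs_minus_commute)
    next
      case False
      moreover have "0 \<le> \<delta> * (x - x0)" using False \<delta>0 by simp
      ultimately show ?thesis using lip[of x0 x] that x0 by simp
    qed
    then show "\<delta> * \<bar>x - x0\<bar> \<le> \<bar>\<sigma> x - \<sigma> x0\<bar>" "\<bar>\<sigma> x - \<sigma> x0\<bar> \<le> K * \<bar>x - x0\<bar>" by auto
  qed
  obtain d where d: "0 < d" "\<And>x. x \<in> {0..1} \<Longrightarrow> \<bar>x - x0\<bar> < d \<Longrightarrow> \<bar>\<Delta> x - \<Delta> x0\<bar> < \<Delta> x0 / 2"
    using \<Delta> x0 pos unfolding continuous_on_iff dist_real_def by (metis half_gt_zero)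
  \<comment> \<open>The bound \<delta>/\<Lambda> limits the growth of
    \<open>exp (\<Lambda> * x)\<close> over the distance h/\<delta> to a factor
    \<open>exp 1\<close>; \<delta>d keeps the support of the tent where
    \<open>\<Delta> \<ge> \<Delta> x0 / 2\<close>; and \<open>K\<close> lets an interval of length
    \<open>h / (2 * K)\<close> fit into the unit interval on one side of \<open>x0\<close>.\<close>
  define h where "h = min (min (\<delta> / \<Lambda>) (\<delta> * d)) K"
  have h: "0 < h" "h \<le> \<delta> / \<Lambda>" "h \<le> \<delta> * d" "h \<le> K"
    using \<delta>0 L0 d K0 by (auto simp: h_def)
  define z0 where "z0 = \<sigma> x0"
  note ci = continuous_intros \<Delta> \<sigma>_cont continuous_on_compose2[OF tent_cont _ subset_UNIV]
  note ci = ci continuous_on_compose2[OF tent_tail_cont[OF h(1)] _ subset_UNIV]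
  have est: "\<bar>integral {0..1} (\<lambda>x. \<Delta> x * tent z0 h (\<sigma> x))\<bar>
      \<le> real m * Cst * integral {0..1} (\<lambda>x. \<bar>\<Delta> x\<bar> * tent_tail z0 h (\<sigma> x))"
    by (rule product_estimate[OF \<Delta> \<sigma>_cont \<sigma>_pos ortho h(1)])
  have lower: "\<Delta> x0 / 2 * (h\<^sup>2 / (4 * K)) \<le> integral {0..1} (\<lambda>x. \<Delta> x * tent z0 h (\<sigma> x))"
  proof -
    have w: "h / (2 * K) \<le> 1 / 2" "0 < h / (2 * K)" using h K0 by (auto simp: field_simps)
    obtain p q where pq: "0 \<le> p" "q \<le> 1" "q - p = h / (2 * K)" "\<And>x. x \<in> {p..q} \<Longrightarrow> \<bar>x - x0\<bar> \<le> h / (2 * K)"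
    proof (cases "x0 \<le> 1 / 2")
      case True
      then show ?thesis using that[of x0 "x0 + h / (2 * K)"] x0 w by force
    next
      case False
      then show ?thesis using that[of "x0 - h / (2 * K)" x0] x0 w by force
    qed
    have pq01: "{p..q} \<subseteq> {0..1}" using pq by auto
    have "\<Delta> x0 / 2 * (h\<^sup>2 / (4 * K)) = \<Delta> x0 / 2 * (h / 2 * (q - p))"
      by (simp add: pq(3) power2_eq_square)
    also have "h / 2 * (q - p) \<le> integral {p..q} (\<lambda>x. tent z0 h (\<sigma> x))"
    proof -
      have "p \<le> q" using pq w by linarith
      then have "h / 2 * (q - p) = integral {p..q} (\<lambda>x. h / 2)" by simp
      also have "\<dots> \<le> integral {p..q} (\<lambda>x. tent z0 h (\<sigma> x))"
      proof (rule integral_le)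
        show "(\<lambda>x. tent z0 h (\<sigma> x)) integrable_on {p..q}"
          by (intro integrable_continuous_real ci continuous_on_subset[OF \<sigma>_cont pq01])
        fix x assume x: "x \<in> {p..q}"
        have "\<bar>\<sigma> x - z0\<bar> \<le> K * \<bar>x - x0\<bar>" using lip'(2)[of x] x pq01 by (auto simp: z0_def)
        also have "\<dots> \<le> K * (h / (2 * K))" using pq(4)[OF x] K0 by (intro mult_left_mono) auto
        also have "\<dots> = h / 2" using K0 by simp
        finally show "h / 2 \<le> tent z0 h (\<sigma> x)" by (simp add: tent_def max_def)
      qed auto
      finally show ?thesis .
    qed
    also have "\<dots> \<le> integral {0..1} (\<lambda>x. tent z0 h (\<sigma> x))"
      by (rule integral_subset_le[OF pq01])
        (use tent_nonneg in \<open>auto intro!: integrable_continuous_real ci continuous_on_subset[OF \<sigma>_cont pq01]\<close>)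
    also have "\<Delta> x0 / 2 * \<dots> = integral {0..1} (\<lambda>x. \<Delta> x0 / 2 * tent z0 h (\<sigma> x))" by simp
    also have "\<dots> \<le> integral {0..1} (\<lambda>x. \<Delta> x * tent z0 h (\<sigma> x))"
    proof (rule integral_le)
      fix x :: real assume x: "x \<in> {0..1}"
      show "\<Delta> x0 / 2 * tent z0 h (\<sigma> x) \<le> \<Delta> x * tent z0 h (\<sigma> x)"
      proof (cases "\<bar>\<sigma> x - z0\<bar> < h")
        case True
        then have "\<delta> * \<bar>x - x0\<bar> < \<delta> * d" using lip'(1)[OF x] h by (simp add: z0_def)
        then have "\<bar>x - x0\<bar> < d" using \<delta>0 by simp
        then have "\<Delta> x0 / 2 \<le> \<Delta> x" using d(2)[OF x] by (simp add: abs_if split: if_splits)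
        then show ?thesis using tent_nonneg by (rule mult_right_mono)
      qed (simp add: tent_def)
    qed (intro integrable_continuous_real ci)+
    finally show ?thesis using pos by simp
  qed
  have upper: "integral {0..1} (\<lambda>x. \<bar>\<Delta> x\<bar> * tent_tail z0 h (\<sigma> x)) \<le> 3 * h\<^sup>2 * \<Delta> x0 / \<Lambda>"
  proof -
    \<comment> \<open>Beyond \<open>x0 + h / \<delta>\<close> the value of \<sigma> exceeds
      \<open>z0 + h\<close>, where the tail vanishes. The error thus lives on the left of
      \<open>x1\<close>, where maximality of \<open>x0\<close> bounds \<Delta> by a growing
      exponential whose integral gains \<open>1 / \<Lambda>\<close>.\<close>
    define x1 where "x1 = min 1 (x0 + h / \<delta>)"
    define D where "D = \<Delta> x0 * exp (- (\<Lambda> * x0))"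
    have x1: "0 \<le> x1" "x1 \<le> 1" using x0 h(1) \<delta>0 by (auto simp: x1_def)
    have D0: "0 < D" using pos by (simp add: D_def)
    have ii: "(\<lambda>x. \<bar>\<Delta> x\<bar> * tent_tail z0 h (\<sigma> x)) integrable_on {0..1}"
      by (intro integrable_continuous_real ci)
    have "integral {x1..1} (\<lambda>x. \<bar>\<Delta> x\<bar> * tent_tail z0 h (\<sigma> x)) = integral {x1..1} (\<lambda>x. 0)"
    \<comment> \<open>When \<open>x1\<close> is cut off at 1, the tail may be nonzero at that one
      remaining point.\<close>
    proof (rule integral_spike[of "{1}"])
      fix x assume x: "x \<in> {x1..1} - {1}"
      then have "x0 + h / \<delta> \<le> x" by (auto simp: x1_def)
      then have "h \<le> \<delta> * (x - x0)" using \<delta>0 by (simp add: field_simps)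
      also have "\<dots> \<le> \<sigma> x - \<sigma> x0"
        using \<open>x0 + h / \<delta> \<le> x\<close> h(1) \<delta>0 x x0 x1 by (intro lip(1)) (auto simp: x1_def intro: order_trans[of x0 "x0 + h / \<delta>"])
      finally show "0 = \<bar>\<Delta> x\<bar> * tent_tail z0 h (\<sigma> x)" using tent_tail_zero[OF h(1), of z0 "\<sigma> x"] by (simp add: z0_def)
    qed auto
    then have "integral {0..1} (\<lambda>x. \<bar>\<Delta> x\<bar> * tent_tail z0 h (\<sigma> x)) = integral {0..x1} (\<lambda>x. \<bar>\<Delta> x\<bar> * tent_tail z0 h (\<sigma> x))"
      using Henstock_Kurzweil_Integration.integral_combine[OF x1 ii] by simp
    also have "\<dots> \<le> integral {0..x1} (\<lambda>x. h\<^sup>2 * D * exp (\<Lambda> * x))"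
    proof (rule integral_le)
      show "(\<lambda>x. \<bar>\<Delta> x\<bar> * tent_tail z0 h (\<sigma> x)) integrable_on {0..x1}"
        using ii by (rule integrable_on_subinterval) (use x1 in auto)
      show "(\<lambda>x. h\<^sup>2 * D * exp (\<Lambda> * x)) integrable_on {0..x1}" by (intro integrable_continuous_real continuous_intros)
      fix x assume x: "x \<in> {0..x1}"
      have "\<bar>\<Delta> x\<bar> * exp (- (\<Lambda> * x)) \<le> D" using mx[of x] x x1 pos by (simp add: D_def)
      then have "\<bar>\<Delta> x\<bar> * exp (- (\<Lambda> * x)) * exp (\<Lambda> * x) \<le> D * exp (\<Lambda> * x)" by (intro mult_right_mono) auto
      then have "\<bar>\<Delta> x\<bar> \<le> D * exp (\<Lambda> * x)" by (simp add: mult.assoc flip: exp_add)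
      then have "\<bar>\<Delta> x\<bar> * tent_tail z0 h (\<sigma> x) \<le> (D * exp (\<Lambda> * x)) * h\<^sup>2"
        by (intro mult_mono tent_tail_le tent_tail_nonneg h(1)) (use D0 in auto)
      then show "\<bar>\<Delta> x\<bar> * tent_tail z0 h (\<sigma> x) \<le> h\<^sup>2 * D * exp (\<Lambda> * x)" by (simp add: mult_ac)
    qed
    also have "\<dots> = h\<^sup>2 * D * exp (\<Lambda> * x1) / \<Lambda> - h\<^sup>2 * D * exp (\<Lambda> * 0) / \<Lambda>"
    proof (rule integral_unique, rule fundamental_theorem_of_calculus[OF x1(1)])
      fix x
      have "((\<lambda>x. h\<^sup>2 * D * exp (\<Lambda> * x) / \<Lambda>) has_real_derivative h\<^sup>2 * D * exp (\<Lambda> * x)) (at x within {0..x1})"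
        by (rule derivative_eq_intros refl)+ (use L0 in auto)
      then show "((\<lambda>x. h\<^sup>2 * D * exp (\<Lambda> * x) / \<Lambda>) has_vector_derivative h\<^sup>2 * D * exp (\<Lambda> * x)) (at x within {0..x1})"
        by (simp add: has_real_derivative_iff_has_vector_derivative)
    qed
    also have "\<dots> \<le> h\<^sup>2 * D * exp (\<Lambda> * x1) / \<Lambda>" using D0 L0 by simp
    also have "\<dots> \<le> h\<^sup>2 * D * (exp (\<Lambda> * x0) * 3) / \<Lambda>"
    proof -
      have "\<Lambda> * (h / \<delta>) \<le> 1" using h(2) L0 \<delta>0 by (simp add: field_simps)
      moreover have "\<Lambda> * x1 \<le> \<Lambda> * (x0 + h / \<delta>)" using L0 by (intro mult_left_mono) (auto simp: x1_def)
      ultimately have "\<Lambda> * x1 \<le> \<Lambda> * x0 + 1" by (simp add: algebra_simps)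
      then have "exp (\<Lambda> * x1) \<le> exp (\<Lambda> * x0) * exp 1" by (simp flip: exp_add)
      also have "\<dots> \<le> exp (\<Lambda> * x0) * 3" using exp_le by (intro mult_left_mono) auto
      finally show ?thesis using D0 L0 by (intro divide_right_mono mult_left_mono) auto
    qed
    also have "\<dots> = 3 * h\<^sup>2 * \<Delta> x0 / \<Lambda>" by (simp add: D_def mult_ac flip: exp_add)
    finally show ?thesis .
  qed
  have "\<Delta> x0 / 2 * (h\<^sup>2 / (4 * K)) \<le> real m * Cst * (3 * h\<^sup>2 * \<Delta> x0 / \<Lambda>)"
    using lower est mult_left_mono[OF upper, of "real m * Cst"] C0 by linarith
  then have "(h\<^sup>2 * \<Delta> x0) * \<Lambda> \<le> (h\<^sup>2 * \<Delta> x0) * (24 * K * (real m * Cst))"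
    using K0 L0 by (simp add: field_simps)
  then have "\<Lambda> \<le> 24 * K * (real m * Cst)" using pos h(1) by simp
  then show False by (simp add: \<Lambda>_def)
qed

text \<open>The point where the weighted modulus is largest is the same for \<Delta> and its
  negative, so both signs are excluded there, and the largest weighted modulus is 0.\<close>

lemma ortho_imp_zero:
  fixes \<Delta> \<sigma> d\<sigma> :: "real \<Rightarrow> real"
  assumes \<Delta>: "continuous_on {0..1} \<Delta>"
    and \<sigma>_pos: "\<And>x. x \<in> {0..1} \<Longrightarrow> 0 \<le> \<sigma> x"
    and \<sigma>_deriv: "\<And>x. x \<in> {0..1} \<Longrightarrow> (\<sigma> has_real_derivative d\<sigma> x) (at x within {0..1})"
    and d\<sigma>: "\<And>x. x \<in> {0..1} \<Longrightarrow> \<delta> \<le> d\<sigma> x" "\<And>x. x \<in> {0..1} \<Longrightarrow> d\<sigma> x \<le> K"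
    and ortho: "\<And>n. 1 \<le> n \<Longrightarrow> integral {0..1} (\<lambda>x. \<Delta> x * exp (- (real n * \<sigma> x)) * (\<Sum>i<m. c n i x)) = 0"
    and x: "x \<in> {0..1}"
  shows "\<Delta> x = 0"
proof -
  define \<Lambda> where "\<Lambda> = 24 * K * (real m * Cst) + 1"
  have "continuous_on {0..1} (\<lambda>x. \<bar>\<Delta> x\<bar> * exp (- (\<Lambda> * x)))" by (intro continuous_intros \<Delta>)
  then obtain x0 where x0: "x0 \<in> {0..1}" and mx: "\<And>x. x \<in> {0..1} \<Longrightarrow> \<bar>\<Delta> x\<bar> * exp (- (\<Lambda> * x)) \<le> \<bar>\<Delta> x0\<bar> * exp (- (\<Lambda> * x0))"
    using continuous_attains_sup[of "{0..1}" "\<lambda>x. \<bar>\<Delta> x\<bar> * exp (- (\<Lambda> * x))"] by auto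
  have "\<Delta> x0 \<le> 0"
    using ortho_imp_nonpos[OF \<Delta> \<sigma>_pos \<sigma>_deriv d\<sigma> ortho x0] mx unfolding \<Lambda>_def by blast
  moreover have "- \<Delta> x0 \<le> 0"
  proof (rule ortho_imp_nonpos[OF _ \<sigma>_pos \<sigma>_deriv d\<sigma> _ x0, of "\<lambda>x. - \<Delta> x"])
    show "continuous_on {0..1} (\<lambda>x. - \<Delta> x)" by (intro continuous_intros \<Delta>)
    show "integral {0..1} (\<lambda>x. - \<Delta> x * exp (- (real n * \<sigma> x)) * (\<Sum>i<m. c n i x)) = 0" if "1 \<le> n" for n
      using ortho[OF that] by simp
  qed (use mx in \<open>simp_all add: \<Lambda>_def\<close>)
  ultimately have "\<Delta> x0 = 0" by simp
  then show ?thesis using mx[OF x] by (simp add: mult_le_0_iff)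
qed

end

section \<open>Uniqueness for the vibrating string\<close>

definition ode_sol :: "(real \<Rightarrow> real) \<Rightarrow> (real \<Rightarrow> real) \<Rightarrow> (real \<Rightarrow> real) \<Rightarrow> bool" where
  "ode_sol V u v \<longleftrightarrow> (\<forall>x\<in>{0..1}. (u has_real_derivative v x) (at x within {0..1}) \<and>
     (v has_real_derivative V x * u x) (at x within {0..1}))"

text \<open>For fixed \<open>r\<close>, the pair \<open>(a, b)\<close> is a column of the 2 x 2
  Dirichlet-to-Neumann matrix of \<open>u'' = V u\<close>, with the derivative at 0 taken
  inward.\<close>

definition dn_data :: "(real \<Rightarrow> real) \<Rightarrow> bool \<Rightarrow> real \<Rightarrow> real \<Rightarrow> bool" where
  "dn_data V r a b \<longleftrightarrow> (\<exists>u v. ode_sol V u v \<and> u 0 = (if r then 0 else 1) \<and>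
     u 1 = (if r then 1 else 0) \<and> v 0 = a \<and> v 1 = b)"

lemma ode_sol_wronskian:
  assumes "ode_sol V u v" "ode_sol V w z"
  shows "v 1 * w 1 - u 1 * z 1 = v 0 * w 0 - u 0 * z 0"
proof -
  have "((\<lambda>x. v x * w x - u x * z x) has_real_derivative 0) (at x within {0..1})" if "x \<in> {0..1}" for x
  proof -
    note d = assms[unfolded ode_sol_def, THEN bspec, OF that]
    note d' = d(1)[THEN conjunct1] d(1)[THEN conjunct2] d(2)[THEN conjunct1] d(2)[THEN conjunct2]
    show ?thesis by (rule derivative_eq_intros d' refl)+ (simp add: algebra_simps)
  qed
  then have "\<exists>k. \<forall>x\<in>{0..1}. v x * w x - u x * z x = k"
    by (intro has_field_derivative_zero_constant) auto
  then show ?thesis by auto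
qed

lemma ode_sol_exists_right:
  assumes V: "continuous_on {0..1} V"
  obtains u v where "ode_sol V u v" "u 1 = A" "v 1 = B"
proof -
  define R :: "real \<Rightarrow> real" where "R x = 1 - x" for x
  have Rc: "continuous_on {0..1} R" and R01: "R ` {0..1} = {0..1}"
    unfolding R_def by (auto intro!: continuous_intros)
  have cV: "continuous_on {0..1} (\<lambda>x. - V (R x))"
    by (intro continuous_intros continuous_on_compose2[OF V Rc]) (use R01 in auto)
  obtain u v where uv: "u 0 = A" "v 0 = B"
    "\<And>x. x \<in> {0..1} \<Longrightarrow> (u has_real_derivative - 1 * v x) (at x within {0..1})"
    "\<And>x. x \<in> {0..1} \<Longrightarrow> (v has_real_derivative - V (R x) * u x) (at x within {0..1})"
    using linear_system_exists[of 0 1 "\<lambda>_. - 1" "\<lambda>x. - V (R x)" A B] cV continuous_on_const by auto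
  have "((\<lambda>x. w (R x)) has_real_derivative - d (R x)) (at x within {0..1})"
    if "\<And>x. x \<in> {0..1} \<Longrightarrow> (w has_real_derivative d x) (at x within {0..1})" "x \<in> {0..1}" for w d x
  proof -
    have "(R has_real_derivative - 1) (at x within {0..1})"
      unfolding R_def by (auto intro!: derivative_eq_intros)
    moreover have "(w has_real_derivative d (R x)) (at (R x) within R ` {0..1})"
      unfolding R01 using that by (auto simp: R_def)
    ultimately show ?thesis using DERIV_image_chain[of w "d (R x)" R x "{0..1}" "-1"] by (simp add: o_def)
  qed
  from this[OF uv(3)] this[OF uv(4)]
  have "ode_sol V (\<lambda>x. u (R x)) (\<lambda>x. v (R x))"
    by (simp add: ode_sol_def R_def)
  then show ?thesis using uv(1,2) by (intro that[of "\<lambda>x. u (R x)" "\<lambda>x. v (R x)"]) (auto simp: R_def)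
qed

text \<open>The Wronskian with each of the two basic solutions is constant, and comparing its end
  values expresses the end derivatives of any solution through its end values. The last identity is
  the symmetry of the Dirichlet-to-Neumann matrix.\<close>

lemma dn_data_endpoints:
  assumes "dn_data V False a b" "dn_data V True a' b'" "ode_sol V u v"
  shows "v 0 = u 0 * a - u 1 * b" "v 1 = u 1 * b' - u 0 * a'" "a' = - b"
proof -
  obtain w z where w: "ode_sol V w z" "w 0 = 1" "w 1 = 0" "z 0 = a" "z 1 = b"
    using assms(1) by (auto simp: dn_data_def)
  obtain w' z' where w': "ode_sol V w' z'" "w' 0 = 0" "w' 1 = 1" "z' 0 = a'" "z' 1 = b'"
    using assms(2) by (auto simp: dn_data_def)
  show "v 0 = u 0 * a - u 1 * b" using ode_sol_wronskian[OF assms(3) w(1)] w by simp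
  show "v 1 = u 1 * b' - u 0 * a'" using ode_sol_wronskian[OF assms(3) w'(1)] w' by simp
  show "a' = - b" using ode_sol_wronskian[OF w(1) w'(1)] w w' by simp
qed

text \<open>Green's identity. The end derivatives of both solutions are given by the same symmetric
  matrix, so the boundary terms cancel.\<close>

lemma dn_data_orthogonality:
  assumes dn: "dn_data V1 False a b" "dn_data V1 True a' b'" "dn_data V2 False a b" "dn_data V2 True a' b'"
    and s: "ode_sol V1 u1 v1" "ode_sol V2 u2 v2"
  shows "((\<lambda>x. (V1 x - V2 x) * (u1 x * u2 x)) has_integral 0) {0..1}"
proof -
  have "((\<lambda>x. (V1 x - V2 x) * (u1 x * u2 x)) has_integral
     (v1 1 * u2 1 - u1 1 * v2 1) - (v1 0 * u2 0 - u1 0 * v2 0)) {0..1}"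
  proof (rule fundamental_theorem_of_calculus)
    fix x :: real assume x: "x \<in> {0..1}"
    note d = s[unfolded ode_sol_def, THEN bspec, OF x]
    note d' = d(1)[THEN conjunct1] d(1)[THEN conjunct2] d(2)[THEN conjunct1] d(2)[THEN conjunct2]
    have "((\<lambda>x. v1 x * u2 x - u1 x * v2 x) has_real_derivative (V1 x - V2 x) * (u1 x * u2 x)) (at x within {0..1})"
      by (rule derivative_eq_intros d' refl)+ (simp add: algebra_simps)
    then show "((\<lambda>x. v1 x * u2 x - u1 x * v2 x) has_vector_derivative (V1 x - V2 x) * (u1 x * u2 x)) (at x within {0..1})"
      by (simp add: has_real_derivative_iff_has_vector_derivative)
  qed simp
  moreover have "(v1 1 * u2 1 - u1 1 * v2 1) - (v1 0 * u2 0 - u1 0 * v2 0) = 0"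
    by (simp only: dn_data_endpoints(1,2)[OF dn(1,2) s(1)] dn_data_endpoints(1,2)[OF dn(3,4) s(2)]
      dn_data_endpoints(3)[OF dn(1,2) s(1)]) (simp add: algebra_simps)
  ultimately show ?thesis by simp
qed

text \<open>\<open>b\<close> and \<open>a\<close> are the amplitudes of the decaying and the growing wave in the optical variable \<open>s\<close>;
  \<open>a 1 = 0\<close> says that no wave comes back from the right end.\<close>

definition jost where
  "jost P \<beta> s n u v a b \<longleftrightarrow> ode_sol (\<lambda>x. (real n)\<^sup>2 * P x) u v \<and> a 1 = 0 \<and> b 1 = 1 \<and>
    (\<forall>x\<in>{0..1}. u x = exp (- (real n * s x)) * (a x + b x) / (2 * sqrt (sqrt (P x))) \<and>
      (a has_real_derivative 2 * real n * sqrt (P x) * a x + \<beta> x * b x) (at x within {0..1}) \<and>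
      (b has_real_derivative \<beta> x * a x) (at x within {0..1}))"

lemma jostD:
  assumes "jost P \<beta> s n u v a b"
  shows "ode_sol (\<lambda>x. (real n)\<^sup>2 * P x) u v" "a 1 = 0" "b 1 = 1"
    "x \<in> {0..1} \<Longrightarrow> u x = exp (- (real n * s x)) * (a x + b x) / (2 * sqrt (sqrt (P x)))"
    "x \<in> {0..1} \<Longrightarrow> (a has_real_derivative 2 * real n * sqrt (P x) * a x + \<beta> x * b x) (at x within {0..1})"
    "x \<in> {0..1} \<Longrightarrow> (b has_real_derivative \<beta> x * a x) (at x within {0..1})"
  using assms by (auto simp: jost_def)

text \<open>The Liouville-Green splitting in exact form. With \<open>p\<close> the fourth root of
  \<open>P\<close>, the combinations \<open>p u + v / (n p)\<close> and
  \<open>p u - v / (n p)\<close> diagonalise the equation up to the coupling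
  \<open>p' / p = dP / (4 * P)\<close>, which is independent of \<open>n\<close>.\<close>

lemma jost_solution:
  fixes P dP s :: "real \<Rightarrow> real" and n :: nat
  assumes P: "\<And>x. x \<in> {0..1} \<Longrightarrow> 0 < P x"
    and dP: "\<And>x. x \<in> {0..1} \<Longrightarrow> (P has_real_derivative dP x) (at x within {0..1})"
    and s: "\<And>x. x \<in> {0..1} \<Longrightarrow> (s has_real_derivative sqrt (P x)) (at x within {0..1})"
    and n: "1 \<le> n"
  shows "\<exists>u v a b. jost P (\<lambda>x. dP x / (4 * P x)) s n u v a b"
proof -
  define p where "p x = sqrt (sqrt (P x))" for x
  define k where "k = real n"
  have k: "0 < k" using n by (simp add: k_def)
  have p: "0 < p x" "sqrt (P x) = (p x)\<^sup>2" "P x = p x ^ 4" if "x \<in> {0..1}" for x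
    using P[OF that] by (auto simp: p_def) (metis (no_types) less_imp_le power4_eq_xxxx real_sqrt_ge_zero real_sqrt_mult_self mult.assoc abs_of_nonneg)
  have dp: "(p has_real_derivative dP x / (4 * P x) * p x) (at x within {0..1})" if x: "x \<in> {0..1}" for x
  proof -
    have "(p has_real_derivative (dP x * (inverse (sqrt (P x)) / 2)) * (inverse (sqrt (sqrt (P x))) / 2)) (at x within {0..1})"
      unfolding p_def using P[OF x]
      by (auto intro!: derivative_eq_intros dP[OF x])
    also have "(dP x * (inverse (sqrt (P x)) / 2)) * (inverse (sqrt (sqrt (P x))) / 2) = dP x / (4 * P x) * p x"
      unfolding p_def[symmetric] using p[OF x] by (simp add: field_simps power4_eq_xxxx power2_eq_square)
    finally show ?thesis .
  qed
  have "continuous_on {0..1} (\<lambda>x. k\<^sup>2 * P x)"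
    by (intro continuous_intros DERIV_continuous_on[OF dP])
  \<comment> \<open>These end values are \<open>a 1 = 0\<close> and \<open>b 1 = 1\<close> solved
    for \<open>u 1\<close> and \<open>v 1\<close>.\<close>
  then obtain u v where uv: "ode_sol (\<lambda>x. k\<^sup>2 * P x) u v" and u1: "u 1 = exp (- (k * s 1)) / (2 * p 1)"
    and v1: "v 1 = - k * (p 1)\<^sup>2 * (exp (- (k * s 1)) / (2 * p 1))"
    by (rule ode_sol_exists_right)
  define a where "a x = exp (k * s x) * (p x * u x + v x / (k * p x))" for x
  define b where "b x = exp (k * s x) * (p x * u x - v x / (k * p x))" for x
  have p1: "0 < p 1" using p(1)[of 1] by simp
  have "a 1 = 0" using k p1 by (simp add: a_def u1 v1 field_simps power2_eq_square)
  moreover have "b 1 = 1"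
    using k p1 by (simp add: b_def v1 u1 field_simps power2_eq_square exp_minus)
  moreover have "u x = exp (- (k * s x)) * (a x + b x) / (2 * p x)" if "x \<in> {0..1}" for x
    using k p(1)[OF that] by (simp add: a_def b_def field_simps exp_minus)
  moreover have "(a has_real_derivative 2 * k * sqrt (P x) * a x + dP x / (4 * P x) * b x) (at x within {0..1})"
    "(b has_real_derivative dP x / (4 * P x) * a x) (at x within {0..1})" if x: "x \<in> {0..1}" for x
  proof -
    note d = uv[unfolded ode_sol_def, THEN bspec, OF x, THEN conjunct1]
      uv[unfolded ode_sol_def, THEN bspec, OF x, THEN conjunct2] dp[OF x] s[OF x]
    define e where "e = dP x / (4 * P x)"
    note d = d[unfolded e_def[symmetric] p(2)[OF x]]
    have kp: "k * p x \<noteq> 0" using k p(1)[OF x] by simp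
    show "(a has_real_derivative 2 * k * sqrt (P x) * a x + dP x / (4 * P x) * b x) (at x within {0..1})"
      unfolding a_def[abs_def] b_def e_def[symmetric] p(2)[OF x]
      apply (rule derivative_eq_intros d refl kp)+
      using k p(1)[OF x] p(3)[OF x]
      by (simp add: field_simps power4_eq_xxxx power2_eq_square)
    show "(b has_real_derivative dP x / (4 * P x) * a x) (at x within {0..1})"
      unfolding b_def[abs_def] a_def e_def[symmetric] p(2)[OF x]
      apply (rule derivative_eq_intros d refl kp)+
      using k p(1)[OF x] p(3)[OF x]
      by (simp add: field_simps power4_eq_xxxx power2_eq_square)
  qed
  ultimately show ?thesis using uv unfolding k_def p_def jost_def by blast
qed

lemma sum_lessThan_4: "(\<Sum>j<4. f j) = f 0 + f 1 + f 2 + f (3::nat)"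
  by (simp add: numeral_eq_Suc)

theorem string_uniqueness:
  fixes P1 P2 dP1 dP2 :: "real \<Rightarrow> real"
  assumes P1: "\<And>x. x \<in> {0..1} \<Longrightarrow> 0 < P1 x" and P2: "\<And>x. x \<in> {0..1} \<Longrightarrow> 0 < P2 x"
    and dP1: "\<And>x. x \<in> {0..1} \<Longrightarrow> (P1 has_real_derivative dP1 x) (at x within {0..1})" "continuous_on {0..1} dP1"
    and dP2: "\<And>x. x \<in> {0..1} \<Longrightarrow> (P2 has_real_derivative dP2 x) (at x within {0..1})" "continuous_on {0..1} dP2"
    and dn: "\<And>n r. 1 \<le> n \<Longrightarrow> \<exists>a b. dn_data (\<lambda>x. (real n)\<^sup>2 * P1 x) r a b \<and> dn_data (\<lambda>x. (real n)\<^sup>2 * P2 x) r a b"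
    and x: "x \<in> {0..1}"
  shows "P1 x = P2 x"
proof -
  note cP = DERIV_continuous_on[OF dP1(1)] DERIV_continuous_on[OF dP2(1)]
  define s1 where "s1 x = integral {0..x} (\<lambda>t. sqrt (P1 t))" for x
  define s2 where "s2 x = integral {0..x} (\<lambda>t. sqrt (P2 t))" for x
  have s1: "(s1 has_real_derivative sqrt (P1 x)) (at x within {0..1})" if "x \<in> {0..1}" for x
    unfolding s1_def by (rule integral_has_real_derivative[OF _ that]) (intro continuous_intros cP)
  have s2: "(s2 has_real_derivative sqrt (P2 x)) (at x within {0..1})" if "x \<in> {0..1}" for x
    unfolding s2_def by (rule integral_has_real_derivative[OF _ that]) (intro continuous_intros cP)
  have s_nonneg: "0 \<le> s1 x" "0 \<le> s2 x" if "x \<in> {0..1}" for x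
    unfolding s1_def s2_def
    by (intro integral_nonneg integrable_continuous_real continuous_intros continuous_on_subset[OF cP(1)]
      continuous_on_subset[OF cP(2)]; use that P1 P2 in \<open>auto intro: less_imp_le\<close>)+
  define \<beta>1 where "\<beta>1 x = dP1 x / (4 * P1 x)" for x
  define \<beta>2 where "\<beta>2 x = dP2 x / (4 * P2 x)" for x
  have c\<beta>: "continuous_on {0..1} \<beta>1" "continuous_on {0..1} \<beta>2"
    unfolding \<beta>1_def \<beta>2_def using P1 P2 by (auto intro!: continuous_intros cP dP1 dP2 simp: less_imp_neq[symmetric])
  have "\<forall>n. \<exists>u v a b. 1 \<le> n \<longrightarrow> jost P1 \<beta>1 s1 n u v a b"
    using jost_solution[OF P1 dP1(1) s1] unfolding \<beta>1_def[abs_def] by blast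
  then obtain u1 v1 a1 b1 where J1: "\<And>n. 1 \<le> n \<Longrightarrow> jost P1 \<beta>1 s1 n (u1 n) (v1 n) (a1 n) (b1 n)"
    unfolding choice_iff by blast
  note j1 = jostD[OF J1]
  have "\<forall>n. \<exists>u v a b. 1 \<le> n \<longrightarrow> jost P2 \<beta>2 s2 n u v a b"
    using jost_solution[OF P2 dP2(1) s2] unfolding \<beta>2_def[abs_def] by blast
  then obtain u2 v2 a2 b2 where J2: "\<And>n. 1 \<le> n \<Longrightarrow> jost P2 \<beta>2 s2 n (u2 n) (v2 n) (a2 n) (b2 n)"
    unfolding choice_iff by blast
  note j2 = jostD[OF J2]
  \<comment> \<open>The index is read in binary: digit 1 says that the first factor is
    \<open>a1\<close> instead of \<open>b1\<close>, digit 2 the same for \<open>a2\<close> and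
    \<open>b2\<close>. The coupling exchanges one factor at a time, at the cost \<beta>1 or
    \<beta>2, so the diagonal of \<open>M\<close> is zero. Each growing factor contributes twice its
    optical length to the phase.\<close>
  define M where "M i j = (if (i, j) \<in> {(0,1), (1,0), (2,3), (3,2)} then \<beta>1
      else if (i, j) \<in> {(0,2), (2,0), (1,3), (3,1)} then \<beta>2 else (\<lambda>_. 0))" for i j :: nat
  define p where "p i x = (if i \<in> {1,3} then 2 * s1 x else 0) + (if i \<in> {2,3} then 2 * s2 x else 0)" for i :: nat and x
  define dp where "dp i x = (if i \<in> {1,3} then 2 * sqrt (P1 x) else 0) + (if i \<in> {2,3} then 2 * sqrt (P2 x) else 0)" for i :: nat and x
  define c where "c n i x = (if i \<in> {1,3} then a1 n x else b1 n x) * (if i \<in> {2,3} then a2 n x else b2 n x)" for n i :: nat and x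
  obtain B where B: "0 < B" "\<And>x. x \<in> {0..1} \<Longrightarrow> \<bar>\<beta>1 x\<bar> \<le> B" "\<And>x. x \<in> {0..1} \<Longrightarrow> \<bar>\<beta>2 x\<bar> \<le> B"
  proof -
    have "bounded (\<beta>1 ` {0..1})" "bounded (\<beta>2 ` {0..1})"
      by (auto intro!: compact_imp_bounded compact_continuous_image c\<beta>)
    then obtain B1 B2 where "\<forall>y\<in>\<beta>1 ` {0..1}. norm y \<le> B1" "\<forall>y\<in>\<beta>2 ` {0..1}. norm y \<le> B2"
      unfolding bounded_iff by blast
    then show ?thesis by (intro that[of "max 1 (max B1 B2)"]) (auto simp: le_max_iff_disj)
  qed
  obtain \<delta> where \<delta>: "0 < \<delta>" "\<And>x. x \<in> {0..1} \<Longrightarrow> \<delta> \<le> sqrt (P1 x)" "\<And>x. x \<in> {0..1} \<Longrightarrow> \<delta> \<le> sqrt (P2 x)"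
  proof -
    have "\<exists>y\<in>{0..1}. \<forall>x\<in>{0..1}. sqrt (P1 y) \<le> sqrt (P1 x)" "\<exists>y\<in>{0..1}. \<forall>x\<in>{0..1}. sqrt (P2 y) \<le> sqrt (P2 x)"
      by (auto intro!: continuous_attains_inf continuous_intros cP simp del: real_sqrt_le_iff)
    then obtain y1 y2 where y: "y1 \<in> {0..1}" "\<forall>x\<in>{0..1}. sqrt (P1 y1) \<le> sqrt (P1 x)"
      "y2 \<in> {0..1}" "\<forall>x\<in>{0..1}. sqrt (P2 y2) \<le> sqrt (P2 x)" by blast
    show ?thesis
    proof (rule that[of "min (sqrt (P1 y1)) (sqrt (P2 y2))"])
      show "0 < min (sqrt (P1 y1)) (sqrt (P2 y2))" using P1[OF y(1)] P2[OF y(3)] by simp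
    qed (use y in \<open>auto simp: min_le_iff_disj simp del: real_sqrt_le_iff\<close>)
  qed
  obtain K where K: "\<And>x. x \<in> {0..1} \<Longrightarrow> sqrt (P1 x) + sqrt (P2 x) \<le> K"
  proof -
    have "\<exists>y\<in>{0..1}. \<forall>x\<in>{0..1}. sqrt (P1 x) + sqrt (P2 x) \<le> sqrt (P1 y) + sqrt (P2 y)"
      by (intro continuous_attains_sup continuous_intros cP) auto
    then show ?thesis using that by blast
  qed
  have i4: "i = 0 \<or> i = 1 \<or> i = 2 \<or> i = 3" if "i < 4" for i :: nat using that by auto
  interpret transport 4 M p dp c B \<delta>
  proof
    show "continuous_on {0..1} (M i j)" for i j
      by (auto simp: M_def intro!: c\<beta>)
    show "\<bar>M i j x\<bar> \<le> B" if "x \<in> {0..1}" for i j x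
      using B that by (auto simp: M_def less_imp_le)
    show "M 0 0 x = 0" for x by (simp add: M_def)
    show "(p i has_real_derivative dp i x) (at x within {0..1})" if "x \<in> {0..1}" for i x
      unfolding p_def dp_def using s1[OF that] s2[OF that] by (auto intro!: derivative_eq_intros)
    show "\<delta> \<le> dp i x" if "0 < i" "i < 4" "x \<in> {0..1}" for i x
      using i4[OF that(2)] that(1) \<delta>(1) \<delta>(2,3)[OF that(3)] by (auto simp: dp_def)
    show "p 0 x = 0" "dp 0 x = 0" for x by (auto simp: p_def dp_def)
    show "c n i 1 = (if i = 0 then 1 else 0)" if "1 \<le> n" "i < 4" for n i
      using j1(2,3)[OF that(1)] j2(2,3)[OF that(1)] i4[OF that(2)] by (auto simp: c_def)
    show "(c n i has_real_derivative real n * dp i x * c n i x + (\<Sum>j<4. M i j x * c n j x)) (at x within {0..1})"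
      if n: "1 \<le> n" and i: "i < 4" and x: "x \<in> {0..1}" for n i x
    proof -
      note d = j1(5,6)[OF n x] j2(5,6)[OF n x]
      note D = DERIV_mult'[OF d(1) d(3)] DERIV_mult'[OF d(1) d(4)] DERIV_mult'[OF d(2) d(3)] DERIV_mult'[OF d(2) d(4)]
      from i4[OF i] show ?thesis
        by (elim disjE; simp add: c_def[abs_def] M_def dp_def sum_lessThan_4)
          (rule DERIV_cong, rule D, simp add: algebra_simps)+
    qed
  qed (use B \<delta> in auto)
  \<comment> \<open>The Liouville-Green denominators of \<open>u1 * u2\<close> are
    \<open>4 * q x\<close>. Absorbing \<open>q\<close> into \<Delta> leaves the exponential of
    \<open>s1 + s2\<close> and the sum of the four products.\<close>
  define q where "q x = sqrt (sqrt (P1 x)) * sqrt (sqrt (P2 x))" for x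
  have q: "0 < q x" if "x \<in> {0..1}" for x using P1[OF that] P2[OF that] by (simp add: q_def)
  define \<Delta> where "\<Delta> x = (P1 x - P2 x) / q x" for x
  have "\<Delta> x = 0"
  proof (rule ortho_imp_zero[of \<Delta> "\<lambda>x. s1 x + s2 x" "\<lambda>x. sqrt (P1 x) + sqrt (P2 x)" K, OF _ _ _ _ K _ x])
    show "continuous_on {0..1} \<Delta>"
    proof -
      have "sqrt (sqrt (P1 x)) * sqrt (sqrt (P2 x)) \<noteq> 0" if "x \<in> {0..1}" for x
        using q[OF that] by (auto simp: q_def)
      then show ?thesis unfolding \<Delta>_def q_def by (intro continuous_intros cP ballI)
    qed
    show "((\<lambda>x. s1 x + s2 x) has_real_derivative sqrt (P1 x) + sqrt (P2 x)) (at x within {0..1})"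
      if "x \<in> {0..1}" for x by (intro DERIV_add s1 s2 that)
    show "0 \<le> s1 x + s2 x" if "x \<in> {0..1}" for x using s_nonneg[OF that] by simp
    show "\<delta> \<le> sqrt (P1 x) + sqrt (P2 x)" if "x \<in> {0..1}" for x using \<delta>(2,3)[OF that] \<delta>(1) by linarith
    show "integral {0..1} (\<lambda>x. \<Delta> x * exp (- (real n * (s1 x + s2 x))) * (\<Sum>i<4. c n i x)) = 0" if n: "1 \<le> n" for n
    proof -
      obtain a b where ab: "dn_data (\<lambda>x. (real n)\<^sup>2 * P1 x) False a b" "dn_data (\<lambda>x. (real n)\<^sup>2 * P2 x) False a b"
        using dn[OF n] by blast
      obtain a' b' where ab': "dn_data (\<lambda>x. (real n)\<^sup>2 * P1 x) True a' b'" "dn_data (\<lambda>x. (real n)\<^sup>2 * P2 x) True a' b'"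
        using dn[OF n] by blast
      from has_integral_mult_right[OF dn_data_orthogonality[OF ab(1) ab'(1) ab(2) ab'(2) j1(1)[OF n] j2(1)[OF n]], of "4 / (real n)\<^sup>2"]
      have "((\<lambda>x. 4 / (real n)\<^sup>2 * (((real n)\<^sup>2 * P1 x - (real n)\<^sup>2 * P2 x) * (u1 n x * u2 n x))) has_integral 0) {0..1}"
        by simp
      then have "((\<lambda>x. \<Delta> x * exp (- (real n * (s1 x + s2 x))) * (\<Sum>i<4. c n i x)) has_integral 0) {0..1}"
      proof (rule has_integral_eq[rotated])
        fix x :: real assume x: "x \<in> {0..1}"
        have "(\<Sum>i<4. c n i x) = (a1 n x + b1 n x) * (a2 n x + b2 n x)"
          by (simp add: sum_lessThan_4 c_def algebra_simps)
        moreover have "exp (- (real n * (s1 x + s2 x))) = exp (- (real n * s1 x)) * exp (- (real n * s2 x))"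
          by (simp add: algebra_simps flip: exp_add)
        moreover have "4 / (real n)\<^sup>2 * (((real n)\<^sup>2 * P1 x - (real n)\<^sup>2 * P2 x) * (u1 n x * u2 n x))
          = (P1 x - P2 x) * (4 * (u1 n x * u2 n x))"
          using n by (simp add: field_simps)
        ultimately show "4 / (real n)\<^sup>2 * (((real n)\<^sup>2 * P1 x - (real n)\<^sup>2 * P2 x) * (u1 n x * u2 n x))
          = \<Delta> x * exp (- (real n * (s1 x + s2 x))) * (\<Sum>i<4. c n i x)"
          by (simp add: \<Delta>_def q_def j1(4)[OF n x] j2(4)[OF n x])
      qed
      then show ?thesis by (rule integral_unique)
    qed
  qed
  then show ?thesis using q[OF x] by (simp add: \<Delta>_def)
qed

section \<open>Smooth functions and the Dirichlet problem for the modes\<close>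

lemma Ck_on_imp_continuous: "Ck_on k S f \<Longrightarrow> continuous_on S f"
  by (cases k) (auto simp: continuous_on_eq_continuous_within intro: has_derivative_continuous)

lemma Ck_on_SucI:
  assumes "\<And>x. x \<in> S \<Longrightarrow> (f has_derivative f' x) (at x within S)" "\<And>v. Ck_on k S (\<lambda>x. f' x v)"
  shows "Ck_on (Suc k) S f"
  using assms by auto

lemma Ck_on_SucE:
  assumes "Ck_on (Suc k) S f"
  obtains f' where "\<And>x. x \<in> S \<Longrightarrow> (f has_derivative f' x) (at x within S)" "\<And>v. Ck_on k S (\<lambda>x. f' x v)"
  using assms by auto

lemma Ck_on_SucD: "Ck_on (Suc k) S f \<Longrightarrow> Ck_on k S f"
proof (induction k arbitrary: f)
  case 0 then show ?case using Ck_on_imp_continuous[of "Suc 0" S f] by simp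
next
  case (Suc k)
  then obtain f' where f': "\<forall>x\<in>S. (f has_derivative f' x) (at x within S)" "\<forall>v. Ck_on (Suc k) S (\<lambda>x. f' x v)"
    using Ck_on.simps(2) by blast
  then have "\<forall>v. Ck_on k S (\<lambda>x. f' x v)" using Suc.IH by blast
  then show ?case using f'(1) by auto
qed

lemma Ck_on_const [simp]: "Ck_on k S (\<lambda>x. c)"
  by (induction k arbitrary: c) (auto intro!: exI[of _ "\<lambda>x v. 0"])

lemma Ck_on_bounded_linear:
  assumes l: "bounded_linear l" and "Ck_on k S f"
  shows "Ck_on k S (\<lambda>x. l (f x))"
  using assms(2)
proof (induction k arbitrary: f)
  case 0 then show ?case using bounded_linear.continuous_on[OF l] by simp
next
  case (Suc k)
  from Suc.prems obtain f' where f': "\<And>x. x \<in> S \<Longrightarrow> (f has_derivative f' x) (at x within S)" "\<And>v. Ck_on k S (\<lambda>x. f' x v)"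
    by (rule Ck_on_SucE) blast
  show ?case
    by (rule Ck_on_SucI[OF bounded_linear.has_derivative[OF l f'(1)] Suc.IH[OF f'(2)]])
qed

lemma Ck_on_add: "Ck_on k S f \<Longrightarrow> Ck_on k S g \<Longrightarrow> Ck_on k S (\<lambda>x. f x + g x)"
proof (induction k arbitrary: f g)
  case 0 then show ?case by (auto intro: continuous_intros)
next
  case (Suc k)
  from Suc.prems(1) obtain f' where f': "\<And>x. x \<in> S \<Longrightarrow> (f has_derivative f' x) (at x within S)" "\<And>v. Ck_on k S (\<lambda>x. f' x v)"
    by (rule Ck_on_SucE) blast
  from Suc.prems(2) obtain g' where g': "\<And>x. x \<in> S \<Longrightarrow> (g has_derivative g' x) (at x within S)" "\<And>v. Ck_on k S (\<lambda>x. g' x v)"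
    by (rule Ck_on_SucE) blast
  show ?case
  proof (rule Ck_on_SucI)
    show "((\<lambda>x. f x + g x) has_derivative (\<lambda>v. f' x v + g' x v)) (at x within S)" if "x \<in> S" for x
      by (rule has_derivative_add[OF f'(1)[OF that] g'(1)[OF that]])
    show "Ck_on k S (\<lambda>x. f' x v + g' x v)" for v by (rule Suc.IH[OF f'(2) g'(2)])
  qed
qed

lemma Ck_on_bilinear:
  assumes bil: "bounded_bilinear prd" and "Ck_on k S f" "Ck_on k S g"
  shows "Ck_on k S (\<lambda>x. prd (f x) (g x))"
  using assms(2,3)
proof (induction k arbitrary: f g)
  case 0 then show ?case using bounded_bilinear.continuous_on[OF bil] by simp
next
  case (Suc k)
  from Suc.prems(1) obtain f' where f': "\<And>x. x \<in> S \<Longrightarrow> (f has_derivative f' x) (at x within S)" "\<And>v. Ck_on k S (\<lambda>x. f' x v)"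
    by (rule Ck_on_SucE) blast
  from Suc.prems(2) obtain g' where g': "\<And>x. x \<in> S \<Longrightarrow> (g has_derivative g' x) (at x within S)" "\<And>v. Ck_on k S (\<lambda>x. g' x v)"
    by (rule Ck_on_SucE) blast
  show ?case
  proof (rule Ck_on_SucI)
    show "((\<lambda>x. prd (f x) (g x)) has_derivative (\<lambda>v. prd (f x) (g' x v) + prd (f' x v) (g x))) (at x within S)" if "x \<in> S" for x
      by (rule bounded_bilinear.FDERIV[OF bil f'(1)[OF that] g'(1)[OF that]])
    show "Ck_on k S (\<lambda>x. prd (f x) (g' x v) + prd (f' x v) (g x))" for v
      by (rule Ck_on_add[OF Suc.IH[OF Ck_on_SucD[OF Suc.prems(1)] g'(2)] Suc.IH[OF f'(2) Ck_on_SucD[OF Suc.prems(2)]]])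
  qed
qed

lemmas Ck_on_mult = Ck_on_bilinear[OF bounded_bilinear_mult]
lemmas Ck_on_scaleR = Ck_on_bilinear[OF bounded_bilinear_scaleR]

lemma Ck_on_sum: "(\<And>i. i \<in> I \<Longrightarrow> Ck_on k S (f i)) \<Longrightarrow> Ck_on k S (\<lambda>x. \<Sum>i\<in>I. f i x)"
  by (induction I rule: infinite_finite_induct) (auto intro: Ck_on_add)

lemma Ck_on_prod:
  fixes f :: "'i \<Rightarrow> 'a::real_normed_vector \<Rightarrow> real"
  shows "(\<And>i. i \<in> I \<Longrightarrow> Ck_on k S (f i)) \<Longrightarrow> Ck_on k S (\<lambda>x. \<Prod>i\<in>I. f i x)"
  by (induction I rule: infinite_finite_induct) (auto intro: Ck_on_mult)

lemma Ck_on_Suc_realE: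
  fixes f :: "real \<Rightarrow> 'b::real_normed_vector"
  assumes "Ck_on (Suc k) S f"
  obtains f' where "\<And>t. t \<in> S \<Longrightarrow> (f has_vector_derivative f' t) (at t within S)" "Ck_on k S f'"
proof -
  from assms obtain f' where f': "\<And>x. x \<in> S \<Longrightarrow> (f has_derivative f' x) (at x within S)" "\<And>v. Ck_on k S (\<lambda>x. f' x v)"
    by (rule Ck_on_SucE) blast
  have "(f has_vector_derivative f' t 1) (at t within S)" if "t \<in> S" for t
  proof -
    have D: "(f has_derivative f' t) (at t within S)" using f' that by auto
    have "f' t v = v *\<^sub>R f' t 1" for v
      using linear_cmul[OF has_derivative_linear[OF D], of v 1] by simp
    then have "f' t = (\<lambda>v. v *\<^sub>R f' t 1)" by (rule ext)
    then show ?thesis using D by (simp add: has_vector_derivative_def)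
  qed
  then show ?thesis using f'(2) that[of "\<lambda>t. f' t 1"] by blast
qed

lemma Ck_on_Suc_realI:
  fixes f :: "real \<Rightarrow> 'b::real_normed_vector"
  assumes "\<And>t. t \<in> S \<Longrightarrow> (f has_vector_derivative f' t) (at t within S)" "Ck_on k S f'"
  shows "Ck_on (Suc k) S f"
proof (rule Ck_on_SucI)
  show "(f has_derivative (\<lambda>v. v *\<^sub>R f' t)) (at t within S)" if "t \<in> S" for t
    using assms(1)[OF that] by (simp add: has_vector_derivative_def)
  show "Ck_on k S (\<lambda>t. v *\<^sub>R f' t)" for v by (intro Ck_on_scaleR assms Ck_on_const)
qed

text \<open>The derivative is a product of \<open>f'\<close> and the function itself, so its
  differentiability of order \<open>k\<close> is the induction hypothesis; \<open>Ck_on_sqrt\<close>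
  works in the same way.\<close>

lemma Ck_on_inverse:
  fixes f :: "real \<Rightarrow> real"
  assumes "\<And>t. t \<in> S \<Longrightarrow> f t \<noteq> 0" "Ck_on k S f"
  shows "Ck_on k S (\<lambda>t. inverse (f t))"
  using assms(2)
proof (induction k)
  case 0 then show ?case using assms(1) by (auto intro!: continuous_intros)
next
  case (Suc k)
  from Suc.prems obtain f' where f': "\<And>t. t \<in> S \<Longrightarrow> (f has_vector_derivative f' t) (at t within S)" "Ck_on k S f'"
    by (rule Ck_on_Suc_realE) blast
  have "Ck_on k S (\<lambda>t. inverse (f t))" using Suc.IH Ck_on_SucD[OF Suc.prems] .
  then have "Ck_on k S (\<lambda>t. (- 1) * (inverse (f t) * f' t * inverse (f t)))"
    by (intro Ck_on_mult f' Ck_on_const)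
  moreover have "((\<lambda>t. inverse (f t)) has_vector_derivative (- 1) * (inverse (f t) * f' t * inverse (f t))) (at t within S)"
    if "t \<in> S" for t
    using f'(1)[OF that] assms(1)[OF that] that
    by (auto intro!: derivative_eq_intros simp flip: has_real_derivative_iff_has_vector_derivative)
  ultimately show ?case by (rule Ck_on_Suc_realI[rotated])
qed

lemma Ck_on_sqrt:
  fixes f :: "real \<Rightarrow> real"
  assumes "\<And>t. t \<in> S \<Longrightarrow> 0 < f t" "Ck_on k S f"
  shows "Ck_on k S (\<lambda>t. sqrt (f t))"
  using assms(2)
proof (induction k)
  case 0 then show ?case by (auto intro!: continuous_intros)
next
  case (Suc k)
  from Suc.prems obtain f' where f': "\<And>t. t \<in> S \<Longrightarrow> (f has_vector_derivative f' t) (at t within S)" "Ck_on k S f'"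
    by (rule Ck_on_Suc_realE) blast
  have "Ck_on k S (\<lambda>t. inverse (sqrt (f t)))"
    using Suc.IH[OF Ck_on_SucD[OF Suc.prems]] by (rule Ck_on_inverse[rotated]) (use assms(1) in force)
  then have "Ck_on k S (\<lambda>t. (1 / 2) * (f' t * inverse (sqrt (f t))))"
    by (intro Ck_on_mult f' Ck_on_const)
  moreover have "((\<lambda>t. sqrt (f t)) has_vector_derivative (1 / 2) * (f' t * inverse (sqrt (f t)))) (at t within S)"
    if "t \<in> S" for t
    using f'(1)[OF that] assms(1)[OF that] that
    by (auto intro!: derivative_eq_intros simp flip: has_real_derivative_iff_has_vector_derivative)
  ultimately show ?case by (rule Ck_on_Suc_realI[rotated])
qed

lemma Ck_on_det:
  fixes A :: "real \<Rightarrow> real^'d^'d"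
  assumes "\<And>i j. Ck_on k S (\<lambda>t. A t $ i $ j)"
  shows "Ck_on k S (\<lambda>t. det (A t))"
  unfolding det_def by (intro Ck_on_sum Ck_on_mult Ck_on_prod Ck_on_const assms)

lemma matrix_inv_mult:
  fixes A :: "real^'d^'d"
  assumes "det A \<noteq> 0"
  shows "A ** matrix_inv A = mat 1" "matrix_inv A ** A = mat 1"
  using assms[folded invertible_det_nz] someI_ex[of "\<lambda>B. A ** B = mat 1 \<and> B ** A = mat 1"]
  by (auto simp: invertible_def matrix_inv_def)

lemma matrix_inv_eqI:
  fixes A B :: "real^'d^'d"
  assumes "A ** B = mat 1"
  shows "matrix_inv A = B"
proof -
  have nz: "det A \<noteq> 0" using assms by (metis det_I det_mul mult_zero_left zero_neq_one)
  have "matrix_inv A = matrix_inv A ** (A ** B)" by (simp add: assms)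
  also have "\<dots> = B" by (simp add: matrix_mul_assoc matrix_inv_mult[OF nz])
  finally show ?thesis .
qed

lemma matrix_inv_cramer:
  fixes A :: "real^'d^'d"
  assumes "det A \<noteq> 0"
  shows "matrix_inv A $ k $ j = det (\<chi> i l. if l = k then axis j 1 $ i else A $ i $ l) / det A"
proof -
  have "A *v (matrix_inv A *v axis j 1) = axis j 1"
    using assms by (simp add: matrix_vector_mul_assoc matrix_inv_mult)
  then have "matrix_inv A *v axis j 1 = (\<chi> k. det (\<chi> i l. if l = k then axis j 1 $ i else A $ i $ l) / det A)"
    using cramer[OF assms] by blast
  moreover have "(matrix_inv A *v axis j 1) $ k = matrix_inv A $ k $ j"
    by (simp add: matrix_vector_mult_def axis_def if_distrib cong: if_cong)
  ultimately show ?thesis by simp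
qed

text \<open>The function is Cramer's expression for an entry of the inverse, in which only
  determinants occur; \<open>matrix_inv_cramer\<close> makes the identification.\<close>

lemma Ck_on_matrix_inv:
  fixes A :: "real \<Rightarrow> real^'d^'d"
  assumes A: "\<And>i j. Ck_on k S (\<lambda>t. A t $ i $ j)" and nz: "\<And>t. t \<in> S \<Longrightarrow> det (A t) \<noteq> 0"
  shows "Ck_on k S (\<lambda>t. det (\<chi> i l. if l = p then axis q 1 $ i else A t $ i $ l) * inverse (det (A t)))"
proof (intro Ck_on_mult Ck_on_det Ck_on_inverse nz A)
  show "Ck_on k S (\<lambda>t. (\<chi> i l. if l = p then axis q 1 $ i else A t $ i $ l) $ i $ j)" for i j
    using A by (cases "j = p") auto
qed

lemma Ck_on_cong: "(\<And>x. x \<in> S \<Longrightarrow> f x = g x) \<Longrightarrow> Ck_on k S f \<Longrightarrow> Ck_on k S g"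
proof (cases k)
  case (Suc j)
  assume eq: "\<And>x. x \<in> S \<Longrightarrow> f x = g x" and "Ck_on k S f"
  then obtain f' where f': "\<And>x. x \<in> S \<Longrightarrow> (f has_derivative f' x) (at x within S)" "\<And>v. Ck_on j S (\<lambda>x. f' x v)"
    using Suc Ck_on_SucE by metis
  show ?thesis unfolding Suc
    by (rule Ck_on_SucI[OF has_derivative_transform[OF _ _ f'(1)] f'(2)]) (simp_all add: eq)
qed (auto intro: continuous_on_eq)

section \<open>Regularity and the boundary value problem for a linear system\<close>

lemma Ck_on_linear_system:
  fixes a v f g :: "real \<Rightarrow> real"
  assumes "smooth_on S f" "smooth_on S g"
    and "\<And>t. t \<in> S \<Longrightarrow> (a has_real_derivative f t * v t) (at t within S)"
    and "\<And>t. t \<in> S \<Longrightarrow> (v has_real_derivative g t * a t) (at t within S)"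
  shows "Ck_on k S a \<and> Ck_on k S v"
proof (induction k)
  case 0 show ?case using DERIV_continuous_on[OF assms(3)] DERIV_continuous_on[OF assms(4)] by simp
next
  case (Suc k)
  have "Ck_on k S (\<lambda>t. f t * v t)" "Ck_on k S (\<lambda>t. g t * a t)"
    using Suc assms(1,2) by (auto simp: smooth_on_def intro: Ck_on_mult)
  then show ?case
    using Ck_on_Suc_realI[OF assms(3)[unfolded has_real_derivative_iff_has_vector_derivative]]
      Ck_on_Suc_realI[OF assms(4)[unfolded has_real_derivative_iff_has_vector_derivative]] by simp
qed

text \<open>Shooting. It suffices that the solution \<phi> starting from 0 with
  \<open>v 0 = 1\<close> is nonzero at \<open>L\<close>. Now \<phi>v has the derivative
  \<open>f v^2 + g \<phi>^2 \<ge> 0\<close>, so \<open>\<phi>^2\<close> is increasing; if it ended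
  at 0, then \<phi> would vanish identically and \<open>v\<close> would be 1, which contradicts
  \<open>\<phi>' = f v > 0\<close>.\<close>

lemma dirichlet_problem_ode:
  fixes f g :: "real \<Rightarrow> real"
  assumes L: "0 < L" and cont: "continuous_on {0..L} f" "continuous_on {0..L} g"
    and f: "\<And>t. t \<in> {0..L} \<Longrightarrow> 0 < f t" and g: "\<And>t. t \<in> {0..L} \<Longrightarrow> 0 \<le> g t"
  obtains a v where "a 0 = A" "a L = B"
    "\<And>t. t \<in> {0..L} \<Longrightarrow> (a has_real_derivative f t * v t) (at t within {0..L})"
    "\<And>t. t \<in> {0..L} \<Longrightarrow> (v has_real_derivative g t * a t) (at t within {0..L})"
proof -
  obtain \<phi> v where \<phi>: "\<phi> 0 = 0" "v 0 = 1"
    "\<And>t. t \<in> {0..L} \<Longrightarrow> (\<phi> has_real_derivative f t * v t) (at t within {0..L})"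
    "\<And>t. t \<in> {0..L} \<Longrightarrow> (v has_real_derivative g t * \<phi> t) (at t within {0..L})"
    using linear_system_exists[OF less_imp_le[OF L] cont] by metis
  obtain \<theta> w where \<theta>: "\<theta> 0 = 1" "w 0 = 0"
    "\<And>t. t \<in> {0..L} \<Longrightarrow> (\<theta> has_real_derivative f t * w t) (at t within {0..L})"
    "\<And>t. t \<in> {0..L} \<Longrightarrow> (w has_real_derivative g t * \<theta> t) (at t within {0..L})"
    using linear_system_exists[OF less_imp_le[OF L] cont] by metis
  have mono: "p x \<le> p y" if xy: "0 \<le> x" "x \<le> y" "y \<le> L"
    and p: "\<And>t. t \<in> {0..L} \<Longrightarrow> (p has_real_derivative p' t) (at t within {0..L})"
    "\<And>t. t \<in> {0..L} \<Longrightarrow> 0 \<le> p' t" for p p' :: "real \<Rightarrow> real" and x y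
  proof (rule within_deriv_nonneg[OF xy(2), of p p'])
    fix t assume t: "t \<in> {x..y}"
    show "(p has_real_derivative p' t) (at t within {x..y})"
      by (rule DERIV_subset[OF p(1)]) (use t xy in auto)
    show "0 \<le> p' t" using p(2) t xy by auto
  qed
  have prod_nonneg: "0 \<le> \<phi> t * v t" if t: "t \<in> {0..L}" for t
  proof -
    have "\<phi> 0 * v 0 \<le> \<phi> t * v t"
    proof (rule mono[where p = "\<lambda>t. \<phi> t * v t"])
      fix s assume s: "s \<in> {0..L}"
      show "((\<lambda>t. \<phi> t * v t) has_real_derivative f s * (v s)\<^sup>2 + g s * (\<phi> s)\<^sup>2) (at s within {0..L})"
        by (rule derivative_eq_intros \<phi>(3,4)[OF s] refl)+ (simp add: power2_eq_square)
      show "0 \<le> f s * (v s)\<^sup>2 + g s * (\<phi> s)\<^sup>2" using f[OF s] g[OF s] by simp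
    qed (use t in auto)
    then show ?thesis using \<phi> by simp
  qed
  have nz: "\<phi> L \<noteq> 0"
  proof
    assume z: "\<phi> L = 0"
    have \<phi>0: "\<phi> t = 0" if t: "t \<in> {0..L}" for t
    proof -
      have "(\<phi> t)\<^sup>2 \<le> (\<phi> L)\<^sup>2"
      proof (rule mono[where p = "\<lambda>t. (\<phi> t)\<^sup>2"])
        fix s assume s: "s \<in> {0..L}"
        show "((\<lambda>t. (\<phi> t)\<^sup>2) has_real_derivative 2 * f s * (\<phi> s * v s)) (at s within {0..L})"
          by (rule derivative_eq_intros \<phi>(3,4)[OF s] refl)+ simp
        show "0 \<le> 2 * f s * (\<phi> s * v s)" using f[OF s] prod_nonneg[OF s] by simp
      qed (use t in auto)
      then show ?thesis using z by simp
    qed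
    have "v t = 1" if t: "t \<in> {0..L}" for t
    proof -
      have "(v has_real_derivative 0) (at s within {0..L})" if "s \<in> {0..L}" for s
        using \<phi>(4)[OF that] \<phi>0[OF that] by simp
      then have "\<exists>c. \<forall>x\<in>{0..L}. v x = c" by (intro has_field_derivative_zero_constant) auto
      then show ?thesis using \<phi>(2) t L by force
    qed
    then obtain x where "x \<in> {0<..<L}" "\<phi> L - \<phi> 0 = f x * 1 * (L - 0)"
      using mvt_within[OF L, of \<phi> "\<lambda>t. f t * 1"] \<phi>(3) by auto
    then show False using z \<phi>(1) f[of x] L by simp
  qed
  define c where "c = (B - A * \<theta> L) / \<phi> L"
  show ?thesis
  proof (rule that[of "\<lambda>t. A * \<theta> t + c * \<phi> t" "\<lambda>t. A * w t + c * v t"])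
    fix t assume t: "t \<in> {0..L}"
    show "((\<lambda>t. A * \<theta> t + c * \<phi> t) has_real_derivative f t * (A * w t + c * v t)) (at t within {0..L})"
      "((\<lambda>t. A * w t + c * v t) has_real_derivative g t * (A * \<theta> t + c * \<phi> t)) (at t within {0..L})"
      by (rule derivative_eq_intros \<phi>(3,4)[OF t] \<theta>(3,4)[OF t] refl | simp add: algebra_simps)+
  qed (use \<phi> \<theta> nz in \<open>simp_all add: c_def\<close>)
qed

section \<open>Positive definite matrices\<close>

lemma sum_UNIV_option: "(\<Sum>i\<in>(UNIV::'n::finite option set). f i) = f None + (\<Sum>\<alpha>\<in>UNIV. f (Some \<alpha>))"
  by (simp add: UNIV_option_conv sum.reindex)

text \<open>Induction along the Cholesky decomposition: the Schur complement \<open>A'\<close> is again positive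
  definite, and \<open>A - A'\<close> has rank one.\<close>

lemma trace_inequality_set:
  fixes A H :: "'i \<Rightarrow> 'i \<Rightarrow> real"
  assumes "finite I" and "\<And>i j. A i j = A j i"
    and "\<And>x. (\<exists>i\<in>I. x i \<noteq> 0) \<Longrightarrow> 0 < (\<Sum>i\<in>I. \<Sum>j\<in>I. x i * x j * A i j)"
    and "\<And>x. (\<Sum>i\<in>I. \<Sum>j\<in>I. x i * x j * H i j) \<le> 0"
  shows "(\<Sum>i\<in>I. \<Sum>j\<in>I. A i j * H i j) \<le> 0"
  using assms
proof (induction I arbitrary: A rule: finite_induct)
  case (insert k I)
  note sym = insert.prems(1) and pos = insert.prems(2) and neg = insert.prems(3)
  have split: "(\<Sum>i\<in>insert k I. \<Sum>j\<in>insert k I. F i j)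
      = F k k + (\<Sum>j\<in>I. F k j) + (\<Sum>i\<in>I. F i k) + (\<Sum>i\<in>I. \<Sum>j\<in>I. F i j)" for F :: "'i \<Rightarrow> 'i \<Rightarrow> real"
    using insert.hyps by (simp add: sum.distrib)
  define a where "a = A k k"
  have a: "0 < a"
  proof -
    have "(\<Sum>i\<in>I. (if i = k then 1 else 0) * y i) = 0" for y :: "'i \<Rightarrow> real"
      by (rule sum.neutral) (use insert.hyps in auto)
    moreover have "(\<Sum>i\<in>I. \<Sum>j\<in>I. (if i = k then 1 else 0) * (if j = k then 1 else 0) * A i j) = 0"
      by (intro sum.neutral ballI) (use insert.hyps in auto)
    ultimately show ?thesis
      using pos[of "\<lambda>i. if i = k then 1 else 0"] unfolding split a_def by (simp add: mult.commute)
  qed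
  define A' where "A' i j = A i j - A i k * A k j / a" for i j
  have "(\<Sum>i\<in>I. \<Sum>j\<in>I. A' i j * H i j) \<le> 0"
  proof (rule insert.IH)
    show "A' i j = A' j i" for i j using sym[of i j] sym[of i k] sym[of k j] by (simp add: A'_def)
    show "0 < (\<Sum>i\<in>I. \<Sum>j\<in>I. x i * x j * A' i j)" if "\<exists>i\<in>I. x i \<noteq> 0" for x
    proof -
      define S where "S = (\<Sum>j\<in>I. A k j * x j)"
      \<comment> \<open>This value of coordinate \<open>k\<close> minimises the quadratic form of
        \<open>A\<close> with the others fixed, and the minimum is the form of the Schur
        complement.\<close>
      define y where "y = x(k := - S / a)"
      have yI: "y i = x i" if "i \<in> I" for i using that insert.hyps by (auto simp: y_def)
      have "0 < (\<Sum>i\<in>insert k I. \<Sum>j\<in>insert k I. y i * y j * A i j)"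
        using that yI by (intro pos) auto
      also have "\<dots> = (S / a) * (S / a) * a - (S / a) * S - (S / a) * S + (\<Sum>i\<in>I. \<Sum>j\<in>I. x i * x j * A i j)"
      proof -
        have "(\<Sum>j\<in>I. y k * y j * A k j) = - (S / a) * S"
          unfolding S_def sum_distrib_left
          by (intro sum.cong refl) (simp add: yI S_def[symmetric], simp add: y_def)
        moreover have "(\<Sum>i\<in>I. y i * y k * A i k) = - (S / a) * S"
          unfolding S_def sum_distrib_left
          by (intro sum.cong refl) (simp add: yI S_def[symmetric], simp add: y_def sym[of _ k])
        moreover have "(\<Sum>i\<in>I. \<Sum>j\<in>I. y i * y j * A i j) = (\<Sum>i\<in>I. \<Sum>j\<in>I. x i * x j * A i j)"
          by (intro sum.cong refl) (simp add: yI)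
        moreover have "y k * y k * A k k = (S / a) * (S / a) * a" by (simp add: y_def a_def)
        ultimately show ?thesis unfolding split by simp
      qed
      also have "\<dots> = (\<Sum>i\<in>I. \<Sum>j\<in>I. x i * x j * A i j) - S * S / a" using a by (simp add: field_simps)
      also have "S * S / a = (\<Sum>i\<in>I. \<Sum>j\<in>I. x i * x j * (A i k * A k j / a))"
        unfolding S_def sum_product sum_divide_distrib
        by (intro sum.cong refl) (simp add: sym[of _ k])
      finally show ?thesis by (simp add: A'_def right_diff_distrib sum_subtractf)
    qed
    show "(\<Sum>i\<in>I. \<Sum>j\<in>I. x i * x j * H i j) \<le> 0" for x
    proof -
      have "(\<Sum>i\<in>I. \<Sum>j\<in>I. x i * x j * H i j) = (\<Sum>i\<in>insert k I. \<Sum>j\<in>insert k I. (x(k := 0)) i * (x(k := 0)) j * H i j)"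
        unfolding split using insert.hyps by (auto intro!: sum.cong)
      then show ?thesis using neg[of "x(k := 0)"] by simp
    qed
  qed
  \<comment> \<open>The rank-one part contributes the form of \<open>H\<close> at the vector
    \<open>A i k\<close>, divided by \<open>a\<close>.\<close>
  moreover have "(\<Sum>i\<in>insert k I. \<Sum>j\<in>insert k I. (A i k * A k j / a) * H i j) \<le> 0"
  proof -
    have "(\<Sum>i\<in>insert k I. \<Sum>j\<in>insert k I. (A i k * A k j / a) * H i j)
      = (\<Sum>i\<in>insert k I. \<Sum>j\<in>insert k I. (A i k * A j k) * H i j) / a"
      unfolding sum_divide_distrib by (intro sum.cong refl) (simp add: sym[of k])
    then show ?thesis using neg[of "\<lambda>i. A i k"] a by (simp only: divide_le_0_iff) simp
  qed
  moreover have "(\<Sum>i\<in>insert k I. \<Sum>j\<in>insert k I. A i j * H i j)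
      = (\<Sum>i\<in>insert k I. \<Sum>j\<in>insert k I. (A i k * A k j / a) * H i j) + (\<Sum>i\<in>I. \<Sum>j\<in>I. A' i j * H i j)"
    unfolding split using a by (simp add: a_def[symmetric] A'_def left_diff_distrib sum_subtractf)
  ultimately show ?case by simp
qed simp

lemma inner_matrix_vector: "v \<bullet> (A *v w) = (\<Sum>i\<in>UNIV. \<Sum>j\<in>UNIV. v $ i * w $ j * A $ i $ j)"
  for A :: "real^'n^'n"
  by (simp add: inner_vec_def matrix_vector_mult_def sum_distrib_left mult_ac)

lemma Sym_pos_sym:
  assumes "A \<in> Sym_pos"
  shows "A $ i $ j = A $ j $ i"
proof -
  have "A $ i $ j = transpose A $ j $ i" by (simp add: transpose_def)
  then show ?thesis using assms by (simp add: Sym_pos_def)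
qed

text \<open>Meant for the second derivatives at an interior maximum. \<open>H\<close> is tested on
  pairs \<open>x\<close>, \<open>x\<close> only, so mixed derivatives may be entered in either
  order.\<close>

lemma trace_inequality:
  fixes A :: "real^'n^'n"
  assumes A: "A \<in> Sym_pos" and H: "\<And>x :: real^'n. (\<Sum>i\<in>UNIV. \<Sum>j\<in>UNIV. x $ i * x $ j * H i j) \<le> 0"
  shows "(\<Sum>i\<in>UNIV. \<Sum>j\<in>UNIV. A $ i $ j * H i j) \<le> 0"
proof (rule trace_inequality_set)
  show "A $ i $ j = A $ j $ i" for i j by (rule Sym_pos_sym[OF A])
  show "0 < (\<Sum>i\<in>UNIV. \<Sum>j\<in>UNIV. x i * x j * A $ i $ j)" if "\<exists>i\<in>UNIV. x i \<noteq> 0" for x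
  proof -
    have "vec_lambda x \<noteq> 0" using that by (auto simp: vec_eq_iff)
    then have "0 < vec_lambda x \<bullet> (A *v vec_lambda x)" using A by (simp add: Sym_pos_def)
    then show ?thesis by (simp add: inner_matrix_vector)
  qed
  show "(\<Sum>i\<in>UNIV. \<Sum>j\<in>UNIV. x i * x j * H i j) \<le> 0" for x using H[of "vec_lambda x"] by simp
qed simp

lemma Sym_pos_pos: "A \<in> Sym_pos \<Longrightarrow> v \<noteq> 0 \<Longrightarrow> 0 < v \<bullet> (A *v v)"
  by (simp add: Sym_pos_def)

lemma posdef_det_nonzero:
  fixes A :: "real^'n^'n"
  assumes "\<And>v. v \<noteq> 0 \<Longrightarrow> 0 < v \<bullet> (A *v v)"
  shows "det A \<noteq> 0"
proof -
  have "v = 0" if "A *v v = 0" for v using assms[of v] that by force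
  then have "\<exists>B. B ** A = mat 1" by (simp add: matrix_left_invertible_ker)
  then show ?thesis by (simp add: invertible_left_inverse flip: invertible_det_nz)
qed

text \<open>The segment from the identity to \<open>A\<close> consists of positive definite
  matrices, whose determinant never vanishes, so it keeps the sign it has at the identity.\<close>

lemma Sym_pos_det_pos:
  fixes A :: "real^'n^'n"
  assumes "A \<in> Sym_pos"
  shows "0 < det A"
proof (rule ccontr)
  assume neg: "\<not> 0 < det A"
  define F where "F s = (1 - s) *\<^sub>R mat 1 + s *\<^sub>R A" for s :: real
  have nz: "det (F s) \<noteq> 0" if "0 \<le> s" "s \<le> 1" for s
  proof (rule posdef_det_nonzero)
    fix v :: "real^'n" assume v: "v \<noteq> 0"
    have "v \<bullet> (F s *v v) = (1 - s) * (v \<bullet> v) + s * (v \<bullet> (A *v v))"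
      by (simp add: F_def matrix_vector_mult_add_rdistrib inner_add_right flip: scaleR_matrix_vector_assoc)
    moreover have "0 < (1 - s) * (v \<bullet> v) + s * (v \<bullet> (A *v v))"
    proof (cases "s = 0")
      case False
      then have "0 < s * (v \<bullet> (A *v v))" using that Sym_pos_pos[OF assms v] by simp
      moreover have "0 \<le> (1 - s) * (v \<bullet> v)" using that by simp
      ultimately show ?thesis by linarith
    qed (use v in simp)
    ultimately show "0 < v \<bullet> (F s *v v)" by simp
  qed
  have "continuous_on {0..1} (\<lambda>s. det (F s))"
    unfolding det_def F_def by (intro continuous_intros) 
  moreover have "det (F 0) = 1" "det (F 1) = det A" by (simp_all add: F_def)
  ultimately obtain s where "0 \<le> s" "s \<le> 1" "det (F s) = 0"
    using IVT2'[of "\<lambda>s. det (F s)" 1 0 0] neg by auto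
  then show False using nz by blast
qed

lemma matrix_inv_Sym_pos:
  fixes A :: "real^'n^'n"
  assumes A: "A \<in> Sym_pos"
  shows "matrix_inv A \<in> Sym_pos"
proof -
  have nz: "det A \<noteq> 0" using Sym_pos_det_pos[OF A] by simp
  have tA: "transpose A = A" using A by (simp add: Sym_pos_def)
  have "A ** transpose (matrix_inv A) = transpose (matrix_inv A ** A)"
    by (simp add: matrix_transpose_mul tA)
  then have "transpose (matrix_inv A) = matrix_inv A"
    by (intro matrix_inv_eqI[symmetric]) (simp add: matrix_inv_mult[OF nz])
  moreover have "0 < v \<bullet> (matrix_inv A *v v)" if "v \<noteq> 0" for v
  proof -
    define u where "u = matrix_inv A *v v"
    have v: "v = A *v u" by (simp add: u_def matrix_vector_mul_assoc matrix_inv_mult[OF nz])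
    then have "u \<noteq> 0" using that by auto
    then have "0 < u \<bullet> (A *v u)" by (rule Sym_pos_pos[OF A])
    also have "u \<bullet> (A *v u) = v \<bullet> u" by (simp add: inner_commute v[symmetric])
    finally show ?thesis by (simp add: u_def)
  qed
  ultimately show ?thesis by (simp add: Sym_pos_def)
qed

section \<open>Metrics \<open>dt^2 + h\<close> as block matrices\<close>

definition block :: "real^'n^'n \<Rightarrow> real^('n::finite option)^('n option)" where
  "block A = (\<chi> i j. case (i, j) of (None, None) \<Rightarrow> 1 | (Some \<alpha>, Some \<beta>) \<Rightarrow> A $ \<alpha> $ \<beta> | _ \<Rightarrow> 0)"

lemma block_nth [simp]:
  "block A $ None $ None = 1" "block A $ None $ Some \<beta> = 0" "block A $ Some \<alpha> $ None = 0"
  "block A $ Some \<alpha> $ Some \<beta> = A $ \<alpha> $ \<beta>"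
  by (simp_all add: block_def)

lemma product_metric_block: "product_metric h x = block (h (x $ None))"
  by (simp add: product_metric_def block_def)

lemma vec_option_eqI: "v $ None = w $ None \<Longrightarrow> (\<And>\<alpha>. v $ Some \<alpha> = w $ Some \<alpha>) \<Longrightarrow> v = w"
  by (simp add: vec_eq_iff split_option_all)

lemma block_mult: "block A ** block B = block (A ** B)"
  by (intro vec_option_eqI) (simp_all add: matrix_matrix_mult_def sum_UNIV_option)

lemma block_mat_1: "block (mat 1) = mat 1"
  by (intro vec_option_eqI) (simp_all add: mat_def)

lemma inner_block: "v \<bullet> (block A *v w) = v $ None * w $ None + torus_part v \<bullet> (A *v torus_part w)"
  by (simp add: inner_matrix_vector sum_UNIV_option torus_part_def)

lemma block_Sym_pos:
  assumes "A \<in> Sym_pos"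
  shows "block A \<in> Sym_pos"
proof -
  have "transpose (block A) = block A"
    by (intro vec_option_eqI) (simp_all add: transpose_def Sym_pos_sym[OF assms])
  moreover have "0 < v \<bullet> (block A *v v)" if "v \<noteq> 0" for v
  proof (cases "torus_part v = 0")
    case True
    then have "v $ None \<noteq> 0" using that by (auto simp: torus_part_def vec_eq_iff split_option_all)
    then show ?thesis by (simp add: inner_block True flip: power2_eq_square)
  next
    case False
    then show ?thesis using Sym_pos_pos[OF assms False] by (simp add: inner_block add_nonneg_pos)
  qed
  ultimately show ?thesis by (simp add: Sym_pos_def)
qed

lemma matrix_inv_block:
  assumes "det A \<noteq> 0"
  shows "matrix_inv (block A) = block (matrix_inv A)"
  by (rule matrix_inv_eqI) (simp add: block_mult matrix_inv_mult[OF assms] block_mat_1)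

text \<open>The scaling acts on the rows \<open>Some \<alpha>\<close> and leaves the row
  \<open>None\<close> alone, hence the exponent is the dimension of the torus and not that of the
  cylinder.\<close>

lemma det_block_scaleR:
  fixes A :: "real^'n^'n"
  shows "det (block (c *\<^sub>R A)) = c ^ CARD('n) * det (block A)"
proof -
  define d where "d i = (case i of None \<Rightarrow> 1 | Some _ \<Rightarrow> c)" for i :: "'n option"
  have "block (c *\<^sub>R A) = (\<chi> i. d i *s (block A $ i))"
    by (intro vec_option_eqI) (simp_all add: d_def)
  then have "det (block (c *\<^sub>R A)) = prod d UNIV * det (\<chi> i. block A $ i)"
    by (simp only: det_rows_mul)
  also have "prod d UNIV = c ^ CARD('n)"
    by (simp add: UNIV_option_conv prod.reindex d_def)
  finally show ?thesis by simp
qed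

section \<open>The Laplacian on the cylinder\<close>

lemma slab_derivative_unique:
  fixes x :: "real^('n::finite option)"
  assumes L: "0 < L" and x: "x \<in> slab L"
    and "(f has_derivative D) (at x within slab L)" "(f has_derivative D') (at x within slab L)"
  shows "D = D'"
proof (rule frechet_derivative_unique_within[OF assms(3,4)])
  fix i :: "real^('n option)" and e :: real
  assume "i \<in> Basis" "0 < e"
  then obtain j where i: "i = axis j 1" by (auto simp: Basis_vec_def)
  have x0: "0 \<le> x $ None" "x $ None \<le> L" using x by (auto simp: slab_def)
  \<comment> \<open>The increment in \<open>t\<close> has to point into the slab also from boundary
    points: away from the nearer end, and by at most half the length.\<close>
  define d where "d = (if x $ None \<le> L / 2 then min (e / 2) (L / 2) else - min (e / 2) (L / 2))"
  show "\<exists>d. 0 < \<bar>d\<bar> \<and> \<bar>d\<bar> < e \<and> x + d *\<^sub>R i \<in> slab L"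
    by (intro exI[of _ d]) (use x0 L \<open>0 < e\<close> in \<open>auto simp: d_def slab_def i axis_def\<close>)
qed

lemma frechet_derivative_slab:
  assumes "0 < L" "x \<in> slab L" "(f has_derivative D) (at x within slab L)"
  shows "frechet_derivative f (at x within slab L) = D"
  using slab_derivative_unique[OF assms(1,2) _ assms(3)] assms(3)
  by (metis differentiableI frechet_derivative_works)

lemma partial_within_slab:
  assumes "0 < L" "x \<in> slab L" "(f has_derivative D) (at x within slab L)"
  shows "partial_within i (slab L) f x = D (axis i 1)"
  by (simp add: partial_within_def frechet_derivative_slab[OF assms])

lemma slab_coordinate_chain:
  assumes c: "(c has_derivative c') (at (x $ None) within {0..L})"
  shows "((\<lambda>z :: real^('n::finite option). c (z $ None)) has_derivative (\<lambda>v. c' (v $ None))) (at x within slab L)"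
proof (rule has_derivative_in_compose[where f = "\<lambda>z. z $ None" and g = c])
  show "((\<lambda>z. z $ None) has_derivative (\<lambda>v. v $ None)) (at x within slab L)"
    by (intro bounded_linear_imp_has_derivative bounded_linear_vec_nth)
  show "(c has_derivative c') (at (x $ None) within (\<lambda>z. z $ None) ` slab L)"
    by (rule has_derivative_subset[OF c]) (auto simp: slab_def)
qed

lemma partial_within_coefficient:
  fixes f :: "real^('n::finite option) \<Rightarrow> complex"
  assumes L: "0 < L" and x: "x \<in> slab L"
    and c: "(c has_real_derivative c') (at (x $ None) within {0..L})"
    and f: "(f has_derivative D) (at x within slab L)"
  shows "((\<lambda>z. c (z $ None) *\<^sub>R f z) has_derivative
      (\<lambda>v. c (x $ None) *\<^sub>R D v + (v $ None * c') *\<^sub>R f x)) (at x within slab L)"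
  using has_derivative_scaleR[OF slab_coordinate_chain[OF c[unfolded has_field_derivative_def]] f]
  by (simp add: mult.commute)

locale cylinder_metric =
  fixes L :: real and h :: "real \<Rightarrow> real^'n::finite^'n"
  assumes L: "0 < L" and h_smooth: "smooth_on {0..L} h" and h_pos: "\<And>t. t \<in> {0..L} \<Longrightarrow> h t \<in> Sym_pos"
begin

definition W :: "real \<Rightarrow> real" where "W t = sqrt (det (block (h t)))"

text \<open>The matrix \<open>Hi t\<close> has the coefficients \<open>h\<^sup>\<alpha>\<^sup>\<beta>\<close> of the inverse metric.\<close>

definition Hi :: "real \<Rightarrow> real^'n^'n" where "Hi t = matrix_inv (h t)"

lemma h_det: "t \<in> {0..L} \<Longrightarrow> det (h t) \<noteq> 0"
  using Sym_pos_det_pos[OF h_pos] by force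

lemma Hi_pos: "t \<in> {0..L} \<Longrightarrow> Hi t \<in> Sym_pos"
  unfolding Hi_def by (intro matrix_inv_Sym_pos h_pos)

lemma block_det_pos: "t \<in> {0..L} \<Longrightarrow> 0 < det (block (h t))"
  by (intro Sym_pos_det_pos block_Sym_pos h_pos)

lemma W_pos: "t \<in> {0..L} \<Longrightarrow> 0 < W t"
  using block_det_pos by (simp add: W_def)

lemma h_nth_smooth: "Ck_on k {0..L} (\<lambda>t. h t $ i $ j)"
  by (rule Ck_on_bounded_linear[where l = "\<lambda>A. A $ i $ j"])
    (use h_smooth bounded_linear_compose[OF bounded_linear_vec_nth bounded_linear_vec_nth] in \<open>auto simp: smooth_on_def\<close>)

lemma W_smooth: "Ck_on k {0..L} W"
proof -
  have "Ck_on k {0..L} (\<lambda>t. block (h t) $ i $ j)" for i j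
    by (cases i; cases j) (simp_all add: h_nth_smooth)
  then show ?thesis unfolding W_def[abs_def]
    by (intro Ck_on_sqrt Ck_on_det block_det_pos)
qed

lemma Hi_smooth: "Ck_on k {0..L} (\<lambda>t. Hi t $ i $ j)"
  by (rule Ck_on_cong[OF _ Ck_on_matrix_inv[where p = i and q = j, OF h_nth_smooth h_det]])
    (simp_all add: Hi_def matrix_inv_cramer[OF h_det] field_simps)

lemma smooth_has_derivative:
  fixes c :: "real \<Rightarrow> real"
  assumes "Ck_on 1 {0..L} c"
  obtains c' where "\<And>t. t \<in> {0..L} \<Longrightarrow> (c has_real_derivative c' t) (at t within {0..L})" "continuous_on {0..L} c'"
proof -
  from assms have "Ck_on (Suc 0) {0..L} c" by simp
  then obtain c' where "\<And>t. t \<in> {0..L} \<Longrightarrow> (c has_vector_derivative c' t) (at t within {0..L})" "Ck_on 0 {0..L} c'"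
    by (rule Ck_on_Suc_realE) blast
  then show ?thesis by (intro that[of c']) (simp_all add: has_real_derivative_iff_has_vector_derivative)
qed

definition dW :: "real \<Rightarrow> real" where
  "dW = (SOME c'. (\<forall>t\<in>{0..L}. (W has_real_derivative c' t) (at t within {0..L})) \<and> continuous_on {0..L} c')"

lemma dW: "t \<in> {0..L} \<Longrightarrow> (W has_real_derivative dW t) (at t within {0..L})" "continuous_on {0..L} dW"
proof -
  have "\<exists>c'. (\<forall>t\<in>{0..L}. (W has_real_derivative c' t) (at t within {0..L})) \<and> continuous_on {0..L} c'"
    using smooth_has_derivative[OF W_smooth] by metis
  from someI_ex[OF this] show "t \<in> {0..L} \<Longrightarrow> (W has_real_derivative dW t) (at t within {0..L})" "continuous_on {0..L} dW"
    unfolding dW_def by blast+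
qed

text \<open>The metric depends on \<open>t\<close> alone and has no mixed terms, so the density is
  differentiated only in the \<open>t\<close> direction. What remains is
  \<open>u_tt + (W' / W) u_t\<close> plus the second-order operator of \<open>h t\<close> with
  constant coefficients.\<close>

lemma laplace_beltrami_eq:
  fixes u :: "real^('n option) \<Rightarrow> complex"
  assumes x: "x \<in> slab L"
    and U: "\<And>z. z \<in> slab L \<Longrightarrow> (u has_derivative U z) (at z within slab L)"
    and V: "\<And>j. ((\<lambda>z. U z (axis j 1)) has_derivative V j) (at x within slab L)"
  shows "laplace_beltrami (slab L) (product_metric h) u x =
    V None (axis None 1) + (dW (x $ None) / W (x $ None)) *\<^sub>R U x (axis None 1) +
    (\<Sum>\<alpha>\<in>UNIV. \<Sum>\<beta>\<in>UNIV. Hi (x $ None) $ \<alpha> $ \<beta> *\<^sub>R V (Some \<beta>) (axis (Some \<alpha>) 1))"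
proof -
  define t where "t = x $ None"
  have t: "t \<in> {0..L}" using x by (simp add: slab_def t_def)
  define G where "G i z = (\<Sum>j\<in>UNIV. (sqrt (det (product_metric h z)) * matrix_inv (product_metric h z) $ i $ j)
      *\<^sub>R partial_within j (slab L) u z)" for i z
  have G: "G i z = (\<Sum>j\<in>UNIV. (W (z $ None) * block (Hi (z $ None)) $ i $ j) *\<^sub>R U z (axis j 1))"
    if "z \<in> slab L" for i z
  proof -
    have "z $ None \<in> {0..L}" using that by (simp add: slab_def)
    then show ?thesis unfolding G_def
      by (simp add: product_metric_block matrix_inv_block h_det W_def Hi_def partial_within_slab[OF L that U[OF that]])
  qed
  have GN: "G None z = W (z $ None) *\<^sub>R U z (axis None 1)" if "z \<in> slab L" for z
    by (simp add: G[OF that] sum_UNIV_option)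
  have GS: "G (Some \<alpha>) z = (\<Sum>\<beta>\<in>UNIV. (W (z $ None) * Hi (z $ None) $ \<alpha> $ \<beta>) *\<^sub>R U z (axis (Some \<beta>) 1))"
    if "z \<in> slab L" for z \<alpha>
    by (simp add: G[OF that] sum_UNIV_option)
  have W': "(W has_real_derivative dW t) (at (x $ None) within {0..L})" using dW(1)[OF t] by (simp add: t_def)
  have "partial_within None (slab L) (G None) x = W t *\<^sub>R V None (axis None 1) + dW t *\<^sub>R U x (axis None 1)"
  proof -
    have "(G None has_derivative (\<lambda>v. W t *\<^sub>R V None v + (v $ None * dW t) *\<^sub>R U x (axis None 1))) (at x within slab L)"
      unfolding t_def
      by (rule has_derivative_transform[OF x _ partial_within_coefficient[OF L x W'[unfolded t_def] V]]) (simp add: GN)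
    from partial_within_slab[OF L x this] show ?thesis by (simp add: axis_def)
  qed
  moreover have "partial_within (Some \<alpha>) (slab L) (G (Some \<alpha>)) x =
      (\<Sum>\<beta>\<in>UNIV. (W t * Hi t $ \<alpha> $ \<beta>) *\<^sub>R V (Some \<beta>) (axis (Some \<alpha>) 1))" for \<alpha>
  proof -
    \<comment> \<open>The derivatives \<open>c'\<close> of the coefficients occur with the factor
      \<open>v $ None\<close>, which vanishes in the direction \<open>Some \<alpha>\<close>.\<close>
    have "\<exists>c'. \<forall>\<beta>. ((\<lambda>t. W t * Hi t $ \<alpha> $ \<beta>) has_real_derivative c' \<beta>) (at (x $ None) within {0..L})"
    proof (rule choice, rule allI)
      fix \<beta>
      have "Ck_on 1 {0..L} (\<lambda>t. W t * Hi t $ \<alpha> $ \<beta>)" by (intro Ck_on_mult W_smooth Hi_smooth)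
      from smooth_has_derivative[OF this] show "\<exists>c'. ((\<lambda>t. W t * Hi t $ \<alpha> $ \<beta>) has_real_derivative c') (at (x $ None) within {0..L})"
        using t unfolding t_def by metis
    qed
    then obtain c' where c': "\<And>\<beta>. ((\<lambda>t. W t * Hi t $ \<alpha> $ \<beta>) has_real_derivative c' \<beta>) (at (x $ None) within {0..L})" by blast
    have "(G (Some \<alpha>) has_derivative (\<lambda>v. \<Sum>\<beta>\<in>UNIV. (W t * Hi t $ \<alpha> $ \<beta>) *\<^sub>R V (Some \<beta>) v
        + (v $ None * c' \<beta>) *\<^sub>R U x (axis (Some \<beta>) 1))) (at x within slab L)"
      unfolding t_def
      by (rule has_derivative_transform[OF x _ has_derivative_sum[OF partial_within_coefficient[OF L x c' V]]]) (simp add: GS)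
    from partial_within_slab[OF L x this] show ?thesis by (simp add: axis_def)
  qed
  moreover have "laplace_beltrami (slab L) (product_metric h) u x = (1 / W t) *\<^sub>R
      (\<Sum>i\<in>UNIV. partial_within i (slab L) (G i) x)"
    by (simp add: laplace_beltrami_def G_def[abs_def] product_metric_block W_def t_def)
  ultimately have "laplace_beltrami (slab L) (product_metric h) u x = (1 / W t) *\<^sub>R
      (W t *\<^sub>R V None (axis None 1) + dW t *\<^sub>R U x (axis None 1) +
       (\<Sum>\<alpha>\<in>UNIV. \<Sum>\<beta>\<in>UNIV. (W t * Hi t $ \<alpha> $ \<beta>) *\<^sub>R V (Some \<beta>) (axis (Some \<alpha>) 1)))"
    by (simp only: sum_UNIV_option)
  then show ?thesis using W_pos[OF t] unfolding t_def[symmetric]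
    by (simp add: scaleR_add_right scaleR_sum_right)
qed

end

section \<open>Maximum principle\<close>

lemma local_max_second_derivative:
  fixes \<phi> \<psi> :: "real \<Rightarrow> real"
  assumes "0 < e" and \<phi>: "\<And>s. \<bar>s\<bar> < e \<Longrightarrow> (\<phi> has_real_derivative \<psi> s) (at s)"
    and \<psi>: "(\<psi> has_real_derivative d) (at 0)" and mx: "\<And>s. \<bar>s\<bar> < e \<Longrightarrow> \<phi> s \<le> \<phi> 0"
  shows "\<psi> 0 = 0" "d \<le> 0"
proof -
  show z: "\<psi> 0 = 0"
    by (rule DERIV_local_max[OF \<phi> \<open>0 < e\<close>]) (use \<open>0 < e\<close> mx in auto)
  show "d \<le> 0"
  proof (rule ccontr)
    assume "\<not> d \<le> 0"
    then obtain b where b: "0 < b" "\<And>y. 0 < y \<Longrightarrow> y < b \<Longrightarrow> \<psi> 0 < \<psi> (0 + y)"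
      using DERIV_pos_inc_right[OF \<psi>] by auto
    define s where "s = min e b / 2"
    have s: "0 < s" "s < e" "s < b" using \<open>0 < e\<close> b by (auto simp: s_def)
    obtain y where "0 < y" "y < s" "\<phi> s - \<phi> 0 = (s - 0) * \<psi> y"
      using MVT2[OF s(1), of \<phi> \<psi>] \<phi> s by auto
    moreover have "0 < s * \<psi> y" using b(2)[of y] z s calculation by simp
    ultimately show False using mx[of s] s by simp
  qed
qed

lemma linear_axis_expansion:
  fixes l :: "real^'d::finite \<Rightarrow> 'b::real_vector"
  assumes "linear l"
  shows "l \<xi> = (\<Sum>j\<in>UNIV. \<xi> $ j *\<^sub>R l (axis j 1))"
proof -
  have "l \<xi> = l (\<Sum>j\<in>UNIV. \<xi> $ j *s axis j 1)" by (simp only: basis_expansion)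
  also have "\<dots> = (\<Sum>j\<in>UNIV. \<xi> $ j *\<^sub>R l (axis j 1))"
    by (simp add: linear_sum[OF assms] linear_cmul[OF assms] scalar_mult_eq_scaleR)
  finally show ?thesis .
qed

text \<open>The second derivative test in one variable, along the line through \<open>x0\<close> in
  the direction \<xi>. \<open>V j\<close> is the differential of the \<open>j\<close>-th partial
  derivative.\<close>

lemma interior_max_derivatives:
  fixes u :: "real^'d::finite \<Rightarrow> real"
  assumes "0 < e" and U: "\<And>z. z \<in> ball x0 e \<Longrightarrow> (u has_derivative U z) (at z)"
    and V: "\<And>j. ((\<lambda>z. U z (axis j 1)) has_derivative V j) (at x0)"
    and mx: "\<And>z. z \<in> ball x0 e \<Longrightarrow> u z \<le> u x0"
  shows "U x0 \<xi> = 0" "(\<Sum>i\<in>UNIV. \<Sum>j\<in>UNIV. \<xi> $ i * \<xi> $ j * V j (axis i 1)) \<le> 0"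
proof -
  define q where "q s = x0 + s *\<^sub>R \<xi>" for s
  define d where "d = e / (norm \<xi> + 1)"
  have d: "0 < d" using \<open>0 < e\<close> by (simp add: d_def add_nonneg_pos)
  have qb: "q s \<in> ball x0 e" if "\<bar>s\<bar> < d" for s
  proof -
    have "\<bar>s\<bar> * norm \<xi> \<le> \<bar>s\<bar> * (norm \<xi> + 1)" by (intro mult_left_mono) auto
    also have "\<dots> < e" using that by (simp add: d_def pos_less_divide_eq add_nonneg_pos)
    finally show ?thesis by (simp add: q_def dist_norm)
  qed
  have q: "(q has_derivative (\<lambda>t. t *\<^sub>R \<xi>)) (at s)" for s
    unfolding q_def by (auto intro!: derivative_eq_intros)
  define \<psi> where "\<psi> s = (\<Sum>j\<in>UNIV. \<xi> $ j * U (q s) (axis j 1))" for s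
  have lin: "U z \<xi> = (\<Sum>j\<in>UNIV. \<xi> $ j * U z (axis j 1))" if "z \<in> ball x0 e" for z
    using linear_axis_expansion[OF has_derivative_linear[OF U[OF that]], of \<xi>] by simp
  have 1: "((\<lambda>s. u (q s)) has_real_derivative \<psi> s) (at s)" if "\<bar>s\<bar> < d" for s
  proof -
    have "((\<lambda>s. u (q s)) has_derivative (\<lambda>t. U (q s) (t *\<^sub>R \<xi>))) (at s)"
      using has_derivative_compose[OF q U[OF qb[OF that]]] .
    moreover have "U (q s) (t *\<^sub>R \<xi>) = \<psi> s * t" for t
      using linear_cmul[OF has_derivative_linear[OF U[OF qb[OF that]]], of t \<xi>] lin[OF qb[OF that]]
      by (simp add: \<psi>_def mult.commute)
    ultimately show ?thesis by (simp add: has_field_derivative_def)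
  qed
  have q0: "q 0 = x0" by (simp add: q_def)
  have 2: "(\<psi> has_real_derivative (\<Sum>j\<in>UNIV. \<xi> $ j * V j \<xi>)) (at 0)"
    unfolding \<psi>_def
  proof (intro DERIV_sum DERIV_cmult)
    fix j
    have "((\<lambda>z. U z (axis j 1)) has_derivative V j) (at (q 0))" using V by (simp add: q0)
    from has_derivative_compose[OF q this]
    have "((\<lambda>s. U (q s) (axis j 1)) has_derivative (\<lambda>t. V j (t *\<^sub>R \<xi>))) (at 0)" .
    moreover have "V j (t *\<^sub>R \<xi>) = V j \<xi> * t" for t
      using linear_cmul[OF has_derivative_linear[OF V], of j t \<xi>] by simp
    ultimately show "((\<lambda>s. U (q s) (axis j 1)) has_real_derivative V j \<xi>) (at 0)"
      by (simp add: has_field_derivative_def)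
  qed
  have 3: "u (q s) \<le> u (q 0)" if "\<bar>s\<bar> < d" for s using mx[OF qb[OF that]] q0 by simp
  note test = local_max_second_derivative[OF d 1 2 3]
  show "U x0 \<xi> = 0" using test(1) lin[of x0] \<open>0 < e\<close> by (simp add: \<psi>_def q0)
  have "(\<Sum>i\<in>UNIV. \<Sum>j\<in>UNIV. \<xi> $ i * \<xi> $ j * V j (axis i 1)) = (\<Sum>j\<in>UNIV. \<xi> $ j * V j \<xi>)"
    by (subst sum.swap, intro sum.cong refl)
      (subst linear_axis_expansion[OF has_derivative_linear[OF V], of _ \<xi>], simp add: sum_distrib_left mult_ac)
  then show "(\<Sum>i\<in>UNIV. \<Sum>j\<in>UNIV. \<xi> $ i * \<xi> $ j * V j (axis i 1)) \<le> 0" using test(2) by simp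
qed

lemma torus_periodic_int_shift:
  fixes z :: "real^('n::finite option)" and \<alpha> :: 'n
  assumes per: "torus_periodic L u" and z: "z \<in> slab L"
  shows "u (z + (of_int k * (2 * pi)) *\<^sub>R axis (Some \<alpha>) 1) = u z"
proof -
  have ax: "axis (Some \<alpha>) (2 * pi) = (2 * pi) *\<^sub>R (axis (Some \<alpha>) 1 :: real^('n option))"
    by (simp add: vec_eq_iff axis_def)
  have sl: "z + c *\<^sub>R axis (Some \<alpha>) 1 \<in> slab L" for c :: real using z by (simp add: slab_def axis_def)
  have step: "u (z + (c + 2 * pi) *\<^sub>R axis (Some \<alpha>) 1) = u (z + c *\<^sub>R axis (Some \<alpha>) 1)" for c
  proof -
    have "z + (c + 2 * pi) *\<^sub>R axis (Some \<alpha>) 1 = (z + c *\<^sub>R axis (Some \<alpha>) 1) + axis (Some \<alpha>) (2 * pi)"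
      by (simp add: ax scaleR_add_left)
    then show ?thesis using per sl[of c] unfolding torus_periodic_def by metis
  qed
  show ?thesis
  proof (induction k rule: int_induct[where k = 0])
    case (step1 i)
    then show ?case using step[of "of_int i * (2 * pi)"] by (simp add: algebra_simps)
  next
    case (step2 i)
    then show ?case using step[of "of_int (i - 1) * (2 * pi)"] by (simp add: algebra_simps)
  qed simp
qed

text \<open>The slab is unbounded; moving points into a fundamental box makes a continuous periodic
  function attain its maximum.\<close>

lemma torus_periodic_representative:
  fixes z :: "real^('n::finite option)"
  assumes per: "torus_periodic L u" and z: "z \<in> slab L"
  obtains z' where "u z' = u z" "z' $ None = z $ None" "\<And>\<alpha>. 0 \<le> z' $ Some \<alpha> \<and> z' $ Some \<alpha> \<le> 2 * pi"
proof -
  define k where "k \<alpha> = - \<lfloor>z $ Some \<alpha> / (2 * pi)\<rfloor>" for \<alpha>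
  define y where "y A = z + (\<Sum>\<alpha>\<in>A. (of_int (k \<alpha>) * (2 * pi)) *\<^sub>R axis (Some \<alpha>) 1)" for A
  have yN: "y A $ None = z $ None" for A by (simp add: y_def axis_def)
  have u: "u (y A) = u z" if "finite A" for A
    using that
  proof (induction A rule: finite_induct)
    case (insert \<alpha> A)
    have "y A \<in> slab L" using z yN by (simp add: slab_def)
    moreover have "y (insert \<alpha> A) = y A + (of_int (k \<alpha>) * (2 * pi)) *\<^sub>R axis (Some \<alpha>) 1"
      using insert.hyps by (simp add: y_def add_ac)
    ultimately show ?case using torus_periodic_int_shift[OF per, of "y A" "k \<alpha>" \<alpha>] insert.IH by simp
  qed (simp add: y_def)
  have yS: "y UNIV $ Some \<alpha> = z $ Some \<alpha> - of_int \<lfloor>z $ Some \<alpha> / (2 * pi)\<rfloor> * (2 * pi)" for \<alpha>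
    by (simp add: y_def axis_def k_def if_distrib cong: if_cong)
  have "0 \<le> y UNIV $ Some \<alpha> \<and> y UNIV $ Some \<alpha> \<le> 2 * pi" for \<alpha>
  proof -
    have "of_int \<lfloor>z $ Some \<alpha> / (2 * pi)\<rfloor> \<le> z $ Some \<alpha> / (2 * pi)"
      "z $ Some \<alpha> / (2 * pi) \<le> of_int \<lfloor>z $ Some \<alpha> / (2 * pi)\<rfloor> + 1" by linarith+
    then have "of_int \<lfloor>z $ Some \<alpha> / (2 * pi)\<rfloor> * (2 * pi) \<le> z $ Some \<alpha> / (2 * pi) * (2 * pi)"
      "z $ Some \<alpha> / (2 * pi) * (2 * pi) \<le> (of_int \<lfloor>z $ Some \<alpha> / (2 * pi)\<rfloor> + 1) * (2 * pi)"
      by (intro mult_right_mono; simp)+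
    then show ?thesis unfolding yS by (simp add: algebra_simps)
  qed
  then show ?thesis using that[of "y UNIV"] u yN by simp
qed

text \<open>The barrier \<open>e exp (\<Lambda> t)\<close> with \<open>\<Lambda> > \<bar>w\<bar>\<close> makes the subsolution strict.\<close>

lemma slab_max_principle:
  fixes u :: "real^('n::finite option) \<Rightarrow> real"
  assumes L: "0 < L"
    and D1: "\<And>z. z \<in> slab L \<Longrightarrow> (u has_derivative U z) (at z within slab L)"
    and D2: "\<And>z j. z \<in> slab L \<Longrightarrow> ((\<lambda>z. U z (axis j 1)) has_derivative V z j) (at z within slab L)"
    and eq: "\<And>z. z \<in> slab L \<Longrightarrow> V z None (axis None 1) + w (z $ None) * U z (axis None 1) +
      (\<Sum>\<alpha>\<in>UNIV. \<Sum>\<beta>\<in>UNIV. A (z $ None) $ \<alpha> $ \<beta> * V z (Some \<beta>) (axis (Some \<alpha>) 1)) = 0"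
    and w: "\<And>t. t \<in> {0..L} \<Longrightarrow> \<bar>w t\<bar> \<le> K" and A: "\<And>t. t \<in> {0..L} \<Longrightarrow> A t \<in> Sym_pos"
    and per: "torus_periodic L u" and bd: "\<And>z. z \<in> slab_boundary L \<Longrightarrow> u z \<le> 0"
    and z: "z \<in> slab L"
  shows "u z \<le> 0"
proof -
  define \<Lambda> where "\<Lambda> = K + 1"
  have K0: "0 \<le> K" using w[of 0] L by force
  define b where "b z = exp (\<Lambda> * z $ None)" for z :: "real^('n option)"
  have b: "(b has_derivative (\<lambda>v. \<Lambda> * b z * v $ None)) (at z within S)" for z S
    unfolding b_def by (auto intro!: derivative_eq_intros bounded_linear_imp_has_derivative bounded_linear_vec_nth)
  have bmax: "b z \<le> exp (\<Lambda> * L)" if "z \<in> slab L" for z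
    using that K0 by (auto simp: b_def \<Lambda>_def slab_def intro: mult_left_mono)
  have main: "u z \<le> e * exp (\<Lambda> * L)" if e: "0 < e" for e
  proof -
    define g where "g z = u z + e * b z" for z
    define C where "C = cbox (0 :: real^('n option)) (\<chi> i. case i of None \<Rightarrow> L | Some _ \<Rightarrow> 2 * pi)"
    have C: "x \<in> C \<longleftrightarrow> 0 \<le> x $ None \<and> x $ None \<le> L \<and> (\<forall>\<alpha>. 0 \<le> x $ Some \<alpha> \<and> x $ Some \<alpha> \<le> 2 * pi)" for x
      by (auto simp: C_def mem_box_cart split_option_all)
    have C_slab: "C \<subseteq> slab L" by (auto simp: C slab_def)
    have "continuous_on (slab L) g"
      unfolding g_def using D1 b
      by (intro continuous_intros) (auto simp: continuous_on_eq_continuous_within intro: has_derivative_continuous)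
    then have "continuous_on C g" using C_slab by (rule continuous_on_subset)
    moreover have "compact C" by (simp add: C_def)
    moreover have "0 \<in> C" using L by (simp add: C)
    ultimately obtain x0 where x0: "x0 \<in> C" and mxC: "\<And>x. x \<in> C \<Longrightarrow> g x \<le> g x0"
      using continuous_attains_sup[of C g] by blast
    have x0s: "x0 \<in> slab L" using x0 C_slab by blast
    have mx: "g x \<le> g x0" if x: "x \<in> slab L" for x
    proof -
      obtain x' where x': "u x' = u x" "x' $ None = x $ None" "\<And>\<alpha>. 0 \<le> x' $ Some \<alpha> \<and> x' $ Some \<alpha> \<le> 2 * pi"
        using torus_periodic_representative[OF per x] by blast
      then have "x' \<in> C" using x by (simp add: C slab_def)
      moreover have "g x' = g x" using x' by (simp add: g_def b_def)
      ultimately show ?thesis using mxC by metis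
    qed
    have bnd: "x0 $ None = 0 \<or> x0 $ None = L"
    proof (rule ccontr)
      assume "\<not> ?thesis"
      then have t0: "0 < x0 $ None" "x0 $ None < L" using x0 by (auto simp: C)
      define I where "I = {z :: real^('n option). 0 < z $ None \<and> z $ None < L}"
      have "open I" unfolding I_def
        by (intro open_Collect_conj open_Collect_less continuous_intros)
      moreover have "x0 \<in> I" using t0 by (simp add: I_def)
      ultimately obtain d where d: "0 < d" "ball x0 d \<subseteq> I" by (meson open_contains_ball)
      have I_slab: "I \<subseteq> slab L" by (auto simp: I_def slab_def)
      have atI: "at z within slab L = at z" if "z \<in> I" for z
        using that interior_maximal[OF I_slab \<open>open I\<close>] by (intro at_within_interior) auto
      define Ug where "Ug z v = U z v + e * (\<Lambda> * b z * v $ None)" for z v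
      define Vg where "Vg j v = V x0 j v + e * (\<Lambda> * (\<Lambda> * b x0 * v $ None) * axis j 1 $ None)" for j v
      have 1: "(g has_derivative Ug z) (at z)" if "z \<in> ball x0 d" for z
      proof -
        have zI: "z \<in> I" using that d by blast
        then have "(u has_derivative U z) (at z)" using D1[of z] atI[OF zI] I_slab by auto
        then show ?thesis unfolding g_def Ug_def
          by (intro has_derivative_add has_derivative_mult_right b)
      qed
      have 2: "((\<lambda>z. Ug z (axis j 1)) has_derivative Vg j) (at x0)" for j
        unfolding Ug_def Vg_def using D2[OF x0s, of j] atI[OF \<open>x0 \<in> I\<close>]
        by (auto intro!: derivative_eq_intros b)
      have 3: "g z \<le> g x0" if "z \<in> ball x0 d" for z using that d I_slab mx by blast
      note test = interior_max_derivatives[OF d(1) 1 2 3]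
      have t0': "x0 $ None \<in> {0..L}" using t0 by simp
      have "U x0 (axis None 1) = - (e * (\<Lambda> * b x0))"
        using test(1)[of "axis None 1"] by (simp add: Ug_def)
      moreover have "V x0 None (axis None 1) \<le> - (e * \<Lambda> * \<Lambda> * b x0)"
        using test(2)[of "axis None 1"] by (simp add: sum_UNIV_option axis_def[of None] Vg_def)
      moreover have "(\<Sum>\<alpha>\<in>UNIV. \<Sum>\<beta>\<in>UNIV. A (x0 $ None) $ \<alpha> $ \<beta> * V x0 (Some \<beta>) (axis (Some \<alpha>) 1)) \<le> 0"
      proof (rule trace_inequality[OF A[OF t0']])
        fix x :: "real^'n"
        define \<xi> where "\<xi> = (\<chi> i. case i of None \<Rightarrow> 0 | Some \<alpha> \<Rightarrow> x $ \<alpha>)"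
        have "(\<Sum>i\<in>UNIV. \<Sum>j\<in>UNIV. \<xi> $ i * \<xi> $ j * Vg j (axis i 1)) =
            (\<Sum>i\<in>UNIV. \<Sum>j\<in>UNIV. x $ i * x $ j * V x0 (Some j) (axis (Some i) 1))"
          by (simp add: sum_UNIV_option \<xi>_def Vg_def axis_def[of "Some _" "1::real"])
        then show "(\<Sum>i\<in>UNIV. \<Sum>j\<in>UNIV. x $ i * x $ j * V x0 (Some j) (axis (Some i) 1)) \<le> 0"
          using test(2)[of \<xi>] by simp
      qed
      \<comment> \<open>At an interior maximum of \<open>g\<close> the first and second derivatives
        of the barrier pass to the other side: the \<open>t\<close> derivative of \<open>u\<close>
        is known exactly, the second one is bounded, and the torus part is nonpositive. Since
        \<open>\<Lambda> > \<bar>w\<bar>\<close>, the equation cannot hold.\<close>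
      ultimately have "0 \<le> - (e * \<Lambda> * \<Lambda> * b x0) + w (x0 $ None) * (- (e * (\<Lambda> * b x0)))"
        using eq[OF x0s] by simp
      also have "\<dots> = - (e * \<Lambda> * b x0 * (\<Lambda> + w (x0 $ None)))" by (simp add: algebra_simps)
      also have "\<dots> < 0"
        using e K0 w[OF t0'] by (auto simp: \<Lambda>_def b_def intro!: mult_pos_pos)
      finally show False by simp
    qed
    then have "u x0 \<le> 0" by (intro bd) (auto simp: slab_boundary_def)
    moreover have "e * b x0 \<le> e * exp (\<Lambda> * L)" using bmax[OF x0s] e by (intro mult_left_mono) auto
    ultimately have "g x0 \<le> e * exp (\<Lambda> * L)" by (simp add: g_def)
    moreover have "u z \<le> g z" using e by (simp add: g_def b_def)
    ultimately show ?thesis using mx[OF z] by linarith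
  qed
  show ?thesis
  proof (rule field_le_epsilon)
    fix e :: real assume "0 < e"
    then show "u z \<le> 0 + e" using main[of "e / exp (\<Lambda> * L)"] by simp
  qed
qed

section \<open>The Dirichlet-to-Neumann matrix\<close>

lemma smooth_on_second_derivative:
  assumes "smooth_on S u"
  obtains U V where "\<And>z. z \<in> S \<Longrightarrow> (u has_derivative U z) (at z within S)"
    "\<And>z w. z \<in> S \<Longrightarrow> ((\<lambda>z. U z w) has_derivative V z w) (at z within S)"
proof -
  have "Ck_on (Suc (Suc 0)) S u" using assms by (simp only: smooth_on_def)
  then obtain U where U: "\<And>z. z \<in> S \<Longrightarrow> (u has_derivative U z) (at z within S)" "\<And>w. Ck_on (Suc 0) S (\<lambda>z. U z w)"
    by (rule Ck_on_SucE) blast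
  have "\<forall>w. \<exists>V. \<forall>z\<in>S. ((\<lambda>z. U z w) has_derivative V z) (at z within S)"
    using U(2) by (meson Ck_on_SucE)
  then obtain V where "\<And>w z. z \<in> S \<Longrightarrow> ((\<lambda>z. U z w) has_derivative V w z) (at z within S)"
    by metis
  then show ?thesis using that[of U "\<lambda>z w. V w z"] U(1) by blast
qed

section \<open>Fourier modes as functions on the slab\<close>

definition slab_exponent :: "int^'n \<Rightarrow> real^('n::finite option) \<Rightarrow> complex" where
  "slab_exponent k z = \<i> * of_real (\<Sum>\<alpha>\<in>UNIV. of_int (k $ \<alpha>) * z $ Some \<alpha>)"

lemma fourier_mode_torus_part: "fourier_mode k (torus_part z) = exp (slab_exponent k z)"
  by (simp add: fourier_mode_def torus_part_def slab_exponent_def)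

lemma axis_nth_None [simp]: "axis None c $ None = c" "axis (Some \<alpha>) c $ None = 0"
  by (simp_all add: axis_def)

lemma bounded_linear_slab_exponent: "bounded_linear (slab_exponent k)"
  unfolding slab_exponent_def
  by (intro bounded_linear_const_mult bounded_linear_of_real[THEN bounded_linear_compose] bounded_linear_sum
      bounded_linear_vec_nth)

lemma slab_exponent_axis [simp]:
  "slab_exponent k (axis None 1) = 0" "slab_exponent k (axis (Some \<alpha>) 1) = \<i> * of_int (k $ \<alpha>)"
  by (simp_all add: slab_exponent_def axis_def if_distrib cong: if_cong)

lemma exp_slab_exponent_deriv:
  "((\<lambda>z. exp (slab_exponent k z)) has_derivative (\<lambda>v. slab_exponent k v * exp (slab_exponent k z))) (at z within S)"
  using has_derivative_compose[OF bounded_linear_imp_has_derivative[OF bounded_linear_slab_exponent]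
      DERIV_exp[unfolded has_field_derivative_def]]
  by (simp add: mult.commute)

lemma Ck_on_exp_slab_exponent: "Ck_on j S (\<lambda>z. exp (slab_exponent k z))"
proof (induction j)
  case 0 then show ?case
    by (auto simp: continuous_on_eq_continuous_within intro: has_derivative_continuous[OF exp_slab_exponent_deriv])
next
  case (Suc j)
  show ?case by (rule Ck_on_SucI[OF exp_slab_exponent_deriv]) (intro Ck_on_mult Ck_on_const Suc)
qed

lemma Ck_on_slab_coordinate:
  fixes a :: "real \<Rightarrow> real"
  assumes "Ck_on j {0..L} a"
  shows "Ck_on j (slab L) (\<lambda>z :: real^('n::finite option). a (z $ None))"
  using assms
proof (induction j arbitrary: a)
  case 0
  then show ?case by (auto intro!: continuous_on_compose2[of "{0..L}" a] continuous_intros simp: slab_def)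
next
  case (Suc j)
  from Suc.prems obtain a' where a': "\<And>t. t \<in> {0..L} \<Longrightarrow> (a has_vector_derivative a' t) (at t within {0..L})" "Ck_on j {0..L} a'"
    by (rule Ck_on_Suc_realE) blast
  show ?case
  proof (rule Ck_on_SucI)
    show "((\<lambda>z. a (z $ None)) has_derivative (\<lambda>v. v $ None * a' (x $ None))) (at x within slab L)"
      if "x \<in> slab L" for x :: "real^('n option)"
      using slab_coordinate_chain[OF a'(1)[unfolded has_vector_derivative_def], of x] that
      by (simp add: slab_def)
    show "Ck_on j (slab L) (\<lambda>x :: real^('n option). v $ None * a' (x $ None))" for v
      by (intro Ck_on_mult Ck_on_const Suc.IH a')
  qed
qed

lemma exp_slab_exponent_periodic:
  fixes z :: "real^('n::finite option)" and \<alpha> :: 'n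
  shows "exp (slab_exponent k (z + axis (Some \<alpha>) (2 * pi))) = exp (slab_exponent k z)"
proof -
  have "axis (Some \<alpha>) (2 * pi) = (2 * pi) *\<^sub>R (axis (Some \<alpha>) 1 :: real^('n option))"
    by (simp add: vec_eq_iff axis_def)
  then have "slab_exponent k (z + axis (Some \<alpha>) (2 * pi)) = slab_exponent k z + (2 * pi) *\<^sub>R slab_exponent k (axis (Some \<alpha>) 1)"
    by (simp only: linear_add[OF bounded_linear.linear[OF bounded_linear_slab_exponent]]
      linear_cmul[OF bounded_linear.linear[OF bounded_linear_slab_exponent]])
  also have "\<dots> = slab_exponent k z + of_int (2 * k $ \<alpha>) * of_real pi * \<i>"
    by (simp add: scaleR_conv_of_real)
  finally have "slab_exponent k (z + axis (Some \<alpha>) (2 * pi)) = slab_exponent k z + of_int (2 * k $ \<alpha>) * of_real pi * \<i>" .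
  moreover have "exp (of_int (2 * k $ \<alpha>) * of_real pi * \<i>) = (1::complex)"
    using exp_integer_2pi[of "of_int (k $ \<alpha>)"] by simp
  ultimately show ?thesis by (simp add: exp_add)
qed

lemma boundary_coeff_mode:
  fixes k :: "int^'n::finite"
  assumes "\<And>y. q (point r y) = c * fourier_mode k y"
  shows "boundary_coeff r k q = c"
proof -
  have "fourier_mode k y * cnj (fourier_mode k y) = 1" for y
    by (simp add: fourier_mode_def complex_norm_square[symmetric])
  then have "q (point r y) * cnj (fourier_mode k y) = c" for y
    by (simp add: assms mult.assoc)
  moreover have "measure lborel (cbox 0 (\<chi> \<alpha>. 2 * pi) :: (real^'n) set) = (2 * pi) ^ CARD('n)"
    by (subst content_cbox_cart) (auto simp: interval_eq_empty_cart)
  ultimately show ?thesis by (simp add: boundary_coeff_def scaleR_conv_of_real)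
qed

section \<open>Uniqueness for the Dirichlet problem, separation of variables, and the Neumann
  data\<close>

context cylinder_metric
begin

text \<open>The maximum principle applied to the real part of \<open>c * (u1 - u2)\<close> for
  \<open>c\<close> among the fourth roots of unity bounds the real and the imaginary part from both
  sides.\<close>

lemma dirichlet_solution_unique:
  assumes "dirichlet_solution L (product_metric h) f u1" "dirichlet_solution L (product_metric h) f u2"
    and x: "x \<in> slab L"
  shows "u1 x = u2 x"
proof -
  note u1 = assms(1)[unfolded dirichlet_solution_def] and u2 = assms(2)[unfolded dirichlet_solution_def]
  obtain U1 V1 where UV1: "\<And>z. z \<in> slab L \<Longrightarrow> (u1 has_derivative U1 z) (at z within slab L)"
    "\<And>z w. z \<in> slab L \<Longrightarrow> ((\<lambda>z. U1 z w) has_derivative V1 z w) (at z within slab L)"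
    using smooth_on_second_derivative u1 by blast
  obtain U2 V2 where UV2: "\<And>z. z \<in> slab L \<Longrightarrow> (u2 has_derivative U2 z) (at z within slab L)"
    "\<And>z w. z \<in> slab L \<Longrightarrow> ((\<lambda>z. U2 z w) has_derivative V2 z w) (at z within slab L)"
    using smooth_on_second_derivative u2 by blast
  define w where "w t = dW t / W t" for t
  have "continuous_on {0..L} w"
    unfolding w_def using W_pos by (intro continuous_intros dW Ck_on_imp_continuous[OF W_smooth]) force
  then have "bounded (w ` {0..L})" by (auto intro!: compact_imp_bounded compact_continuous_image)
  then obtain K where "\<forall>y\<in>w ` {0..L}. norm y \<le> K" unfolding bounded_iff by blast
  then have K: "\<bar>w t\<bar> \<le> K" if "t \<in> {0..L}" for t using that by auto
  have nonpos: "Re (c * (u1 x - u2 x)) \<le> 0" for c :: complex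
  proof (rule slab_max_principle[where w = w and A = Hi and K = K, OF L])
    let ?R = "\<lambda>z. Re (c * z)"
    have R: "bounded_linear ?R"
      by (intro bounded_linear_compose[OF bounded_linear_Re] bounded_linear_mult_right)
    have Rlin: "linear ?R" by (rule bounded_linear.linear[OF R])
    fix z :: "real^('n option)" assume z: "z \<in> slab L"
    show "((\<lambda>x. ?R (u1 x - u2 x)) has_derivative (\<lambda>v. ?R (U1 z v - U2 z v))) (at z within slab L)"
      by (rule bounded_linear.has_derivative[OF R has_derivative_diff[OF UV1(1)[OF z] UV2(1)[OF z]]])
    show "((\<lambda>z. ?R (U1 z (axis j 1) - U2 z (axis j 1))) has_derivative
        (\<lambda>v. ?R (V1 z (axis j 1) v - V2 z (axis j 1) v))) (at z within slab L)" for j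
      by (rule bounded_linear.has_derivative[OF R has_derivative_diff[OF UV1(2)[OF z] UV2(2)[OF z]]])
    define X where "X = (V1 z (axis None 1) (axis None 1) - V2 z (axis None 1) (axis None 1)) +
        w (z $ None) *\<^sub>R (U1 z (axis None 1) - U2 z (axis None 1)) +
        (\<Sum>\<alpha>\<in>UNIV. \<Sum>\<beta>\<in>UNIV. Hi (z $ None) $ \<alpha> $ \<beta> *\<^sub>R
          (V1 z (axis (Some \<beta>) 1) (axis (Some \<alpha>) 1) - V2 z (axis (Some \<beta>) 1) (axis (Some \<alpha>) 1)))"
    have "X = laplace_beltrami (slab L) (product_metric h) u1 z - laplace_beltrami (slab L) (product_metric h) u2 z"
      using laplace_beltrami_eq[where V = "\<lambda>j. V1 z (axis j 1)", OF z UV1(1) UV1(2)[OF z]]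
        laplace_beltrami_eq[where V = "\<lambda>j. V2 z (axis j 1)", OF z UV2(1) UV2(2)[OF z]]
      by (simp add: X_def w_def scaleR_diff_right sum_subtractf)
    also have "\<dots> = 0" using u1 u2 z by simp
    finally have "?R X = 0" by simp
    then show "?R (V1 z (axis None 1) (axis None 1) - V2 z (axis None 1) (axis None 1)) +
        w (z $ None) * ?R (U1 z (axis None 1) - U2 z (axis None 1)) +
        (\<Sum>\<alpha>\<in>UNIV. \<Sum>\<beta>\<in>UNIV. Hi (z $ None) $ \<alpha> $ \<beta> *
          ?R (V1 z (axis (Some \<beta>) 1) (axis (Some \<alpha>) 1) - V2 z (axis (Some \<beta>) 1) (axis (Some \<alpha>) 1))) = 0"
      by (simp only: X_def linear_add[OF Rlin] linear_sum[OF Rlin] linear_cmul[OF Rlin] real_scaleR_def)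
  next
    show "torus_periodic L (\<lambda>x. Re (c * (u1 x - u2 x)))"
      using u1 u2 by (simp add: torus_periodic_def)
    show "Re (c * (u1 z - u2 z)) \<le> 0" if "z \<in> slab_boundary L" for z using u1 u2 that by simp
  qed (use K Hi_pos x in auto)
  have "Re (u1 x - u2 x) = 0" using nonpos[of 1] nonpos[of "-1"] by simp
  moreover have "Im (u1 x - u2 x) = 0" using nonpos[of "\<i>"] nonpos[of "- \<i>"] by simp
  ultimately show ?thesis by (simp add: complex_eq_iff)
qed

text \<open>The \<open>q\<close> of the overview. For fixed \<open>t\<close> it is the eigenvalue of
  minus the flat Laplacian of \<open>h t\<close> at the mode \<open>k\<close>.\<close>

definition Q :: "int^'n \<Rightarrow> real \<Rightarrow> real" where
  "Q k t = (\<Sum>\<alpha>\<in>UNIV. \<Sum>\<beta>\<in>UNIV. Hi t $ \<alpha> $ \<beta> * (of_int (k $ \<alpha>) * of_int (k $ \<beta>)))"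

lemma Q_smooth: "Ck_on j {0..L} (Q k)"
  unfolding Q_def[abs_def] by (intro Ck_on_sum Ck_on_mult Hi_smooth Ck_on_const)

lemma Q_inner: "Q k t = (\<chi> \<alpha>. of_int (k $ \<alpha>)) \<bullet> (Hi t *v (\<chi> \<alpha>. of_int (k $ \<alpha>)))"
  by (simp add: Q_def inner_matrix_vector mult_ac)

lemma Q_pos: "t \<in> {0..L} \<Longrightarrow> k \<noteq> 0 \<Longrightarrow> 0 < Q k t"
  unfolding Q_inner by (rule Sym_pos_pos[OF Hi_pos]) (auto simp: vec_eq_iff)

lemma Q_nonneg: "t \<in> {0..L} \<Longrightarrow> 0 \<le> Q k t"
  using Q_pos[of t k] by (cases "k = 0") (auto simp: Q_def)

text \<open>Here \<open>v\<close> is the flux \<open>W a'\<close>. It makes the system off-diagonal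
  and free of derivatives of \<open>W\<close>, and it carries the Neumann data.\<close>

definition mode_solution :: "int^'n \<Rightarrow> (real \<Rightarrow> real) \<Rightarrow> (real \<Rightarrow> real) \<Rightarrow> bool" where
  "mode_solution k a v \<longleftrightarrow> (\<forall>t\<in>{0..L}. (a has_real_derivative inverse (W t) * v t) (at t within {0..L}) \<and>
     (v has_real_derivative (W t * Q k t) * a t) (at t within {0..L}))"

lemma mode_solution_exists:
  obtains a v where "mode_solution k a v" "a 0 = A" "a L = B"
proof -
  have c: "continuous_on {0..L} (\<lambda>t. inverse (W t))" "continuous_on {0..L} (\<lambda>t. W t * Q k t)"
    using W_pos by (force intro!: continuous_intros Ck_on_imp_continuous[OF W_smooth] Ck_on_imp_continuous[OF Q_smooth])+
  have "0 < inverse (W t)" "0 \<le> W t * Q k t" if "t \<in> {0..L}" for t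
    using W_pos[OF that] Q_nonneg[OF that] by simp_all
  from dirichlet_problem_ode[OF L c this] obtain a v where "a 0 = A" "a L = B"
    "\<And>t. t \<in> {0..L} \<Longrightarrow> (a has_real_derivative inverse (W t) * v t) (at t within {0..L})"
    "\<And>t. t \<in> {0..L} \<Longrightarrow> (v has_real_derivative (W t * Q k t) * a t) (at t within {0..L})"
    by blast
  then show ?thesis by (intro that[of a v]) (simp_all add: mode_solution_def)
qed

lemma mode_solution_smooth:
  assumes "mode_solution k a v"
  shows "Ck_on j {0..L} a" "Ck_on j {0..L} v"
proof -
  have "Ck_on j {0..L} a \<and> Ck_on j {0..L} v"
  proof (rule Ck_on_linear_system)
    show "smooth_on {0..L} (\<lambda>t. inverse (W t))"
      using W_pos by (auto simp: smooth_on_def intro!: Ck_on_inverse W_smooth) (metis atLeastAtMost_iff less_irrefl)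
    show "smooth_on {0..L} (\<lambda>t. W t * Q k t)"
      by (auto simp: smooth_on_def intro!: Ck_on_mult W_smooth Q_smooth)
  qed (use assms in \<open>auto simp: mode_solution_def\<close>)
  then show "Ck_on j {0..L} a" "Ck_on j {0..L} v" by auto
qed

text \<open>The second conclusion records the differential up to the boundary, from which the
  Neumann data are read off.\<close>

lemma separated_solution:
  assumes s: "mode_solution k a v" and f: "\<And>x. x \<in> slab_boundary L \<Longrightarrow> f x = a (x $ None) *\<^sub>R fourier_mode k (torus_part x)"
  defines "u \<equiv> \<lambda>z. a (z $ None) *\<^sub>R exp (slab_exponent k z)"
  shows "dirichlet_solution L (product_metric h) f u"
    and "x \<in> slab L \<Longrightarrow> (u has_derivative (\<lambda>w. a (x $ None) *\<^sub>R (slab_exponent k w * exp (slab_exponent k x)) +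
        (w $ None * (inverse (W (x $ None)) * v (x $ None))) *\<^sub>R exp (slab_exponent k x))) (at x within slab L)"
proof -
  define a1 where "a1 t = inverse (W t) * v t" for t
  have a: "(a has_real_derivative a1 t) (at t within {0..L})"
    and v: "(v has_real_derivative (W t * Q k t) * a t) (at t within {0..L})" if "t \<in> {0..L}" for t
    using s that by (auto simp: mode_solution_def a1_def)
  \<comment> \<open>This is \<open>(W a')' = W Q a\<close> solved for \<open>a''\<close>; it matches
    the first-order term \<open>W' / W\<close> of \<open>laplace_beltrami_eq\<close>.\<close>
  have a1: "(a1 has_real_derivative (Q k t * a t - dW t / W t * a1 t)) (at t within {0..L})" if t: "t \<in> {0..L}" for t
    unfolding a1_def using W_pos[OF t] dW(1)[OF t] v[OF t]
    by (auto intro!: derivative_eq_intros simp: field_simps power2_eq_square)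
  define U where "U z w = a (z $ None) *\<^sub>R (slab_exponent k w * exp (slab_exponent k z)) +
        (w $ None * a1 (z $ None)) *\<^sub>R exp (slab_exponent k z)" for z w
  have xN: "z $ None \<in> {0..L}" if "z \<in> slab L" for z :: "real^('n option)" using that by (simp add: slab_def)
  have U: "(u has_derivative U z) (at z within slab L)" if z: "z \<in> slab L" for z
    unfolding u_def U_def
    by (rule partial_within_coefficient[OF L z a[OF xN[OF z]] exp_slab_exponent_deriv])
  then show "x \<in> slab L \<Longrightarrow> (u has_derivative (\<lambda>w. a (x $ None) *\<^sub>R (slab_exponent k w * exp (slab_exponent k x)) +
        (w $ None * (inverse (W (x $ None)) * v (x $ None))) *\<^sub>R exp (slab_exponent k x))) (at x within slab L)"
    unfolding U_def a1_def .
  have "laplace_beltrami (slab L) (product_metric h) u x = 0" if x: "x \<in> slab L" for x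
  proof -
    define t where "t = x $ None"
    have t: "t \<in> {0..L}" using xN[OF x] by (simp add: t_def)
    define E where "E = exp (slab_exponent k x)"
    define a2 where "a2 = Q k t * a t - dW t / W t * a1 t"
    define V where "V j = (case j of None \<Rightarrow> (\<lambda>w. a1 t *\<^sub>R (slab_exponent k w * E) + (w $ None * a2) *\<^sub>R E)
      | Some \<beta> \<Rightarrow> (\<lambda>w. a t *\<^sub>R (\<i> * of_int (k $ \<beta>) * (slab_exponent k w * E)) + (w $ None * a1 t) *\<^sub>R (\<i> * of_int (k $ \<beta>) * E)))" for j
    have V: "((\<lambda>z. U z (axis j 1)) has_derivative V j) (at x within slab L)" for j
    proof (cases j)
      case None
      have "(\<lambda>z. U z (axis j 1)) = (\<lambda>z. a1 (z $ None) *\<^sub>R exp (slab_exponent k z))"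
        by (simp add: None U_def)
      then show ?thesis
        using partial_within_coefficient[OF L x a1[OF xN[OF x]] exp_slab_exponent_deriv]
        by (simp add: None V_def t_def a2_def E_def)
    next
      case (Some \<beta>)
      have "(\<lambda>z. U z (axis j 1)) = (\<lambda>z. a (z $ None) *\<^sub>R (\<i> * of_int (k $ \<beta>) * exp (slab_exponent k z)))"
        by (simp add: Some U_def)
      then show ?thesis
        using partial_within_coefficient[OF L x a[OF xN[OF x]] has_derivative_mult_right[OF exp_slab_exponent_deriv]]
        by (simp add: Some V_def t_def E_def)
    qed
    have VS: "V (Some \<beta>) (axis (Some \<alpha>) 1) = - of_real (a t * (of_int (k $ \<alpha>) * of_int (k $ \<beta>))) * E" for \<alpha> \<beta>
    proof -
      have "V (Some \<beta>) (axis (Some \<alpha>) 1) = of_real (a t) * ((\<i> * \<i>) * (of_int (k $ \<alpha>) * of_int (k $ \<beta>))) * E"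
        by (simp add: V_def scaleR_conv_of_real mult_ac del: i_squared complex_i_mult_minus)
      then show ?thesis by simp
    qed
    have "laplace_beltrami (slab L) (product_metric h) u x =
        V None (axis None 1) + (dW t / W t) *\<^sub>R U x (axis None 1) +
        (\<Sum>\<alpha>\<in>UNIV. \<Sum>\<beta>\<in>UNIV. Hi t $ \<alpha> $ \<beta> *\<^sub>R V (Some \<beta>) (axis (Some \<alpha>) 1))"
      unfolding t_def by (rule laplace_beltrami_eq[OF x U V])
    also have "V None (axis None 1) = of_real a2 * E"
      by (simp add: V_def scaleR_conv_of_real)
    also have "U x (axis None 1) = of_real (a1 t) * E"
      by (simp add: U_def E_def t_def scaleR_conv_of_real)
    also have "(\<Sum>\<alpha>\<in>UNIV. \<Sum>\<beta>\<in>UNIV. Hi t $ \<alpha> $ \<beta> *\<^sub>R V (Some \<beta>) (axis (Some \<alpha>) 1)) = - of_real (a t * Q k t) * E"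
    proof -
      have "(\<Sum>\<alpha>\<in>UNIV. \<Sum>\<beta>\<in>UNIV. Hi t $ \<alpha> $ \<beta> *\<^sub>R V (Some \<beta>) (axis (Some \<alpha>) 1)) =
          (\<Sum>\<alpha>\<in>UNIV. \<Sum>\<beta>\<in>UNIV. (- of_real (a t) * E) * of_real (Hi t $ \<alpha> $ \<beta> * (of_int (k $ \<alpha>) * of_int (k $ \<beta>))))"
        unfolding VS by (intro sum.cong refl) (simp add: scaleR_conv_of_real)
      also have "\<dots> = (- of_real (a t) * E) * of_real (Q k t)"
        by (simp only: sum_distrib_left[symmetric] of_real_sum[symmetric] Q_def)
      finally show ?thesis by simp
    qed
    finally show ?thesis
      by (simp add: a2_def scaleR_conv_of_real algebra_simps)
  qed
  moreover have "smooth_on (slab L) u"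
    unfolding u_def smooth_on_def
    by (intro allI Ck_on_scaleR Ck_on_exp_slab_exponent Ck_on_slab_coordinate mode_solution_smooth[OF s])
  moreover have "torus_periodic L u"
    by (simp add: torus_periodic_def u_def exp_slab_exponent_periodic)
  ultimately show "dirichlet_solution L (product_metric h) f u"
    using f by (simp add: dirichlet_solution_def u_def fourier_mode_torus_part)
qed

text \<open>The \<open>t\<close> direction has length 1 and is orthogonal to the torus directions.
  That no other vector qualifies rests on positivity of \<open>h\<close>.\<close>

lemma outward_unit_normal_eq:
  assumes x: "x \<in> slab_boundary L"
  shows "outward_unit_normal L (product_metric h) x = (if x $ None = L then 1 else - 1) *\<^sub>R axis None 1"
  unfolding outward_unit_normal_def
proof (rule the_equality)
  have t: "x $ None \<in> {0..L}" using x L by (auto simp: slab_boundary_def)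
  have inner: "metric_inner (product_metric h) x v w = v $ None * w $ None + torus_part v \<bullet> (h (x $ None) *v torus_part w)" for v w
    by (simp add: metric_inner_def product_metric_block inner_block)
  have tp: "torus_part (c *\<^sub>R axis None 1 :: real^('n option)) = 0" for c by (simp add: torus_part_def axis_def vec_eq_iff)
  let ?e = "(if x $ None = L then 1 else - 1) *\<^sub>R axis None 1 :: real^('n option)"
  show "metric_inner (product_metric h) x ?e
       ?e = 1 \<and>
    (\<forall>w. w $ None = 0 \<longrightarrow> metric_inner (product_metric h) x ?e w = 0) \<and>
    (if x $ None = L then 0 < ?e $ None
     else ?e $ None < 0)"
    unfolding inner tp by simp
  fix v
  assume v: "metric_inner (product_metric h) x v v = 1 \<and>
    (\<forall>w. w $ None = 0 \<longrightarrow> metric_inner (product_metric h) x v w = 0) \<and>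
    (if x $ None = L then 0 < v $ None else v $ None < 0)"
  \<comment> \<open>The tangential part of \<open>v\<close> itself is the test vector: orthogonality
    to it makes that part zero.\<close>
  define w where "w = (\<chi> i. case i of None \<Rightarrow> 0 | Some \<alpha> \<Rightarrow> v $ Some \<alpha>)"
  have w: "w $ None = 0" "torus_part w = torus_part v" by (simp_all add: w_def torus_part_def)
  then have "torus_part v \<bullet> (h (x $ None) *v torus_part v) = 0"
    using v inner[of v w] by simp
  then have tv: "torus_part v = 0" using Sym_pos_pos[OF h_pos[OF t]] by force
  then have "(v $ None)\<^sup>2 = 1" using v inner[of v v] by (simp add: power2_eq_square)
  then have "v $ None = (if x $ None = L then 1 else - 1)"
    using v by (auto simp: power2_eq_1_iff split: if_splits)
  moreover have "v $ Some \<alpha> = 0" for \<alpha> using tv by (simp add: torus_part_def vec_eq_iff)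
  ultimately show "v = (if x $ None = L then 1 else - 1) *\<^sub>R axis None 1"
    by (intro vec_option_eqI) (simp_all add: axis_def)
qed

text \<open>By uniqueness the solution chosen in \<open>dn_map\<close> agrees on the slab with the
  separated one, and a derivative within the slab depends on nothing else. The result is a multiple
  of the mode \<open>k\<close>, so its coefficient at \<open>k\<close> is that multiple.\<close>

lemma dn_matrix_eq:
  assumes s: "mode_solution k a v" and r: "r \<in> {0, L}"
    and ends: "a 0 = (if s0 = 0 then 1 else 0)" "a L = (if s0 = L then 1 else 0)"
  shows "dn_matrix L (product_metric h) (r, k) (s0, k) =
    of_real ((if r = L then 1 else - 1) * (inverse (W r) * v r))"
proof -
  define f where "f = boundary_mode s0 k"
  define u where "u z = a (z $ None) *\<^sub>R exp (slab_exponent k z)" for z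
  have f: "f x = a (x $ None) *\<^sub>R fourier_mode k (torus_part x)" if "x \<in> slab_boundary L" for x
    using that ends L by (auto simp: f_def boundary_mode_def slab_boundary_def)
  have sep: "dirichlet_solution L (product_metric h) f u"
    unfolding u_def by (rule separated_solution(1)[OF s]) (rule f)
  have u_deriv: "(u has_derivative (\<lambda>w. a (x $ None) *\<^sub>R (slab_exponent k w * exp (slab_exponent k x)) +
        (w $ None * (inverse (W (x $ None)) * v (x $ None))) *\<^sub>R exp (slab_exponent k x))) (at x within slab L)"
    if "x \<in> slab L" for x
    unfolding u_def by (rule separated_solution(2)[OF s _ that]) (rule f)
  define u' where "u' = (SOME u. dirichlet_solution L (product_metric h) f u)"
  have u': "dirichlet_solution L (product_metric h) f u'"
    unfolding u'_def by (rule someI[of _ u]) (rule sep)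
  have "dn_map L (product_metric h) f (point r y) =
     of_real ((if r = L then 1 else - 1) * (inverse (W r) * v r)) * fourier_mode k y" for y
  proof -
    define x where "x = point r y"
    have xN: "x $ None = r" and xT: "torus_part x = y" by (simp_all add: x_def point_def torus_part_def)
    have x: "x \<in> slab L" "x \<in> slab_boundary L" using r L xN by (auto simp: slab_def slab_boundary_def)
    have eq: "u' z = u z" if "z \<in> slab L" for z
      by (rule dirichlet_solution_unique[OF u' sep that])
    have "frechet_derivative u' (at x within slab L) = (\<lambda>w. a (x $ None) *\<^sub>R (slab_exponent k w * exp (slab_exponent k x)) +
        (w $ None * (inverse (W (x $ None)) * v (x $ None))) *\<^sub>R exp (slab_exponent k x))"
      by (rule frechet_derivative_slab[OF L x(1) has_derivative_transform[OF x(1) eq u_deriv[OF x(1)]]])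
    then show ?thesis
      unfolding dn_map_def u'_def[symmetric] x_def[symmetric] outward_unit_normal_eq[OF x(2)] 
      using linear_cmul[OF bounded_linear.linear[OF bounded_linear_slab_exponent], of k "if x $ None = L then 1 else - 1" "axis None 1"]
      by (simp add: xN fourier_mode_torus_part[symmetric] xT scaleR_conv_of_real)
  qed
  then show ?thesis by (simp add: dn_matrix_def f_def[symmetric] boundary_coeff_mode)
qed

end

section \<open>Reconstruction of the metric\<close>

text \<open>Difference quotients of \<tau> are reciprocals of those of \<open>X\<close>. The version
  within a set covers the one-sided derivatives at the ends of the interval, where the string
  equation must hold as well.\<close>

lemma inverse_has_derivative_within:
  fixes X \<tau> :: "real \<Rightarrow> real"
  assumes X: "(X has_real_derivative d) (at (\<tau> x) within S)" and d: "d \<noteq> 0"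
    and cont: "continuous_on (X ` S) \<tau>" and inv: "\<And>t. t \<in> S \<Longrightarrow> \<tau> (X t) = t" and x: "x \<in> X ` S"
  shows "(\<tau> has_real_derivative inverse d) (at x within X ` S)"
proof -
  have Xt: "X (\<tau> y) = y" "\<tau> y \<in> S" if "y \<in> X ` S" for y using that inv by auto
  have "filterlim \<tau> (at (\<tau> x) within S) (at x within X ` S)"
    unfolding filterlim_at
  proof
    show "\<forall>\<^sub>F y in at x within X ` S. \<tau> y \<in> S \<and> \<tau> y \<noteq> \<tau> x"
      unfolding eventually_at_filter using Xt x by (intro always_eventually) metis
    show "(\<tau> \<longlongrightarrow> \<tau> x) (at x within X ` S)" using cont x unfolding continuous_on_def by blast
  qed
  from filterlim_compose[OF X[unfolded has_field_derivative_iff] this]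
  have "((\<lambda>y. inverse ((X (\<tau> y) - X (\<tau> x)) / (\<tau> y - \<tau> x))) \<longlongrightarrow> inverse d) (at x within X ` S)"
    by (rule tendsto_inverse) (rule d)
  then have "((\<lambda>y. (\<tau> y - \<tau> x) / (y - x)) \<longlongrightarrow> inverse d) (at x within X ` S)"
    by (rule Lim_transform_eventually)
      (use Xt x in \<open>auto simp: eventually_at_filter field_simps intro!: always_eventually\<close>)
  then show ?thesis by (simp add: has_field_derivative_iff)
qed

text \<open>Polarisation uses only the unit vectors and the sums of two of them, all of which are
  integer vectors.\<close>

lemma symmetric_form_eq_on_integers:
  fixes A B :: "real^'n^'n"
  assumes A: "\<And>i j. A $ i $ j = A $ j $ i" and B: "\<And>i j. B $ i $ j = B $ j $ i"
    and eq: "\<And>k :: int^'n. (\<Sum>\<alpha>\<in>UNIV. \<Sum>\<beta>\<in>UNIV. A $ \<alpha> $ \<beta> * (of_int (k $ \<alpha>) * of_int (k $ \<beta>))) =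
      (\<Sum>\<alpha>\<in>UNIV. \<Sum>\<beta>\<in>UNIV. B $ \<alpha> $ \<beta> * (of_int (k $ \<alpha>) * of_int (k $ \<beta>)))"
  shows "A = B"
proof -
  define q where "q x = x \<bullet> ((A - B) *v x)" for x :: "real^'n"
  have q: "q (\<chi> \<alpha>. of_int (k $ \<alpha>)) = 0" for k :: "int^'n"
    using eq[of k] unfolding q_def
    by (simp add: matrix_vector_mult_diff_rdistrib inner_diff_right inner_matrix_vector mult_ac)
  have ax: "axis i 1 \<bullet> ((A - B) *v axis j 1) = (A - B) $ i $ j" for i j
    by (simp add: inner_axis' matrix_vector_mul_component inner_axis)
  have int_axis: "(\<chi> \<alpha>. of_int (axis i 1 $ \<alpha>)) = (axis i 1 :: real^'n)"
    "(\<chi> \<alpha>. of_int ((axis i 1 + axis j 1) $ \<alpha>)) = (axis i 1 + axis j 1 :: real^'n)" for i j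
    by (simp_all add: vec_eq_iff axis_def)
  have diag: "(A - B) $ i $ i = 0" for i
    using q[of "axis i 1"] unfolding int_axis q_def ax .
  have "(A - B) $ i $ j = 0" for i j
  proof -
    have "q (axis i 1 + axis j 1) = 0" using q[of "axis i 1 + axis j 1"] unfolding int_axis .
    then have "(A - B) $ i $ i + (A - B) $ j $ i + ((A - B) $ i $ j + (A - B) $ j $ j) = 0"
      unfolding q_def matrix_vector_right_distrib inner_add_left inner_add_right ax .
    then show ?thesis using diag A[of i j] B[of i j] by simp
  qed
  then show ?thesis by (simp add: vec_eq_iff)
qed

section \<open>The zero mode as a coordinate, and the reduction to the string\<close>

context cylinder_metric
begin

text \<open>The coordinate \<open>x = Y t / T\<close> is the zero mode with end values 0 and 1,
  since \<open>W\<close> times its derivative is constant; \<open>T\<close> is the integral of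
  \<open>1 / W\<close>, and \<tau> is the inverse function. For a mode with flux \<open>v\<close>
  the derivative in \<open>x\<close> is \<open>T * v\<close>.\<close>

lemma travel_time:
  obtains T \<tau> where "0 < T" "\<tau> 0 = 0" "\<tau> 1 = L" "\<And>x. x \<in> {0..1} \<Longrightarrow> \<tau> x \<in> {0..L}"
    "\<And>x. x \<in> {0..1} \<Longrightarrow> (\<tau> has_real_derivative T * W (\<tau> x)) (at x within {0..1})"
proof -
  define Y where "Y t = integral {0..t} (\<lambda>t. inverse (W t))" for t
  have c: "continuous_on {0..L} (\<lambda>t. inverse (W t))"
    using W_pos by (force intro!: continuous_intros Ck_on_imp_continuous[OF W_smooth])
  have Y: "(Y has_real_derivative inverse (W t)) (at t within {0..L})" if "t \<in> {0..L}" for t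
    unfolding Y_def using integral_has_real_derivative[OF c that] .
  have less: "Y s < Y t" if st: "0 \<le> s" "s < t" "t \<le> L" for s t
  proof -
    have sub: "{s..t} \<subseteq> {0..L}" using st by auto
    obtain z where z: "z \<in> {s<..<t}" "Y t - Y s = inverse (W z) * (t - s)"
      using mvt_within[OF st(2), of Y "\<lambda>t. inverse (W t)"] DERIV_subset[OF Y sub] sub by blast
    then have "0 < inverse (W z) * (t - s)" using W_pos[of z] st by (intro mult_pos_pos) auto
    then show ?thesis using z by simp
  qed
  define T where "T = Y L"
  have Y0: "Y 0 = 0" by (simp add: Y_def)
  have T: "0 < T" using less[of 0 L] L Y0 by (simp add: T_def)
  define X where "X t = Y t / T" for t
  have X: "(X has_real_derivative inverse (T * W t)) (at t within {0..L})" if "t \<in> {0..L}" for t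
    unfolding X_def using DERIV_cdivide[OF Y[OF that], of T] by (simp add: field_simps)
  have X_less: "X s < X t" if "0 \<le> s" "s < t" "t \<le> L" for s t
    using less[OF that] T by (simp add: X_def divide_strict_right_mono)
  have inj: "inj_on X {0..L}"
    by (rule linorder_inj_onI) (use X_less in \<open>fastforce+\<close>)
  have X01: "X 0 = 0" "X L = 1" using T by (simp_all add: X_def Y0 T_def)
  have X_cont: "continuous_on {0..L} X" using X by (rule DERIV_continuous_on)
  have img: "X ` {0..L} = {0..1}"
  proof
    show "X ` {0..L} \<subseteq> {0..1}"
    proof
      fix y assume "y \<in> X ` {0..L}"
      then obtain t where t: "t \<in> {0..L}" "y = X t" by blast
      have "X 0 \<le> X t" using X_less[of 0 t] t by (cases "t = 0") auto
      moreover have "X t \<le> X L" using X_less[of t L] t by (cases "t = L") auto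
      ultimately show "y \<in> {0..1}" using t X01 by simp
    qed
    show "{0..1} \<subseteq> X ` {0..L}"
    proof
      fix y :: real assume "y \<in> {0..1}"
      then have "\<exists>t. 0 \<le> t \<and> t \<le> L \<and> X t = y" using X_cont X01 L by (intro IVT') auto
      then show "y \<in> X ` {0..L}" by auto
    qed
  qed
  define \<tau> where "\<tau> = inv_into {0..L} X"
  have inv: "\<tau> (X t) = t" if "t \<in> {0..L}" for t using inj that by (simp add: \<tau>_def)
  have \<tau>_in: "\<tau> x \<in> {0..L}" if "x \<in> {0..1}" for x
    using that inv_into_into[of x X "{0..L}"] by (simp add: \<tau>_def img)
  have \<tau>_cont: "continuous_on (X ` {0..L}) \<tau>"
    by (rule continuous_on_inv[OF X_cont]) (use inv in auto)
  show ?thesis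
  proof (rule that[of T \<tau>])
    fix x :: real assume x: "x \<in> {0..1}"
    show "(\<tau> has_real_derivative T * W (\<tau> x)) (at x within {0..1})"
      using inverse_has_derivative_within[OF X[OF \<tau>_in[OF x]] _ \<tau>_cont inv] x T W_pos[OF \<tau>_in[OF x]]
      unfolding img by simp
  qed (use T \<tau>_in inv[of 0] inv[of L] X01 L in auto)
qed

lemma mode_solution_string:
  assumes \<tau>: "\<And>x. x \<in> {0..1} \<Longrightarrow> \<tau> x \<in> {0..L}"
    "\<And>x. x \<in> {0..1} \<Longrightarrow> (\<tau> has_real_derivative T * W (\<tau> x)) (at x within {0..1})"
    and s: "mode_solution k a v"
  shows "ode_sol (\<lambda>x. (T * W (\<tau> x))\<^sup>2 * Q k (\<tau> x)) (\<lambda>x. a (\<tau> x)) (\<lambda>x. T * v (\<tau> x))"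
  unfolding ode_sol_def
proof (intro ballI conjI)
  fix x :: real assume x: "x \<in> {0..1}"
  have sub: "\<tau> ` {0..1} \<subseteq> {0..L}" using \<tau>(1) by auto
  have chain: "((\<lambda>x. p (\<tau> x)) has_real_derivative p' * (T * W (\<tau> x))) (at x within {0..1})"
    if "(p has_real_derivative p') (at (\<tau> x) within {0..L})" for p p'
    using DERIV_image_chain[OF DERIV_subset[OF that sub] \<tau>(2)[OF x]] by (simp add: o_def)
  have a: "(a has_real_derivative inverse (W (\<tau> x)) * v (\<tau> x)) (at (\<tau> x) within {0..L})"
    and v: "(v has_real_derivative (W (\<tau> x) * Q k (\<tau> x)) * a (\<tau> x)) (at (\<tau> x) within {0..L})"
    using s \<tau>(1)[OF x] by (auto simp: mode_solution_def)
  show "((\<lambda>x. a (\<tau> x)) has_real_derivative T * v (\<tau> x)) (at x within {0..1})"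
    using chain[OF a] W_pos[OF \<tau>(1)[OF x]] by (simp add: field_simps)
  show "((\<lambda>x. T * v (\<tau> x)) has_real_derivative (T * W (\<tau> x))\<^sup>2 * Q k (\<tau> x) * a (\<tau> x)) (at x within {0..1})"
    using DERIV_cmult[OF chain[OF v], of T] by (simp add: power2_eq_square mult_ac)
qed

lemma string_coefficient_derivative:
  assumes \<tau>: "\<And>x. x \<in> {0..1} \<Longrightarrow> \<tau> x \<in> {0..L}"
    "\<And>x. x \<in> {0..1} \<Longrightarrow> (\<tau> has_real_derivative T * W (\<tau> x)) (at x within {0..1})"
  obtains d where "\<And>x. x \<in> {0..1} \<Longrightarrow> ((\<lambda>x. (T * W (\<tau> x))\<^sup>2 * Q k (\<tau> x)) has_real_derivative d x) (at x within {0..1})"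
    "continuous_on {0..1} d"
proof -
  have sub: "\<tau> ` {0..1} \<subseteq> {0..L}" using \<tau>(1) by auto
  have "Ck_on 1 {0..L} (\<lambda>t. (T * W t) * (T * W t) * Q k t)"
    by (intro Ck_on_mult Ck_on_const W_smooth Q_smooth)
  then obtain c' where c': "\<And>t. t \<in> {0..L} \<Longrightarrow> ((\<lambda>t. (T * W t) * (T * W t) * Q k t) has_real_derivative c' t) (at t within {0..L})"
    "continuous_on {0..L} c'"
    by (rule smooth_has_derivative) blast
  have \<tau>_cont: "continuous_on {0..1} \<tau>" using \<tau>(2) by (rule DERIV_continuous_on)
  show ?thesis
  proof (rule that[of "\<lambda>x. c' (\<tau> x) * (T * W (\<tau> x))"])
    fix x :: real assume x: "x \<in> {0..1}"
    show "((\<lambda>x. (T * W (\<tau> x))\<^sup>2 * Q k (\<tau> x)) has_real_derivative c' (\<tau> x) * (T * W (\<tau> x))) (at x within {0..1})"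
      using DERIV_image_chain[OF DERIV_subset[OF c'(1)[OF \<tau>(1)[OF x]] sub] \<tau>(2)[OF x]]
      by (simp add: o_def power2_eq_square)
  next
    show "continuous_on {0..1} (\<lambda>x. c' (\<tau> x) * (T * W (\<tau> x)))"
      by (intro continuous_intros continuous_on_compose2[OF c'(2) \<tau>_cont sub]
        continuous_on_compose2[OF Ck_on_imp_continuous[OF W_smooth] \<tau>_cont sub])
  qed
qed

lemma Q_scale: "Q (\<chi> \<alpha>. int n * k $ \<alpha>) t = (real n)\<^sup>2 * Q k t"
  by (simp add: Q_def sum_distrib_left power2_eq_square mult_ac)

end

section \<open>Comparison of two metrics with the same boundary data\<close>

theorem theorem1p4:
  fixes L :: real and h1 h2 :: "real \<Rightarrow> real^'n^'n"
  assumes "CARD('n) \<ge> 2"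
    and "L > 0"
    and "smooth_on {0..L} h1" and "h1 ` {0..L} \<subseteq> Sym_pos"
    and "smooth_on {0..L} h2" and "h2 ` {0..L} \<subseteq> Sym_pos"
    and "\<forall>r\<in>{0, L}. \<forall>s\<in>{0, L}. \<forall>(l :: int^'n) (k :: int^'n).
           dn_matrix L (product_metric h1) (r, l) (s, k) =
           dn_matrix L (product_metric h2) (r, l) (s, k)"
  shows "\<forall>t\<in>{0..L}. h1 t = h2 t"
proof -
  interpret m1: cylinder_metric L h1 using assms by unfold_locales auto
  interpret m2: cylinder_metric L h2 using assms by unfold_locales auto
  note L = \<open>L > 0\<close>
  obtain T1 \<tau>1 where T1: "0 < T1" and \<tau>1: "\<tau>1 0 = 0" "\<tau>1 1 = L" "\<And>x. x \<in> {0..1} \<Longrightarrow> \<tau>1 x \<in> {0..L}"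
    "\<And>x. x \<in> {0..1} \<Longrightarrow> (\<tau>1 has_real_derivative T1 * m1.W (\<tau>1 x)) (at x within {0..1})"
    using m1.travel_time by blast
  obtain T2 \<tau>2 where T2: "0 < T2" and \<tau>2: "\<tau>2 0 = 0" "\<tau>2 1 = L" "\<And>x. x \<in> {0..1} \<Longrightarrow> \<tau>2 x \<in> {0..L}"
    "\<And>x. x \<in> {0..1} \<Longrightarrow> (\<tau>2 has_real_derivative T2 * m2.W (\<tau>2 x)) (at x within {0..1})"
    using m2.travel_time by blast
  \<comment> \<open>The sign of the outward normal at \<open>r\<close> is the same for the two
    metrics and cancels.\<close>
  have dn_eq: "inverse (m1.W r) * v1 r = inverse (m2.W r) * v2 r"
    if s: "m1.mode_solution k a1 v1" "m2.mode_solution k a2 v2" and r: "r \<in> {0, L}" and s0: "s0 \<in> {0, L}"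
      and "a1 0 = (if s0 = 0 then 1 else 0)" "a1 L = (if s0 = L then 1 else 0)"
      and "a2 0 = (if s0 = 0 then 1 else 0)" "a2 L = (if s0 = L then 1 else 0)" for k a1 v1 a2 v2 r s0
  proof -
    have "dn_matrix L (product_metric h1) (r, k) (s0, k) = dn_matrix L (product_metric h2) (r, k) (s0, k)"
      using assms(7) r s0 by blast
    then have "complex_of_real ((if r = L then 1 else - 1) * (inverse (m1.W r) * v1 r)) =
        complex_of_real ((if r = L then 1 else - 1) * (inverse (m2.W r) * v2 r))"
      using m1.dn_matrix_eq[OF s(1) r, of s0] m2.dn_matrix_eq[OF s(2) r, of s0] that by metis
    then show ?thesis by (simp only: of_real_eq_iff) (auto split: if_splits)
  qed
  \<comment> \<open>The potential of the zero mode vanishes, so in the coordinate \<open>x\<close>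
    the mode is affine with slope 1.\<close>
  have unit: "T1 * v1 r = 1 \<and> T2 * v2 r = 1"
    if s: "m1.mode_solution 0 a1 v1" "m2.mode_solution 0 a2 v2" and r: "r \<in> {0, L}"
      and ends: "a1 0 = 0" "a1 L = 1" "a2 0 = 0" "a2 L = 1" for a1 v1 a2 v2 r
  proof -
    have const: "v 0 = 1 \<and> v 1 = 1" if sol: "ode_sol (\<lambda>x. 0) u v" and ends: "u 0 = 0" "u 1 = 1" for u v
    proof -
      have "\<exists>c. \<forall>x\<in>{0..1}. v x = c"
        using sol by (intro has_field_derivative_zero_constant) (auto simp: ode_sol_def)
      then obtain c where c: "\<And>x. x \<in> {0..1} \<Longrightarrow> v x = c" by blast
      obtain x where "x \<in> {0<..<1}" "u 1 - u 0 = v x * (1 - 0)"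
        using mvt_within[of 0 1 u v] sol unfolding ode_sol_def by (metis zero_less_one)
      then show ?thesis using c[of x] c[of 0] c[of 1] ends by simp
    qed
    have Q0: "m1.Q 0 t = 0" "m2.Q 0 t = 0" for t by (simp_all add: m1.Q_def m2.Q_def)
    show ?thesis
      using const[of "\<lambda>x. a1 (\<tau>1 x)" "\<lambda>x. T1 * v1 (\<tau>1 x)"] m1.mode_solution_string[OF \<tau>1(3,4) s(1)]
        const[of "\<lambda>x. a2 (\<tau>2 x)" "\<lambda>x. T2 * v2 (\<tau>2 x)"] m2.mode_solution_string[OF \<tau>2(3,4) s(2)]
        \<tau>1(1,2) \<tau>2(1,2) ends r by (auto simp: Q0)
  qed
  \<comment> \<open>The zero mode has flux \<open>1 / T\<close>, so its Neumann data at
    \<open>r\<close> give the product of \<open>T\<close> and \<open>W r\<close>, the factor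
    \<open>dt / dx\<close> at that end.\<close>
  have TW: "T1 * m1.W r = T2 * m2.W r" if r: "r \<in> {0, L}" for r
  proof -
    obtain a1 v1 where 1: "m1.mode_solution 0 a1 v1" "a1 0 = 0" "a1 L = 1" by (rule m1.mode_solution_exists)
    obtain a2 v2 where 2: "m2.mode_solution 0 a2 v2" "a2 0 = 0" "a2 L = 1" by (rule m2.mode_solution_exists)
    have "inverse (m1.W r) * v1 r = inverse (m2.W r) * v2 r"
      by (rule dn_eq[OF 1(1) 2(1) r, of L]) (use 1 2 L in auto)
    moreover have "v1 r = inverse T1" "v2 r = inverse T2"
      using unit[OF 1(1) 2(1) r 1(2,3) 2(2,3)] T1 T2 by (auto simp: field_simps)
    ultimately have "inverse (T1 * m1.W r) = inverse (T2 * m2.W r)" by (simp add: mult.commute)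
    then show ?thesis by (simp only: inverse_eq_iff_eq)
  qed
  have W1: "0 < T1 * m1.W (\<tau>1 x)" and W2: "0 < T2 * m2.W (\<tau>2 x)" if "x \<in> {0..1}" for x
    using m1.W_pos[OF \<tau>1(3)[OF that]] m2.W_pos[OF \<tau>2(3)[OF that]] T1 T2 by simp_all
  have Q_eq: "(T1 * m1.W (\<tau>1 x))\<^sup>2 * m1.Q k (\<tau>1 x) = (T2 * m2.W (\<tau>2 x))\<^sup>2 * m2.Q k (\<tau>2 x)"
    if x: "x \<in> {0..1}" for x k
  proof (cases "k = 0")
    case True
    then show ?thesis by (simp add: m1.Q_def m2.Q_def)
  next
    case False
    obtain d1 where d1: "\<And>x. x \<in> {0..1} \<Longrightarrow> ((\<lambda>x. (T1 * m1.W (\<tau>1 x))\<^sup>2 * m1.Q k (\<tau>1 x)) has_real_derivative d1 x) (at x within {0..1})"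
      "continuous_on {0..1} d1" using m1.string_coefficient_derivative[OF \<tau>1(3,4)] by blast
    obtain d2 where d2: "\<And>x. x \<in> {0..1} \<Longrightarrow> ((\<lambda>x. (T2 * m2.W (\<tau>2 x))\<^sup>2 * m2.Q k (\<tau>2 x)) has_real_derivative d2 x) (at x within {0..1})"
      "continuous_on {0..1} d2" using m2.string_coefficient_derivative[OF \<tau>2(3,4)] by blast
    show ?thesis
    proof (rule string_uniqueness[OF _ _ d1 d2 _ x])
      show "0 < (T1 * m1.W (\<tau>1 x))\<^sup>2 * m1.Q k (\<tau>1 x)" if "x \<in> {0..1}" for x
        by (intro mult_pos_pos[of "_\<^sup>2"] zero_less_power W1 m1.Q_pos \<tau>1 that False)
      show "0 < (T2 * m2.W (\<tau>2 x))\<^sup>2 * m2.Q k (\<tau>2 x)" if "x \<in> {0..1}" for x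
        by (intro mult_pos_pos[of "_\<^sup>2"] zero_less_power W2 m2.Q_pos \<tau>2 that False)
      fix n :: nat and b :: bool assume "1 \<le> n"
      \<comment> \<open>The frequency \<open>n k\<close> is again an integer vector, and
        \<open>Q\<close> is quadratic in it. This provides string data for every
        \<open>n\<close>.\<close>
      define k' where "k' = (\<chi> \<alpha>. int n * k $ \<alpha>)"
      have Qk': "(real n)\<^sup>2 * (w * m1.Q k t) = w * m1.Q k' t" "(real n)\<^sup>2 * (w * m2.Q k t) = w * m2.Q k' t" for w t
        by (simp_all add: k'_def m1.Q_scale m2.Q_scale)
      define s0 where "s0 = (if b then L else 0)"
      obtain a1 v1 where 1: "m1.mode_solution k' a1 v1" "a1 0 = (if s0 = 0 then 1 else 0)" "a1 L = (if s0 = L then 1 else 0)"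
        by (rule m1.mode_solution_exists)
      obtain a2 v2 where 2: "m2.mode_solution k' a2 v2" "a2 0 = (if s0 = 0 then 1 else 0)" "a2 L = (if s0 = L then 1 else 0)"
        by (rule m2.mode_solution_exists)
      \<comment> \<open>Multiplying Neumann data, which are derivatives in \<open>t\<close>, by
        \<open>dt / dx\<close> gives derivatives in \<open>x\<close>; by \<open>TW\<close> the
        factor is common to both metrics.\<close>
      have v: "T1 * v1 r = T2 * v2 r" if r: "r \<in> {0, L}" for r
      proof -
        have "inverse (m1.W r) * v1 r = inverse (m2.W r) * v2 r"
          by (rule dn_eq[OF 1(1) 2(1) r _ 1(2,3) 2(2,3)]) (simp add: s0_def)
        then have "(T1 * m1.W r) * (inverse (m1.W r) * v1 r) = (T2 * m2.W r) * (inverse (m2.W r) * v2 r)"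
          using TW[OF r] by simp
        moreover have "0 < m1.W r" "0 < m2.W r" using r L m1.W_pos m2.W_pos by auto
        ultimately show ?thesis by (simp add: field_simps)
      qed
      have "dn_data (\<lambda>x. (real n)\<^sup>2 * ((T1 * m1.W (\<tau>1 x))\<^sup>2 * m1.Q k (\<tau>1 x))) b (T1 * v1 0) (T1 * v1 L)"
        unfolding dn_data_def Qk' using m1.mode_solution_string[OF \<tau>1(3,4) 1(1)] 1(2,3) \<tau>1(1,2) L
        by (intro exI[of _ "\<lambda>x. a1 (\<tau>1 x)"] exI[of _ "\<lambda>x. T1 * v1 (\<tau>1 x)"]) (auto simp: s0_def)
      moreover have "dn_data (\<lambda>x. (real n)\<^sup>2 * ((T2 * m2.W (\<tau>2 x))\<^sup>2 * m2.Q k (\<tau>2 x))) b (T2 * v2 0) (T2 * v2 L)"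
        unfolding dn_data_def Qk' using m2.mode_solution_string[OF \<tau>2(3,4) 2(1)] 2(2,3) \<tau>2(1,2) L
        by (intro exI[of _ "\<lambda>x. a2 (\<tau>2 x)"] exI[of _ "\<lambda>x. T2 * v2 (\<tau>2 x)"]) (auto simp: s0_def)
      ultimately show "\<exists>a b'. dn_data (\<lambda>x. (real n)\<^sup>2 * ((T1 * m1.W (\<tau>1 x))\<^sup>2 * m1.Q k (\<tau>1 x))) b a b' \<and>
          dn_data (\<lambda>x. (real n)\<^sup>2 * ((T2 * m2.W (\<tau>2 x))\<^sup>2 * m2.Q k (\<tau>2 x))) b a b'"
        using v[of 0] v[of L] by auto
    qed
  qed
  have W1_nz: "(T1 * m1.W (\<tau>1 x))\<^sup>2 \<noteq> 0" if "x \<in> {0..1}" for x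
    using zero_less_power[OF W1[OF that]] by (metis less_irrefl)
  have frac: "X = (b / a) *\<^sub>R Y" if "a *\<^sub>R X = b *\<^sub>R Y" "a \<noteq> 0" for a b :: real and X Y :: "real^'n^'n"
  proof -
    have "X = inverse a *\<^sub>R (a *\<^sub>R X)" using that(2) by simp
    also have "\<dots> = (b / a) *\<^sub>R Y" by (simp add: that(1) divide_inverse mult.commute)
    finally show ?thesis .
  qed
  define c where "c x = (T2 * m2.W (\<tau>2 x))\<^sup>2 / (T1 * m1.W (\<tau>1 x))\<^sup>2" for x
  have c_pos: "0 < c x" if "x \<in> {0..1}" for x
    unfolding c_def by (intro divide_pos_pos zero_less_power W1[OF that] W2[OF that])
  have h_eq: "h2 (\<tau>2 x) = c x *\<^sub>R h1 (\<tau>1 x)" if x: "x \<in> {0..1}" for x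
  proof -
    have "(T1 * m1.W (\<tau>1 x))\<^sup>2 *\<^sub>R m1.Hi (\<tau>1 x) = (T2 * m2.W (\<tau>2 x))\<^sup>2 *\<^sub>R m2.Hi (\<tau>2 x)"
    proof (rule symmetric_form_eq_on_integers)
      fix k :: "int^'n"
      show "(\<Sum>\<alpha>\<in>UNIV. \<Sum>\<beta>\<in>UNIV. ((T1 * m1.W (\<tau>1 x))\<^sup>2 *\<^sub>R m1.Hi (\<tau>1 x)) $ \<alpha> $ \<beta> * (of_int (k $ \<alpha>) * of_int (k $ \<beta>))) =
        (\<Sum>\<alpha>\<in>UNIV. \<Sum>\<beta>\<in>UNIV. ((T2 * m2.W (\<tau>2 x))\<^sup>2 *\<^sub>R m2.Hi (\<tau>2 x)) $ \<alpha> $ \<beta> * (of_int (k $ \<alpha>) * of_int (k $ \<beta>)))"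
        using Q_eq[OF x, of k] by (simp add: m1.Q_def m2.Q_def sum_distrib_left mult.assoc)
    qed (use Sym_pos_sym[OF m1.Hi_pos[OF \<tau>1(3)[OF x]]] Sym_pos_sym[OF m2.Hi_pos[OF \<tau>2(3)[OF x]]] in simp_all)
    then have Hi: "m1.Hi (\<tau>1 x) = c x *\<^sub>R m2.Hi (\<tau>2 x)"
      unfolding c_def by (rule frac[OF _ W1_nz[OF x]])
    note inv1 = matrix_inv_mult[OF m1.h_det[OF \<tau>1(3)[OF x]], folded m1.Hi_def]
    note inv2 = matrix_inv_mult[OF m2.h_det[OF \<tau>2(3)[OF x]], folded m2.Hi_def]
    have "(c x *\<^sub>R h1 (\<tau>1 x)) ** m2.Hi (\<tau>2 x) = mat 1"
      using inv1(1) unfolding Hi by (simp add: matrix_matrix_mult_def vec_eq_iff mult_ac)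
    then have "(c x *\<^sub>R h1 (\<tau>1 x)) ** (m2.Hi (\<tau>2 x) ** h2 (\<tau>2 x)) = h2 (\<tau>2 x)"
      by (simp only: matrix_mul_assoc matrix_mul_lid)
    then show ?thesis by (simp add: inv2)
  qed
  \<comment> \<open>With \<open>m = CARD('n)\<close>, the determinant of \<open>h_eq\<close> gives
    \<open>W2^2 = c^m W1^2\<close>, while \<open>c\<close> is by definition
    \<open>(T2 W2)^2 / (T1 W1)^2\<close>. Eliminating \<open>W1\<close> and \<open>W2\<close> leaves
    a constant.\<close>
  have c_power: "c x ^ (CARD('n) - 1) = (T1 / T2)\<^sup>2" if x: "x \<in> {0..1}" for x
  proof -
    have "(m2.W (\<tau>2 x))\<^sup>2 = det (block (h2 (\<tau>2 x)))"
      using m2.block_det_pos[OF \<tau>2(3)[OF x]] by (simp add: m2.W_def)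
    also have "\<dots> = c x ^ CARD('n) * det (block (h1 (\<tau>1 x)))" by (simp add: h_eq[OF x] det_block_scaleR)
    also have "det (block (h1 (\<tau>1 x))) = (m1.W (\<tau>1 x))\<^sup>2"
      using m1.block_det_pos[OF \<tau>1(3)[OF x]] by (simp add: m1.W_def)
    also have "c x ^ CARD('n) = c x * c x ^ (CARD('n) - 1)" by (simp flip: power_Suc)
    finally have "(m2.W (\<tau>2 x))\<^sup>2 = c x * c x ^ (CARD('n) - 1) * (m1.W (\<tau>1 x))\<^sup>2" .
    moreover have "c x * (T1\<^sup>2 * (m1.W (\<tau>1 x))\<^sup>2) = T2\<^sup>2 * (m2.W (\<tau>2 x))\<^sup>2"
      using W1_nz[OF x] unfolding c_def power_mult_distrib by simp
    ultimately have "(c x * (m1.W (\<tau>1 x))\<^sup>2) * T1\<^sup>2 = (c x * (m1.W (\<tau>1 x))\<^sup>2) * (T2\<^sup>2 * c x ^ (CARD('n) - 1))"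
      by (simp add: mult_ac)
    moreover have "c x * (m1.W (\<tau>1 x))\<^sup>2 \<noteq> 0" using c_pos[OF x] m1.W_pos[OF \<tau>1(3)[OF x]] by simp
    ultimately have "T1\<^sup>2 = T2\<^sup>2 * c x ^ (CARD('n) - 1)" by simp
    then show ?thesis using T2 by (simp add: power_divide)
  qed
  \<comment> \<open>The boundary value \<open>c 0 = 1\<close> determines that constant.\<close>
  have "T1 * m1.W (\<tau>1 0) = T2 * m2.W (\<tau>2 0)" using TW[of 0] by (simp add: \<tau>1(1) \<tau>2(1))
  then have "c 0 = 1" using W1_nz[of 0] by (simp add: c_def del: mult_eq_0_iff)
  \<comment> \<open>Taking the root requires \<open>CARD('n) - 1 > 0\<close>; this is where the
    dimension enters.\<close>
  have c1: "c x = 1" if x: "x \<in> {0..1}" for x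
  proof (rule power_eq_imp_eq_base)
    show "c x ^ (CARD('n) - 1) = 1 ^ (CARD('n) - 1)" using c_power[OF x] c_power[of 0] \<open>c 0 = 1\<close> by simp
  qed (use c_pos[OF x] assms(1) in auto)
  have W_eq: "T1 * m1.W (\<tau>1 x) = T2 * m2.W (\<tau>2 x)" if x: "x \<in> {0..1}" for x
  proof -
    have "(T1 * m1.W (\<tau>1 x))\<^sup>2 = (T2 * m2.W (\<tau>2 x))\<^sup>2"
      using c1[OF x] W1_nz[OF x] unfolding c_def by (simp only: divide_eq_1_iff)
    then show ?thesis
      by (simp only: power2_eq_iff_nonneg[OF less_imp_le[OF W1[OF x]] less_imp_le[OF W2[OF x]]])
  qed
  \<comment> \<open>Both functions have the derivative \<open>T W\<close> in \<open>x\<close>, now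
    known to be common, and both start at 0. Hence the same \<open>x\<close> stands for the same
    \<open>t\<close>.\<close>
  have "\<exists>d. \<forall>x\<in>{0..1}. \<tau>1 x - \<tau>2 x = d"
  proof (rule has_field_derivative_zero_constant)
    show "((\<lambda>x. \<tau>1 x - \<tau>2 x) has_real_derivative 0) (at x within {0..1})" if "x \<in> {0..1}" for x
      using DERIV_diff[OF \<tau>1(4)[OF that] \<tau>2(4)[OF that]] W_eq[OF that] by simp
  qed simp
  then obtain d where d: "\<And>x. x \<in> {0..1} \<Longrightarrow> \<tau>1 x - \<tau>2 x = d" by blast
  have \<tau>_eq: "\<tau>1 x = \<tau>2 x" if "x \<in> {0..1}" for x
    using d[OF that] d[of 0] \<tau>1(1) \<tau>2(1) by simp
  show ?thesis
  proof
    fix t assume t: "t \<in> {0..L}"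
    have "continuous_on {0..1} \<tau>1" using \<tau>1(4) by (rule DERIV_continuous_on)
    then have "\<exists>x. 0 \<le> x \<and> x \<le> 1 \<and> \<tau>1 x = t" using \<tau>1(1,2) t by (intro IVT') auto
    then obtain x where x: "x \<in> {0..1}" "\<tau>1 x = t" by auto
    show "h1 t = h2 t" using h_eq[OF x(1)] c1[OF x(1)] \<tau>_eq[OF x(1)] x(2) by simp
  qed
qed

end
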